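(* Let $T$ be a complete first-order theory with monster model $\mathbb{M}$. For every sufficiently large cardinal $\kappa$ (i.e. there is a cardinal $\kappa_0$ such that for every cardinal $\kappa\ge\kappa_0$) the following holds. Let $\{X'_0,\ldots,X'_n\}$ be a collapsible family in $\omega^{<\kappa}$. Then there is a collapsible family $\{X_0,\ldots,X_{n+1}\}$ in $\omega^{<\kappa}$ such that there are $\chi\in X_{n+1}$ and $\chi'\trianglerighteq\chi$ with $X_0=\chi'^\frown X'_0,\ \ldots,\ X_n=\chi'^\frown X'_n$.
   Context: $\omega^{<\kappa}=\bigcup_{\alpha<\kappa}\omega^\alpha$. $\eta\trianglelefteq\nu$ means $\eta\subseteq\nu$; $\eta\perp\nu$ means incomparable; $\eta\wedge\nu$ is the largest common initial segment; $\eta<_{lex}\nu$ means $\eta\trianglelefteq\nu$, or $\eta\perp\nu$ and $\eta(l)<\nu(l)$ with $l$ the domain of $\eta\wedge\nu$; $\eta^\frown X=\{\eta^\frown x:x\in X\}$ (concatenation). Trees are structures in $\mathcal{L}_0=\{\trianglelefteq,<_{lex},\wedge\}$; $\bar\eta\sim_0\bar\nu$ means that the tuples have the same quantifier-free $\mathcal{L}_0$-type. Sets of indices written with $\sim_0$ are treated as tuples via fixed corresponding enumerations. An antichain is a set of pairwise incomparable elements. An antichain $X\subseteq\omega^{<\kappa}$ is universal if for each finite antichain $Y\subseteq\omega^{<\kappa}$ there is $X_0\subseteq X$ with $Y\sim_0X_0$. On an antichain $X$ consider the language $\mathcal{L}_\delta=\{\Delta,<_{lex}\}$, with $\Delta(\eta_0,\eta_1,\eta_2,\eta_3)$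 iff $\eta_0\wedge\eta_1\trianglelefteq\eta_2\wedge\eta_3$; $\bar\eta\sim_\delta\bar\nu$ means equal quantifier-free $\mathcal{L}_\delta$-types. A family $(a_\eta)_{\eta\in X}$ is $\delta$-indiscernible over $B$ if $\bar\eta\sim_\delta\bar\nu$ implies $\mathrm{tp}(a_{\bar\eta}/B)=\mathrm{tp}(a_{\bar\nu}/B)$. A tree $(a_\eta)$ is strongly indiscernible over $C$ if $\bar\eta\sim_0\bar\nu$ implies $\mathrm{tp}(a_{\bar\eta}/C)=\mathrm{tp}(a_{\bar\nu}/C)$. A formula $\varphi(y,z)$ witnesses ATP if there is $(c_\eta)_{\eta\in 2^{<\omega}}$ in $\mathbb{M}$ with $\{\varphi(y,c_\eta):\eta\in X\}$ consistent for every antichain $X\subseteq 2^{<\omega}$ and $\{\varphi(y,c_\eta),\varphi(y,c_\nu)\}$ inconsistent whenever $\eta\trianglelefteq\nu$, $\eta\ne\nu$. Let $X_0,\ldots,X_n\subseteq\omega^{<\kappa}$ be universal antichains with $|X_0|=\dots=|X_n|$ and $X_0\sim_0\dots\sim_0X_n$. They are collapsible (form a collapsible family) if: for any set $C\subseteq\mathbb{M}$, any $b\in\mathbb{M}$, any tree $(a_\eta)_{\eta\in\omega^{<\kappa}}$ strongly indiscernible over $C$, and any $i\le n$, if $(a_\eta)_{\eta\in X_i}$ is $\delta$-indiscernible over $bC$, then either $\bigcup_{j\le n}p(y,(a_\eta)_{\eta\in X_j})$ is consistent, where $p(y,\bar z)=\mathrm{tp}(b,(a_\eta)_{\eta\in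 X_i}/C)$, or there is a formula with free (object) variable $y$ which witnesses ATP. *)

theory Defs
  imports "HOL-Library.Sublist"
begin

unbundle cardinal_syntax

section \<open>First-order logic\<close>

text \<open>A symbol is a name together with an arity. Free variables are named (type \<open>'v\<close>), bound
  variables are de Bruijn indices, so that renaming free variables by \<open>map_fm\<close> never captures.
  Parameters from a structure are treated as free variables that denote themselves.\<close>

record ('f, 'p) lang =
  funs :: "('f \<times> nat) set"
  rels :: "('p \<times> nat) set"

datatype (tm_funs: 'f, tm_vars: 'v) tm =
  Free 'v | Bound nat | Fn 'f "('f, 'v) tm list"

datatype (fm_funs: 'f, fm_rels: 'p, fm_vars: 'v) fm =
  Eq "('f, 'v) tm" "('f, 'v) tm"
| Rel 'p "('f, 'v) tm list"
| Neg "('f, 'p, 'v) fm"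
| Conj "('f, 'p, 'v) fm" "('f, 'p, 'v) fm"
| Ex "('f, 'p, 'v) fm"

fun wf_tm :: "('f, 'p) lang \<Rightarrow> nat \<Rightarrow> ('f, 'v) tm \<Rightarrow> bool" where
  "wf_tm L k (Free v) \<longleftrightarrow> True"
| "wf_tm L k (Bound i) \<longleftrightarrow> i < k"
| "wf_tm L k (Fn f ts) \<longleftrightarrow> (f, length ts) \<in> funs L \<and> (\<forall>t\<in>set ts. wf_tm L k t)"

fun wf_fm :: "('f, 'p) lang \<Rightarrow> nat \<Rightarrow> ('f, 'p, 'v) fm \<Rightarrow> bool" where
  "wf_fm L k (Eq s t) \<longleftrightarrow> wf_tm L k s \<and> wf_tm L k t"
| "wf_fm L k (Rel R ts) \<longleftrightarrow> (R, length ts) \<in> rels L \<and> (\<forall>t\<in>set ts. wf_tm L k t)"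
| "wf_fm L k (Neg \<phi>) \<longleftrightarrow> wf_fm L k \<phi>"
| "wf_fm L k (Conj \<phi> \<psi>) \<longleftrightarrow> wf_fm L k \<phi> \<and> wf_fm L k \<psi>"
| "wf_fm L k (Ex \<phi>) \<longleftrightarrow> wf_fm L (Suc k) \<phi>"

fun qfree :: "('f, 'p, 'v) fm \<Rightarrow> bool" where
  "qfree (Eq s t) \<longleftrightarrow> True"
| "qfree (Rel R ts) \<longleftrightarrow> True"
| "qfree (Neg \<phi>) \<longleftrightarrow> qfree \<phi>"
| "qfree (Conj \<phi> \<psi>) \<longleftrightarrow> qfree \<phi> \<and> qfree \<psi>"
| "qfree (Ex \<phi>) \<longleftrightarrow> False"

definition formulas :: "('f, 'p) lang \<Rightarrow> 'v set \<Rightarrow> ('f, 'p, 'v) fm set" where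
  "formulas L V = {\<phi>. wf_fm L 0 \<phi> \<and> fm_vars \<phi> \<subseteq> V}"

record ('f, 'p, 'm) struct =
  univ :: "'m set"
  fn :: "'f \<Rightarrow> 'm list \<Rightarrow> 'm"
  rl :: "'p \<Rightarrow> 'm list \<Rightarrow> bool"

definition is_struct :: "('f, 'p) lang \<Rightarrow> ('f, 'p, 'm) struct \<Rightarrow> bool" where
  "is_struct L M \<longleftrightarrow> univ M \<noteq> {} \<and>
     (\<forall>(f, n)\<in>funs L. \<forall>xs. length xs = n \<and> set xs \<subseteq> univ M \<longrightarrow> fn M f xs \<in> univ M)"

text \<open>Here \<open>xs\<close> lists the values of the bound variables in scope and \<open>e\<close> gives the values of the
  free variables.\<close>

fun tm_val :: "('f, 'p, 'm) struct \<Rightarrow> 'm list \<Rightarrow> ('v \<Rightarrow> 'm) \<Rightarrow> ('f, 'v) tm \<Rightarrow> 'm" where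
  "tm_val M xs e (Free v) = e v"
| "tm_val M xs e (Bound i) = xs ! i"
| "tm_val M xs e (Fn f ts) = fn M f (map (tm_val M xs e) ts)"

fun sat :: "('f, 'p, 'm) struct \<Rightarrow> 'm list \<Rightarrow> ('v \<Rightarrow> 'm) \<Rightarrow> ('f, 'p, 'v) fm \<Rightarrow> bool" where
  "sat M xs e (Eq s t) \<longleftrightarrow> tm_val M xs e s = tm_val M xs e t"
| "sat M xs e (Rel R ts) \<longleftrightarrow> rl M R (map (tm_val M xs e) ts)"
| "sat M xs e (Neg \<phi>) \<longleftrightarrow> \<not> sat M xs e \<phi>"
| "sat M xs e (Conj \<phi> \<psi>) \<longleftrightarrow> sat M xs e \<phi> \<and> sat M xs e \<psi>"
| "sat M xs e (Ex \<phi>) \<longleftrightarrow> (\<exists>x\<in>univ M. sat M (x # xs) e \<phi>)"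

text \<open>The (quantifier-free) type of a tuple \<open>(a i)\<^sub>i\<^sub>\<in>\<^sub>I\<close>. In types over \<open>C\<close> the variable
  \<open>Inl i\<close> stands for the \<open>i\<close>-th coordinate and \<open>Inr c\<close> for the parameter \<open>c\<close>.\<close>

definition qftp :: "('f, 'p) lang \<Rightarrow> ('f, 'p, 'm) struct \<Rightarrow> 'i set \<Rightarrow> ('i \<Rightarrow> 'm) \<Rightarrow> ('f, 'p, 'i) fm set" where
  "qftp L M I a = {\<phi> \<in> formulas L I. qfree \<phi> \<and> sat M [] a \<phi>}"

definition tp :: "('f, 'p) lang \<Rightarrow> ('f, 'p, 'm) struct \<Rightarrow> 'm set \<Rightarrow> 'i set \<Rightarrow> ('i \<Rightarrow> 'm)
    \<Rightarrow> ('f, 'p, 'i + 'm) fm set" where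
  "tp L M C I a = {\<phi> \<in> formulas L (I <+> C). sat M [] (case_sum a id) \<phi>}"

text \<open>Consistency of a set of formulas in the variables \<open>Inl 0, \<dots>, Inl (m - 1)\<close> with parameters
  from \<open>M\<close>, that is, consistency with the elementary diagram of \<open>M\<close>.\<close>

definition consistent :: "('f, 'p, 'm) struct \<Rightarrow> nat \<Rightarrow> ('f, 'p, nat + 'm) fm set \<Rightarrow> bool" where
  "consistent M m \<Sigma> \<longleftrightarrow> (\<forall>\<Sigma>0 \<subseteq> \<Sigma>. finite \<Sigma>0 \<longrightarrow>
     (\<exists>b. b ` {..<m} \<subseteq> univ M \<and> (\<forall>\<phi>\<in>\<Sigma>0. sat M [] (case_sum b id) \<phi>)))"

definition models :: "('f, 'p) lang \<Rightarrow> ('f, 'p, 'm) struct \<Rightarrow> ('f, 'p, nat) fm set \<Rightarrow> bool" where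
  "models L M T \<longleftrightarrow> is_struct L M \<and> (\<forall>\<sigma>\<in>T. \<forall>e. sat M [] e \<sigma>)"

text \<open>By the downward Loewenheim-Skolem theorem it suffices, for satisfiability and entailment, to
  look at models whose universe lies in a type of size at least \<open>|L| + \<aleph>\<^sub>0\<close>; the type of
  formulas is such a type.\<close>

definition entails :: "('f, 'p) lang \<Rightarrow> ('f, 'p, nat) fm set \<Rightarrow> ('f, 'p, nat) fm \<Rightarrow> bool" where
  "entails L T \<sigma> \<longleftrightarrow>
     (\<forall>N :: ('f, 'p, ('f, 'p, nat) fm) struct. models L N T \<longrightarrow> models L N {\<sigma>})"

definition complete_theory :: "('f, 'p) lang \<Rightarrow> ('f, 'p, nat) fm set \<Rightarrow> bool" where
  "complete_theory L T \<longleftrightarrow> T \<subseteq> formulas L {} \<and>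
     (\<exists>N :: ('f, 'p, ('f, 'p, nat) fm) struct. models L N T) \<and>
     (\<forall>\<sigma> \<in> formulas L {}. entails L T \<sigma> \<or> entails L T (Neg \<sigma>))"

section \<open>Monster models\<close>

definition saturated :: "('f, 'p) lang \<Rightarrow> 'l rel \<Rightarrow> ('f, 'p, 'm) struct \<Rightarrow> bool" where
  "saturated L \<mu> M \<longleftrightarrow> (\<forall>A \<subseteq> univ M. |A| <o \<mu> \<longrightarrow>
     (\<forall>\<Sigma> \<subseteq> formulas L ({..<1} <+> A). consistent M 1 \<Sigma> \<longrightarrow>
        (\<exists>x\<in>univ M. \<forall>\<phi>\<in>\<Sigma>. sat M [] (case_sum (\<lambda>_. x) id) \<phi>)))"

definition automorphism :: "('f, 'p) lang \<Rightarrow> ('f, 'p, 'm) struct \<Rightarrow> ('m \<Rightarrow> 'm) \<Rightarrow> bool" where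
  "automorphism L M g \<longleftrightarrow> bij_betw g (univ M) (univ M) \<and>
     (\<forall>(f, n)\<in>funs L. \<forall>xs. length xs = n \<and> set xs \<subseteq> univ M \<longrightarrow> g (fn M f xs) = fn M f (map g xs)) \<and>
     (\<forall>(R, n)\<in>rels L. \<forall>xs. length xs = n \<and> set xs \<subseteq> univ M \<longrightarrow> rl M R (map g xs) = rl M R xs)"

definition strongly_homogeneous :: "('f, 'p) lang \<Rightarrow> 'l rel \<Rightarrow> ('f, 'p, 'm) struct \<Rightarrow> bool" where
  "strongly_homogeneous L \<mu> M \<longleftrightarrow> (\<forall>A h. A \<subseteq> univ M \<and> |A| <o \<mu> \<and> h ` A \<subseteq> univ M \<and>
     (\<forall>\<phi> \<in> formulas L A. sat M [] id \<phi> \<longleftrightarrow> sat M [] h \<phi>) \<longrightarrow>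
       (\<exists>g. automorphism L M g \<and> (\<forall>x\<in>A. g x = h x)))"

text \<open>\<open>\<mu>\<close> is the bound below which sets count as small.\<close>

definition monster_model ::
  "('f, 'p) lang \<Rightarrow> ('f, 'p, nat) fm set \<Rightarrow> 'l rel \<Rightarrow> ('f, 'p, 'm) struct \<Rightarrow> bool" where
  "monster_model L T \<mu> M \<longleftrightarrow> models L M T \<and> Card_order \<mu> \<and>
     |formulas L (UNIV :: nat set) :: ('f, 'p, nat) fm set| <o \<mu> \<and>
     saturated L \<mu> M \<and> strongly_homogeneous L \<mu> M"

section \<open>The tree of sequences of length less than a cardinal\<close>

text \<open>A cardinal is a cardinal order \<open>\<kappa>\<close>; the ordinals \<open>\<alpha> < \<kappa>\<close> are the sets \<open>underS \<kappa> k\<close> for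
  \<open>k \<in> Field \<kappa>\<close>, and a sequence is a partial map with such a domain.\<close>

type_synonym 'k seq = "'k \<rightharpoonup> nat"

definition tree :: "'k rel \<Rightarrow> 'k seq set" where
  "tree \<kappa> = {\<eta>. \<exists>k\<in>Field \<kappa>. dom \<eta> = underS \<kappa> k}"

definition incomparable :: "'k seq \<Rightarrow> 'k seq \<Rightarrow> bool" where
  "incomparable \<eta> \<nu> \<longleftrightarrow> \<not> \<eta> \<subseteq>\<^sub>m \<nu> \<and> \<not> \<nu> \<subseteq>\<^sub>m \<eta>"

definition meet :: "'k rel \<Rightarrow> 'k seq \<Rightarrow> 'k seq \<Rightarrow> 'k seq" where
  "meet \<kappa> \<eta> \<nu> = \<eta> |` {i. \<forall>j\<in>under \<kappa> i. j \<in> dom \<eta> \<and> \<eta> j = \<nu> j}"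

definition lexle :: "'k rel \<Rightarrow> 'k seq \<Rightarrow> 'k seq \<Rightarrow> bool" where
  "lexle \<kappa> \<eta> \<nu> \<longleftrightarrow> \<eta> \<subseteq>\<^sub>m \<nu> \<or> incomparable \<eta> \<nu> \<and>
     (\<exists>l\<in>Field \<kappa>. dom (meet \<kappa> \<eta> \<nu>) = underS \<kappa> l \<and> the (\<eta> l) < the (\<nu> l))"

text \<open>Concatenation: the end-extension of \<open>\<eta>\<close> whose part beyond \<open>dom \<eta>\<close> is an order-isomorphic
  copy of \<open>\<nu>\<close>. It exists and is unique when \<open>\<kappa>\<close> is infinite.\<close>

definition cat :: "'k rel \<Rightarrow> 'k seq \<Rightarrow> 'k seq \<Rightarrow> 'k seq" where
  "cat \<kappa> \<eta> \<nu> = (THE \<rho>. \<rho> \<in> tree \<kappa> \<and> \<eta> \<subseteq>\<^sub>m \<rho> \<and>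
     (\<exists>h. bij_betw h (dom \<nu>) (dom \<rho> - dom \<eta>) \<and>
          (\<forall>i\<in>dom \<nu>. \<forall>j\<in>dom \<nu>. (i, j) \<in> \<kappa> \<longleftrightarrow> (h i, h j) \<in> \<kappa>) \<and>
          (\<forall>i\<in>dom \<nu>. \<rho> (h i) = \<nu> i)))"

datatype meet_sym = Meet
datatype tree_rel = Initial | TreeLex
datatype delta_rel = Delta | DeltaLex

definition L0 :: "(meet_sym, tree_rel) lang" where
  "L0 = \<lparr>funs = {(Meet, 2)}, rels = {(Initial, 2), (TreeLex, 2)}\<rparr>"

definition tree_struct :: "'k rel \<Rightarrow> (meet_sym, tree_rel, 'k seq) struct" where
  "tree_struct \<kappa> = \<lparr>univ = tree \<kappa>,
     fn = (\<lambda>_ xs. meet \<kappa> (xs ! 0) (xs ! 1)),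
     rl = (\<lambda>R xs. case R of
         Initial \<Rightarrow> xs ! 0 \<subseteq>\<^sub>m xs ! 1
       | TreeLex \<Rightarrow> lexle \<kappa> (xs ! 0) (xs ! 1))\<rparr>"

text \<open>The language of antichains is relational; the type of function symbol names is a dummy.\<close>

definition L\<delta> :: "(unit, delta_rel) lang" where
  "L\<delta> = \<lparr>funs = {}, rels = {(Delta, 4), (DeltaLex, 2)}\<rparr>"

definition delta_struct :: "'k rel \<Rightarrow> 'k seq set \<Rightarrow> (unit, delta_rel, 'k seq) struct" where
  "delta_struct \<kappa> X = \<lparr>univ = X,
     fn = (\<lambda>_. undefined),
     rl = (\<lambda>R xs. case R of
         Delta \<Rightarrow> meet \<kappa> (xs ! 0) (xs ! 1) \<subseteq>\<^sub>m meet \<kappa> (xs ! 2) (xs ! 3)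
       | DeltaLex \<Rightarrow> lexle \<kappa> (xs ! 0) (xs ! 1))\<rparr>"

definition sim0 :: "'k rel \<Rightarrow> 'i set \<Rightarrow> ('i \<Rightarrow> 'k seq) \<Rightarrow> ('i \<Rightarrow> 'k seq) \<Rightarrow> bool" where
  "sim0 \<kappa> I \<eta> \<nu> \<longleftrightarrow> qftp L0 (tree_struct \<kappa>) I \<eta> = qftp L0 (tree_struct \<kappa>) I \<nu>"

definition sim_delta :: "'k rel \<Rightarrow> 'k seq set \<Rightarrow> 'i set \<Rightarrow> ('i \<Rightarrow> 'k seq) \<Rightarrow> ('i \<Rightarrow> 'k seq) \<Rightarrow> bool" where
  "sim_delta \<kappa> X I \<eta> \<nu> \<longleftrightarrow> qftp L\<delta> (delta_struct \<kappa> X) I \<eta> = qftp L\<delta> (delta_struct \<kappa> X) I \<nu>"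

definition antichain :: "'k rel \<Rightarrow> 'k seq set \<Rightarrow> bool" where
  "antichain \<kappa> X \<longleftrightarrow> X \<subseteq> tree \<kappa> \<and> (\<forall>\<eta>\<in>X. \<forall>\<nu>\<in>X. \<eta> \<noteq> \<nu> \<longrightarrow> incomparable \<eta> \<nu>)"

definition universal_antichain :: "'k rel \<Rightarrow> 'k seq set \<Rightarrow> bool" where
  "universal_antichain \<kappa> X \<longleftrightarrow> antichain \<kappa> X \<and>
     (\<forall>Y. antichain \<kappa> Y \<and> finite Y \<longrightarrow> (\<exists>h. h ` Y \<subseteq> X \<and> sim0 \<kappa> Y id h))"

section \<open>Indiscernibility, ATP and collapsible families\<close>

text \<open>Members of a family are tuples of a common finite length \<open>d\<close>: \<open>a \<eta> i\<close> is the \<open>i\<close>-th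
  coordinate of \<open>a\<^sub>\<eta>\<close>, for \<open>i < d\<close>. The tuple \<open>a\<^sub>\<eta>\<^sub>0 \<dots> a\<^sub>\<eta>\<^sub>n\<^sub>-\<^sub>1\<close> is indexed by \<open>{..<n} \<times> {..<d}\<close>.\<close>

definition strongly_indiscernible :: "('f, 'p) lang \<Rightarrow> ('f, 'p, 'm) struct \<Rightarrow> 'k rel \<Rightarrow> nat \<Rightarrow> 'm set
    \<Rightarrow> ('k seq \<Rightarrow> nat \<Rightarrow> 'm) \<Rightarrow> bool" where
  "strongly_indiscernible L M \<kappa> d C a \<longleftrightarrow>
     (\<forall>n (\<eta> :: nat \<Rightarrow> 'k seq) \<nu>. \<eta> ` {..<n} \<subseteq> tree \<kappa> \<and> \<nu> ` {..<n} \<subseteq> tree \<kappa> \<and> sim0 \<kappa> {..<n} \<eta> \<nu> \<longrightarrow>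
        tp L M C ({..<n} \<times> {..<d}) (\<lambda>(s, i). a (\<eta> s) i) =
        tp L M C ({..<n} \<times> {..<d}) (\<lambda>(s, i). a (\<nu> s) i))"

definition delta_indiscernible :: "('f, 'p) lang \<Rightarrow> ('f, 'p, 'm) struct \<Rightarrow> 'k rel \<Rightarrow> nat \<Rightarrow> 'm set
    \<Rightarrow> 'k seq set \<Rightarrow> ('k seq \<Rightarrow> nat \<Rightarrow> 'm) \<Rightarrow> bool" where
  "delta_indiscernible L M \<kappa> d B X a \<longleftrightarrow>
     (\<forall>n (\<eta> :: nat \<Rightarrow> 'k seq) \<nu>. \<eta> ` {..<n} \<subseteq> X \<and> \<nu> ` {..<n} \<subseteq> X \<and> sim_delta \<kappa> X {..<n} \<eta> \<nu> \<longrightarrow>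
        tp L M B ({..<n} \<times> {..<d}) (\<lambda>(s, i). a (\<eta> s) i) =
        tp L M B ({..<n} \<times> {..<d}) (\<lambda>(s, i). a (\<nu> s) i))"

text \<open>\<open>\<phi>(y, z)\<close> with \<open>|y| = m\<close> and \<open>|z| = k\<close>: the variables are \<open>Inl i\<close> (for \<open>y\<close>) and \<open>Inr i\<close>
  (for \<open>z\<close>). The tree \<open>2\<^sup><\<^sup>\<omega>\<close> is \<open>bool list\<close> ordered by \<open>prefix\<close>.\<close>

definition inst :: "('f, 'p, nat + nat) fm \<Rightarrow> (nat \<Rightarrow> 'm) \<Rightarrow> ('f, 'p, nat + 'm) fm" where
  "inst \<phi> c = map_fm id id (map_sum id c) \<phi>"

definition witnesses_ATP :: "('f, 'p) lang \<Rightarrow> ('f, 'p, 'm) struct \<Rightarrow> nat \<Rightarrow> nat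
    \<Rightarrow> ('f, 'p, nat + nat) fm \<Rightarrow> bool" where
  "witnesses_ATP L M m k \<phi> \<longleftrightarrow> \<phi> \<in> formulas L ({..<m} <+> {..<k}) \<and>
     (\<exists>c :: bool list \<Rightarrow> nat \<Rightarrow> 'm. (\<forall>\<eta>. c \<eta> ` {..<k} \<subseteq> univ M) \<and>
        (\<forall>X. (\<forall>\<eta>\<in>X. \<forall>\<nu>\<in>X. \<eta> \<noteq> \<nu> \<longrightarrow> \<not> prefix \<eta> \<nu>) \<longrightarrow> consistent M m {inst \<phi> (c \<eta>) |\<eta>. \<eta> \<in> X}) \<and>
        (\<forall>\<eta> \<nu>. prefix \<eta> \<nu> \<and> \<eta> \<noteq> \<nu> \<longrightarrow> \<not> consistent M m {inst \<phi> (c \<eta>), inst \<phi> (c \<nu>)}))"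

text \<open>\<open>tp(b, (a\<^sub>X\<^sub>(\<^sub>t\<^sub>))\<^sub>t\<^sub>\<in>\<^sub>I / C)\<close>, where \<open>X\<close> enumerates an index set along \<open>I\<close>. The
  variable \<open>y\<^sub>i\<close> is \<open>Inl (Inl i)\<close>, the \<open>i\<close>-th coordinate of \<open>z\<^sub>t\<close> is \<open>Inl (Inr (t, i))\<close>.\<close>

definition joint_tp :: "('f, 'p) lang \<Rightarrow> ('f, 'p, 'm) struct \<Rightarrow> 'm set \<Rightarrow> nat \<Rightarrow> (nat \<Rightarrow> 'm) \<Rightarrow> nat
    \<Rightarrow> ('k seq \<Rightarrow> nat \<Rightarrow> 'm) \<Rightarrow> 'i set \<Rightarrow> ('i \<Rightarrow> 'k seq) \<Rightarrow> ('f, 'p, (nat + 'i \<times> nat) + 'm) fm set" where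
  "joint_tp L M C m b d a I X =
     tp L M C ({..<m} <+> I \<times> {..<d}) (case_sum b (\<lambda>(t, i). a (X t) i))"

text \<open>\<open>p(y, (a\<^sub>X\<^sub>(\<^sub>t\<^sub>))\<^sub>t\<^sub>\<in>\<^sub>I)\<close>: the variables \<open>z\<^sub>t\<close> are replaced by parameters.\<close>

definition plug :: "('k seq \<Rightarrow> nat \<Rightarrow> 'm) \<Rightarrow> ('i \<Rightarrow> 'k seq)
    \<Rightarrow> ('f, 'p, (nat + 'i \<times> nat) + 'm) fm set \<Rightarrow> ('f, 'p, nat + 'm) fm set" where
  "plug a X p =
     map_fm id id (case_sum (case_sum Inl (\<lambda>(t, i). Inr (a (X t) i))) Inr) ` p"

text \<open>A family of antichains comes with corresponding enumerations: the \<open>j\<close>-th antichain is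
  \<open>X j ` I\<close>, and the element \<open>X j t\<close> corresponds to \<open>X j' t\<close>.\<close>

definition collapsible :: "('f, 'p) lang \<Rightarrow> ('f, 'p, 'm) struct \<Rightarrow> 'k rel \<Rightarrow> nat \<Rightarrow> 'i set
    \<Rightarrow> (nat \<Rightarrow> 'i \<Rightarrow> 'k seq) \<Rightarrow> bool" where
  "collapsible L M \<kappa> n I X \<longleftrightarrow>
     (\<forall>j\<le>n. universal_antichain \<kappa> (X j ` I) \<and> inj_on (X j) I \<and> sim0 \<kappa> I (X 0) (X j)) \<and>
     (\<forall>C m b d a. \<forall>i\<le>n.
        C \<subseteq> univ M \<and> b ` {..<m} \<subseteq> univ M \<and> (\<forall>\<eta>\<in>tree \<kappa>. a \<eta> ` {..<d} \<subseteq> univ M) \<and>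
        strongly_indiscernible L M \<kappa> d C a \<and>
        delta_indiscernible L M \<kappa> d (b ` {..<m} \<union> C) (X i ` I) a \<longrightarrow>
          consistent M m (\<Union>j\<le>n. plug a (X j) (joint_tp L M C m b d a I (X i))) \<or>
          (\<exists>k \<phi>. witnesses_ATP L M m k \<phi>))"

end

theory Submission
  imports Defs "HOL-Library.Ramsey"
begin

text \<open>Put \<open>\<chi> = X' 0 t0\<close>, \<open>\<chi>' = \<chi>\<close> extended by \<open>0\<close>, \<open>X j = \<chi>'\<close> followed by \<open>X' j\<close> for
  \<open>j \<le> n\<close>, and \<open>X (n + 1) = X' 0\<close>; this works for every infinite \<open>\<kappa>\<close>. Suppose that no formula witnesses
  ATP. A finite part of \<open>p(y, a) \<union> p(y, a above \<chi>)\<close> is consistent, as otherwise copies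
  of it, placed along \<open>2\<^sup><\<^sup>\<omega>\<close> with each one above the point \<open>\<chi>\<close> of all its predecessors, would witness
  ATP: antichains of copies embed into the universal antichain on which \<open>b\<close> realizes \<open>p\<close>. By
  Ramsey's theorem for finite antichains and saturation there is then a \<open>b'\<close> that realizes
  \<open>p\<close> on \<open>X (n + 1)\<close> and on \<open>X 0\<close>, and over which together with finitely many parameters from
  \<open>X (n + 1)\<close> the antichain \<open>X 0\<close> is still \<open>\<delta>\<close>-indiscernible. The tree above \<open>\<chi>'\<close> is
  strongly indiscernible over these parameters, so collapsibility of the given family, applied to the type of
  \<open>b'\<close> over them, yields the conclusion.\<close>

section \<open>The tree of sequences\<close>

text \<open>Compactness alone gives a tuple that realizes p on two antichains, but the given family
  can only be applied to a tuple over which an antichain of the shifted tree is indiscernible. So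
  the indiscernibility is written into the type to be realized, as a set of equivalences, and a
  Ramsey theorem makes its finite parts consistent. There the order of choice is the obstacle: the
  finite antichain \<open>Z\<close> must be fixed before the colouring, because the colouring is
  read off a tuple that already realizes p on copies inside \<open>Z\<close>. The extra entry 0 puts
  \<chi>' strictly above \<chi>, so no member of X (n + 1) lies above \<chi>'. Then the relations of
  a point over \<chi>' to X (n + 1) depend on \<chi> only; this gives both the strong
  indiscernibility of the shifted tree and the fact that all comparable pairs of copies in the
  binary tree look alike. The set C has no bound on its size, while saturation needs small sets.
  Consistency being finitary, C is first cut down to a finite set, which can also be absorbed into
  the parameters of a formula witnessing ATP.\<close>

locale card_tree =
  fixes \<kappa> :: "'k rel"
  assumes card: "Card_order \<kappa>" and inf: "infinite (Field \<kappa>)"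
begin

lemma wo: "Well_order \<kappa>"
  using card card_order_on_well_order_on by blast

sublocale wo: wo_rel \<kappa>
  by unfold_locales (rule wo)

abbreviation tr :: "'k seq set" where "tr \<equiv> tree \<kappa>"
abbreviation mt :: "'k seq \<Rightarrow> 'k seq \<Rightarrow> 'k seq" where "mt \<equiv> meet \<kappa>"
abbreviation lx :: "'k seq \<Rightarrow> 'k seq \<Rightarrow> bool" where "lx \<equiv> lexle \<kappa>"

lemma dom_subset_Field: "\<eta> \<in> tr \<Longrightarrow> dom \<eta> \<subseteq> Field \<kappa>"
  unfolding tree_def using underS_Field by fastforce

lemma tree_iff: "\<eta> \<in> tr \<longleftrightarrow> wo.ofilter (dom \<eta>) \<and> dom \<eta> \<noteq> Field \<kappa>"
proof
  assume "\<eta> \<in> tr"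
  then obtain k where k: "k \<in> Field \<kappa>" "dom \<eta> = underS \<kappa> k" by (auto simp: tree_def)
  have "k \<notin> underS \<kappa> k" by (simp add: underS_def)
  then show "wo.ofilter (dom \<eta>) \<and> dom \<eta> \<noteq> Field \<kappa>" using k wo.underS_ofilter by auto
next
  assume "wo.ofilter (dom \<eta>) \<and> dom \<eta> \<noteq> Field \<kappa>"
  then show "\<eta> \<in> tr" using wo.ofilter_underS_Field unfolding tree_def by blast
qed

lemma dom_down: "\<lbrakk>\<eta> \<in> tr; i \<in> dom \<eta>; (j, i) \<in> \<kappa>\<rbrakk> \<Longrightarrow> j \<in> dom \<eta>"
  unfolding tree_iff wo.ofilter_def under_def by blast

lemma tree_subset:
  assumes "\<nu> \<in> tr" "dom \<eta> \<subseteq> dom \<nu>" "\<And>i j. i \<in> dom \<eta> \<Longrightarrow> (j, i) \<in> \<kappa> \<Longrightarrow> j \<in> dom \<eta>"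
  shows "\<eta> \<in> tr"
proof -
  have "dom \<nu> \<subset> Field \<kappa>" using assms(1) tree_iff dom_subset_Field by blast
  then show ?thesis using assms unfolding tree_iff wo.ofilter_def under_def by blast
qed

lemma linear: "i \<in> Field \<kappa> \<Longrightarrow> j \<in> Field \<kappa> \<Longrightarrow> i = j \<or> i \<in> underS \<kappa> j \<or> j \<in> underS \<kappa> i"
  using wo.TOTALS unfolding underS_def by blast

lemma underS_trans: "i \<in> underS \<kappa> j \<Longrightarrow> j \<in> underS \<kappa> k \<Longrightarrow> i \<in> underS \<kappa> k"
  using wo.TRANS wo.ANTISYM unfolding underS_def trans_def antisym_def by blast

lemma dom_downS: "\<lbrakk>\<eta> \<in> tr; i \<in> dom \<eta>; j \<in> underS \<kappa> i\<rbrakk> \<Longrightarrow> j \<in> dom \<eta>"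
  using dom_down unfolding underS_def by blast

text \<open>The first coordinate of disagreement. \<open>incomparable\<close>, \<open>meet\<close>
  and \<open>lexle\<close> are given by three unrelated conditions; through \<open>splits\<close>
  each becomes a computation at this one coordinate.\<close>

definition splits :: "'k seq \<Rightarrow> 'k seq \<Rightarrow> 'k \<Rightarrow> bool" where
  "splits \<eta> \<nu> l \<longleftrightarrow> l \<in> dom \<eta> \<and> l \<in> dom \<nu> \<and> \<eta> l \<noteq> \<nu> l \<and> (\<forall>j\<in>underS \<kappa> l. \<eta> j = \<nu> j)"

lemma splits_sym: "splits \<eta> \<nu> l \<Longrightarrow> splits \<nu> \<eta> l"
  by (auto simp: splits_def)

text \<open>The sequences are compared as total functions into options, so that the end of a
  sequence counts as a disagreement. At the least disagreement \<open>l\<close>, a sequence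
  undefined at \<open>l\<close> is an initial segment of the other one; if both are defined, they
  split there.\<close>

lemma tree_cases:
  assumes "\<eta> \<in> tr" "\<nu> \<in> tr"
  obtains "\<eta> \<subseteq>\<^sub>m \<nu>" | "\<nu> \<subseteq>\<^sub>m \<eta>" | l where "splits \<eta> \<nu> l"
proof (cases "\<eta> = \<nu>")
  case True
  then show ?thesis using that(1) by simp
next
  case False
  define D where "D = {i \<in> Field \<kappa>. \<eta> i \<noteq> \<nu> i}"
  obtain i where i: "\<eta> i \<noteq> \<nu> i" using False by blast
  then have "i \<in> dom \<eta> \<union> dom \<nu>" by (metis UnI1 UnI2 domIff)
  then have "D \<noteq> {}" using i assms dom_subset_Field unfolding D_def by blast
  define l where "l = wo.minim D"
  have D: "D \<subseteq> Field \<kappa>" by (auto simp: D_def)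
  have l: "l \<in> D" unfolding l_def using wo.minim_in[OF D \<open>D \<noteq> {}\<close>] .
  have ll: "\<eta> j = \<nu> j" if "j \<in> underS \<kappa> l" for j
  proof (rule ccontr)
    assume "\<eta> j \<noteq> \<nu> j"
    moreover have "j \<in> Field \<kappa>" using that underS_Field by fastforce
    ultimately have "j \<in> D" by (simp add: D_def)
    then have "(l, j) \<in> \<kappa>" unfolding l_def using wo.minim_least[OF D] by blast
    then show False using that wo.ANTISYM unfolding underS_def antisym_def by blast
  qed
  have sub: "\<alpha> \<subseteq>\<^sub>m \<beta>" if ab: "\<alpha> \<in> tr" "l \<notin> dom \<alpha>" "\<And>j. j \<in> underS \<kappa> l \<Longrightarrow> \<alpha> j = \<beta> j" for \<alpha> \<beta>
  proof (unfold map_le_def, intro ballI)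
    fix j assume j: "j \<in> dom \<alpha>"
    then have "j \<in> Field \<kappa>" using ab dom_subset_Field by blast
    then have "j \<in> underS \<kappa> l" using linear[of j l] l D j ab(1,2) dom_downS by blast
    then show "\<alpha> j = \<beta> j" using ab by blast
  qed
  consider "l \<notin> dom \<eta>" | "l \<notin> dom \<nu>" | "l \<in> dom \<eta>" "l \<in> dom \<nu>" by blast
  then show ?thesis
  proof cases
    case 1
    then show ?thesis using that(1) sub[OF assms(1)] ll by blast
  next
    case 2
    then show ?thesis using that(2) sub[OF assms(2)] ll by fastforce
  next
    case 3
    then show ?thesis using that(3)[of l] ll l unfolding splits_def D_def by blast
  qed
qed

lemma splits_incomparable: "splits \<eta> \<nu> l \<Longrightarrow> incomparable \<eta> \<nu>"
  unfolding splits_def incomparable_def map_le_def by force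

lemma incomparable_iff: "\<eta> \<in> tr \<Longrightarrow> \<nu> \<in> tr \<Longrightarrow> incomparable \<eta> \<nu> \<longleftrightarrow> (\<exists>l. splits \<eta> \<nu> l)"
  by (metis splits_incomparable tree_cases incomparable_def)

lemma incomparable_sym: "incomparable \<eta> \<nu> \<Longrightarrow> incomparable \<nu> \<eta>"
  by (auto simp: incomparable_def)

lemma meet_le1: "mt \<eta> \<nu> \<subseteq>\<^sub>m \<eta>"
proof (unfold map_le_def, intro ballI)
  fix i assume "i \<in> dom (mt \<eta> \<nu>)"
  then show "mt \<eta> \<nu> i = \<eta> i" by (simp add: meet_def dom_restrict)
qed

lemma dom_meet: "\<eta> \<in> tr \<Longrightarrow> dom (mt \<eta> \<nu>) = {i \<in> dom \<eta>. \<forall>j. (j, i) \<in> \<kappa> \<longrightarrow> \<eta> j = \<nu> j}"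
proof -
  assume "\<eta> \<in> tr"
  then have "j \<in> dom \<eta>" if "i \<in> dom \<eta>" "(j, i) \<in> \<kappa>" for i j using dom_down that by blast
  then show ?thesis unfolding meet_def under_def by (auto simp only: dom_restrict)
qed

lemma meet_le2: "\<eta> \<in> tr \<Longrightarrow> mt \<eta> \<nu> \<subseteq>\<^sub>m \<nu>"
proof (unfold map_le_def, intro ballI)
  fix i assume e: "\<eta> \<in> tr" and i: "i \<in> dom (mt \<eta> \<nu>)"
  then have i': "i \<in> dom \<eta>" "\<And>j. (j, i) \<in> \<kappa> \<Longrightarrow> \<eta> j = \<nu> j" unfolding dom_meet[OF e] by auto
  then have "(i, i) \<in> \<kappa>" using wo.REFL dom_subset_Field[OF e] unfolding refl_on_def by blast
  then have "\<eta> i = \<nu> i" by (rule i'(2))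
  moreover have "mt \<eta> \<nu> i = \<eta> i" using i meet_le1 unfolding map_le_def by blast
  ultimately show "mt \<eta> \<nu> i = \<nu> i" by simp
qed

lemma meet_tree: "\<eta> \<in> tr \<Longrightarrow> mt \<eta> \<nu> \<in> tr"
proof -
  assume e: "\<eta> \<in> tr"
  show ?thesis
  proof (rule tree_subset[OF e])
    show "dom (mt \<eta> \<nu>) \<subseteq> dom \<eta>" using dom_meet[OF e] by blast
    show "j \<in> dom (mt \<eta> \<nu>)" if ij: "i \<in> dom (mt \<eta> \<nu>)" "(j, i) \<in> \<kappa>" for i j
    proof -
      have "i \<in> dom \<eta>" "\<And>k. (k, i) \<in> \<kappa> \<Longrightarrow> \<eta> k = \<nu> k" using ij(1) unfolding dom_meet[OF e] by auto
      moreover have "(k, i) \<in> \<kappa>" if "(k, j) \<in> \<kappa>" for k using transD[OF wo.TRANS that ij(2)] .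
      ultimately show ?thesis unfolding dom_meet[OF e] using dom_down[OF e _ ij(2)] by simp
    qed
  qed
qed

lemma meet_greatest: "\<lbrakk>\<eta> \<in> tr; \<zeta> \<in> tr; \<zeta> \<subseteq>\<^sub>m \<eta>; \<zeta> \<subseteq>\<^sub>m \<nu>\<rbrakk> \<Longrightarrow> \<zeta> \<subseteq>\<^sub>m mt \<eta> \<nu>"
proof (unfold map_le_def, intro ballI)
  fix i assume a: "\<eta> \<in> tr" "\<zeta> \<in> tr" "\<forall>a\<in>dom \<zeta>. \<zeta> a = \<eta> a" "\<forall>a\<in>dom \<zeta>. \<zeta> a = \<nu> a" "i \<in> dom \<zeta>"
  have "\<eta> j = \<nu> j" if "(j, i) \<in> \<kappa>" for j using a dom_down[OF a(2,5) that] by metis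
  moreover have "i \<in> dom \<eta>" using a(3,5) by (metis domIff)
  ultimately have "i \<in> dom (mt \<eta> \<nu>)" unfolding dom_meet[OF a(1)] by simp
  then have "mt \<eta> \<nu> i = \<eta> i" using meet_le1 unfolding map_le_def by blast
  then show "\<zeta> i = mt \<eta> \<nu> i" using a by simp
qed

lemma meet_commute: "\<lbrakk>\<eta> \<in> tr; \<nu> \<in> tr\<rbrakk> \<Longrightarrow> mt \<eta> \<nu> = mt \<nu> \<eta>"
  by (meson map_le_antisym meet_greatest meet_le1 meet_le2 meet_tree)

lemma meet_absorb1: "\<lbrakk>\<eta> \<in> tr; \<eta> \<subseteq>\<^sub>m \<nu>\<rbrakk> \<Longrightarrow> mt \<eta> \<nu> = \<eta>"
  by (meson map_le_antisym map_le_refl meet_greatest meet_le1)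

lemma meet_idem [simp]: "\<eta> \<in> tr \<Longrightarrow> mt \<eta> \<eta> = \<eta>"
  by (simp add: meet_absorb1)

lemma below_linear: "\<lbrakk>\<eta> \<in> tr; \<nu> \<in> tr; \<eta> \<subseteq>\<^sub>m \<zeta>; \<nu> \<subseteq>\<^sub>m \<zeta>\<rbrakk> \<Longrightarrow> \<eta> \<subseteq>\<^sub>m \<nu> \<or> \<nu> \<subseteq>\<^sub>m \<eta>"
proof -
  assume a: "\<eta> \<in> tr" "\<nu> \<in> tr" "\<eta> \<subseteq>\<^sub>m \<zeta>" "\<nu> \<subseteq>\<^sub>m \<zeta>"
  have "\<not> splits \<eta> \<nu> l" for l using a(3,4) unfolding map_le_def splits_def by metis
  then show ?thesis using tree_cases[OF a(1,2)] by blast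
qed

lemma splits_Field: "\<eta> \<in> tr \<Longrightarrow> splits \<eta> \<nu> l \<Longrightarrow> l \<in> Field \<kappa>"
  using dom_subset_Field[of \<eta>] unfolding splits_def by auto

lemma splits_dom_meet:
  assumes e: "\<eta> \<in> tr" "splits \<eta> \<nu> l"
  shows "dom (mt \<eta> \<nu>) = underS \<kappa> l"
proof (rule set_eqI)
  fix i
  have lF: "l \<in> Field \<kappa>" using splits_Field[OF e] .
  have sp: "l \<in> dom \<eta>" "\<eta> l \<noteq> \<nu> l" "\<And>j. j \<in> underS \<kappa> l \<Longrightarrow> \<eta> j = \<nu> j"
    using e(2) by (simp_all add: splits_def)
  show "i \<in> dom (mt \<eta> \<nu>) \<longleftrightarrow> i \<in> underS \<kappa> l"
  proof
    assume "i \<in> dom (mt \<eta> \<nu>)"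
    then have i: "i \<in> dom \<eta>" "\<And>j. (j, i) \<in> \<kappa> \<Longrightarrow> \<eta> j = \<nu> j"
      unfolding dom_meet[OF e(1)] by simp_all
    have iF: "i \<in> Field \<kappa>" using i(1) dom_subset_Field[OF e(1)] by auto
    have "(l, i) \<notin> \<kappa>" using i(2) sp(2) by metis
    then have "(i, l) \<in> \<kappa>" "i \<noteq> l" using wo.TOTALS iF lF by metis+
    then show "i \<in> underS \<kappa> l" by (simp add: underS_def)
  next
    assume i: "i \<in> underS \<kappa> l"
    have "\<eta> j = \<nu> j" if "(j, i) \<in> \<kappa>" for j
    proof (cases "j = i")
      case False
      then have "j \<in> underS \<kappa> i" using that by (simp add: underS_def)
      from underS_trans[OF this i] show ?thesis by (rule sp(3))
    qed (use sp(3) i in simp)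
    then show "i \<in> dom (mt \<eta> \<nu>)" unfolding dom_meet[OF e(1)] using dom_downS[OF e(1) sp(1) i] by simp
  qed
qed

lemma underS_inj: "\<lbrakk>i \<in> Field \<kappa>; j \<in> Field \<kappa>; underS \<kappa> i = underS \<kappa> j\<rbrakk> \<Longrightarrow> i = j"
proof -
  assume a: "i \<in> Field \<kappa>" "j \<in> Field \<kappa>" "underS \<kappa> i = underS \<kappa> j"
  have "i \<notin> underS \<kappa> i" "j \<notin> underS \<kappa> j" by (simp_all add: underS_def)
  then show ?thesis using linear[OF a(1,2)] a(3) by simp
qed

text \<open>The coordinate in \<open>lexle\<close> is given by the domain of the meet; since
  \<open>underS\<close> is injective on the field, it can only be the splitting coordinate.\<close>

lemma lex_iff:
  assumes "\<eta> \<in> tr" "\<nu> \<in> tr"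
  shows "lx \<eta> \<nu> \<longleftrightarrow> \<eta> \<subseteq>\<^sub>m \<nu> \<or> (\<exists>l. splits \<eta> \<nu> l \<and> the (\<eta> l) < the (\<nu> l))"
proof -
  have F: "l \<in> Field \<kappa>" if "splits \<eta> \<nu> l" for l
    using splits_Field assms(1) that by simp
  show ?thesis
  proof
    assume "lx \<eta> \<nu>"
    then consider "\<eta> \<subseteq>\<^sub>m \<nu>" | l where "incomparable \<eta> \<nu>" "l \<in> Field \<kappa>" "dom (mt \<eta> \<nu>) = underS \<kappa> l"
      "the (\<eta> l) < the (\<nu> l)" unfolding lexle_def by blast
    then show "\<eta> \<subseteq>\<^sub>m \<nu> \<or> (\<exists>l. splits \<eta> \<nu> l \<and> the (\<eta> l) < the (\<nu> l))"
    proof cases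
      case (2 l)
      then obtain l' where l': "splits \<eta> \<nu> l'" using incomparable_iff[OF assms] by blast
      then have "l' = l" using underS_inj[OF F[OF l'] 2(2)] splits_dom_meet[OF assms(1) l'] 2(3) by simp
      then show ?thesis using l' 2(4) by blast
    qed simp
  next
    assume "\<eta> \<subseteq>\<^sub>m \<nu> \<or> (\<exists>l. splits \<eta> \<nu> l \<and> the (\<eta> l) < the (\<nu> l))"
    then show "lx \<eta> \<nu>"
      unfolding lexle_def using splits_incomparable splits_dom_meet[OF assms(1)] F by blast
  qed
qed

lemma splits_unique: "\<lbrakk>\<eta> \<in> tr; splits \<eta> \<nu> l; splits \<eta> \<nu> l'\<rbrakk> \<Longrightarrow> l = l'"
proof -
  assume a: "\<eta> \<in> tr" "splits \<eta> \<nu> l" "splits \<eta> \<nu> l'"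
  then have "l \<in> Field \<kappa>" "l' \<in> Field \<kappa>" using splits_Field by simp_all
  moreover have "underS \<kappa> l = underS \<kappa> l'"
    using splits_dom_meet[OF a(1,2)] splits_dom_meet[OF a(1,3)] by simp
  ultimately show ?thesis by (rule underS_inj)
qed

lemma lex_le: "\<eta> \<subseteq>\<^sub>m \<nu> \<Longrightarrow> lx \<eta> \<nu>"
  by (simp add: lexle_def)

lemma lex_refl [simp]: "lx \<eta> \<eta>"
  by (simp add: lexle_def)

lemma splits_less: "splits \<eta> \<nu> l \<Longrightarrow> the (\<eta> l) < the (\<nu> l) \<or> the (\<nu> l) < the (\<eta> l)"
  unfolding splits_def by force

lemma lex_total: "\<lbrakk>\<eta> \<in> tr; \<nu> \<in> tr\<rbrakk> \<Longrightarrow> lx \<eta> \<nu> \<or> lx \<nu> \<eta>"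
proof -
  assume a: "\<eta> \<in> tr" "\<nu> \<in> tr"
  show ?thesis
    using tree_cases[OF a] lex_iff[OF a] lex_iff[OF a(2,1)] splits_less splits_sym by metis
qed

lemma lex_antisym: "\<lbrakk>\<eta> \<in> tr; \<nu> \<in> tr; lx \<eta> \<nu>; lx \<nu> \<eta>\<rbrakk> \<Longrightarrow> \<eta> = \<nu>"
proof -
  assume a: "\<eta> \<in> tr" "\<nu> \<in> tr" "lx \<eta> \<nu>" "lx \<nu> \<eta>"
  have "\<not> incomparable \<eta> \<nu>"
  proof
    assume i: "incomparable \<eta> \<nu>"
    then obtain l where l: "splits \<eta> \<nu> l" "the (\<eta> l) < the (\<nu> l)"
      using lex_iff[OF a(1,2)] a(3) unfolding incomparable_def by blast
    obtain l' where l': "splits \<nu> \<eta> l'" "the (\<nu> l') < the (\<eta> l')"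
      using lex_iff[OF a(2,1)] a(4) i unfolding incomparable_def by blast
    have "l' = l" using splits_unique[OF a(1) splits_sym[OF l'(1)] l(1)] .
    then show False using l l' by simp
  qed
  moreover have "\<not> splits \<eta> \<nu> l" for l using calculation splits_incomparable by blast
  ultimately show ?thesis
    using a lex_iff[OF a(1,2)] lex_iff[OF a(2,1)] map_le_antisym splits_sym by blast
qed

text \<open>This makes order and meet of incomparable nodes insensitive to what happens above them,
  which is the source of the later type computations.\<close>

lemma splits_extend:
  "\<lbrakk>splits \<eta> \<nu> l; \<eta> \<subseteq>\<^sub>m \<eta>'; \<nu> \<subseteq>\<^sub>m \<nu>'; \<eta> \<in> tr; \<nu> \<in> tr\<rbrakk> \<Longrightarrow> splits \<eta>' \<nu>' l"
proof -
  assume a: "splits \<eta> \<nu> l" "\<eta> \<subseteq>\<^sub>m \<eta>'" "\<nu> \<subseteq>\<^sub>m \<nu>'" "\<eta> \<in> tr" "\<nu> \<in> tr"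
  have l: "l \<in> dom \<eta>" "l \<in> dom \<nu>" "\<eta> l \<noteq> \<nu> l" using a(1) unfolding splits_def by auto
  have "\<eta>' l = \<eta> l" "\<nu>' l = \<nu> l" using a(2,3) l unfolding map_le_def by auto
  moreover have "\<eta>' j = \<nu>' j" if "j \<in> underS \<kappa> l" for j
  proof -
    have "j \<in> dom \<eta>" "j \<in> dom \<nu>" using dom_downS l that a by blast+
    then have "\<eta>' j = \<eta> j" "\<nu>' j = \<nu> j" using a(2,3) unfolding map_le_def by auto
    then show ?thesis using a(1) that unfolding splits_def by simp
  qed
  ultimately show ?thesis using l unfolding splits_def by (metis domIff)
qed

lemma lex_extend:
  assumes "\<eta> \<in> tr" "\<nu> \<in> tr" "\<eta>' \<in> tr" "\<nu>' \<in> tr" "incomparable \<eta> \<nu>" "\<eta> \<subseteq>\<^sub>m \<eta>'" "\<nu> \<subseteq>\<^sub>m \<nu>'"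
  shows "lx \<eta>' \<nu>' \<longleftrightarrow> lx \<eta> \<nu>"
proof -
  obtain l where l: "splits \<eta> \<nu> l" using incomparable_iff assms by blast
  then have l': "splits \<eta>' \<nu>' l" using splits_extend assms by blast
  have "\<eta> l = \<eta>' l" "\<nu> l = \<nu>' l" using l assms unfolding splits_def map_le_def by auto
  moreover have "lx \<eta> \<nu> \<longleftrightarrow> the (\<eta> l) < the (\<nu> l)"
    using lex_iff[OF assms(1,2)] l splits_unique[OF assms(1) l] assms(5) unfolding incomparable_def by blast
  moreover have "lx \<eta>' \<nu>' \<longleftrightarrow> the (\<eta>' l) < the (\<nu>' l)"
    using lex_iff[OF assms(3,4)] l' splits_unique[OF assms(3) l'] splits_incomparable[OF l']
    unfolding incomparable_def by blast
  ultimately show ?thesis by simp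
qed

lemma incomparable_extend:
  assumes "\<eta> \<in> tr" "\<nu> \<in> tr" "\<eta>' \<in> tr" "\<nu>' \<in> tr" "incomparable \<eta> \<nu>" "\<eta> \<subseteq>\<^sub>m \<eta>'" "\<nu> \<subseteq>\<^sub>m \<nu>'"
  shows "incomparable \<eta>' \<nu>'"
proof -
  obtain l where "splits \<eta> \<nu> l" using incomparable_iff assms by blast
  then show ?thesis using splits_extend splits_incomparable assms by blast
qed

lemma lex_trans:
  assumes t: "\<eta> \<in> tr" "\<nu> \<in> tr" "\<zeta> \<in> tr" and 1: "lx \<eta> \<nu>" and 2: "lx \<nu> \<zeta>"
  shows "lx \<eta> \<zeta>"
proof -
  consider "\<eta> \<subseteq>\<^sub>m \<nu>" "\<nu> \<subseteq>\<^sub>m \<zeta>"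
    | l where "\<eta> \<subseteq>\<^sub>m \<nu>" "splits \<nu> \<zeta> l" "the (\<nu> l) < the (\<zeta> l)"
    | l where "\<nu> \<subseteq>\<^sub>m \<zeta>" "splits \<eta> \<nu> l" "the (\<eta> l) < the (\<nu> l)"
    | l l' where "splits \<eta> \<nu> l" "the (\<eta> l) < the (\<nu> l)" "splits \<nu> \<zeta> l'" "the (\<nu> l') < the (\<zeta> l')"
    using 1 2 lex_iff[OF t(1,2)] lex_iff[OF t(2,3)] by blast
  then show ?thesis
  proof cases
    case 1
    then show ?thesis using lex_le map_le_trans by blast
  next
    case (2 l)
    show ?thesis
    proof (cases "l \<in> dom \<eta>")
      case True
      then have "splits \<eta> \<zeta> l" "\<eta> l = \<nu> l"
        using 2 dom_downS[OF t(1) True] unfolding splits_def map_le_def by auto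
      then show ?thesis using lex_iff[OF t(1,3)] 2 by metis
    next
      case False
      have "\<eta> \<subseteq>\<^sub>m \<zeta>"
      proof (unfold map_le_def, intro ballI)
        fix j assume j: "j \<in> dom \<eta>"
        have "l \<in> Field \<kappa>" "j \<in> Field \<kappa>" using splits_Field[OF t(2) 2(2)] j dom_subset_Field[OF t(1)] by auto
        then have "j \<in> underS \<kappa> l" using linear[of j l] j False dom_downS[OF t(1)] by blast
        then show "\<eta> j = \<zeta> j" using 2 j unfolding splits_def map_le_def by metis
      qed
      then show ?thesis by (rule lex_le)
    qed
  next
    case (3 l)
    then have "splits \<eta> \<zeta> l" using splits_extend[OF 3(2) map_le_refl 3(1)] t by blast
    moreover have "\<nu> l = \<zeta> l" using 3 unfolding splits_def map_le_def by auto
    ultimately have "splits \<eta> \<zeta> l" "\<nu> l = \<zeta> l" by auto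
    then show ?thesis using lex_iff[OF t(1,3)] 3 by metis
  next
    case (4 l l')
    have F: "l \<in> Field \<kappa>" "l' \<in> Field \<kappa>" using 4(1,3) splits_Field t(1,2) by simp_all
    \<comment> \<open>The outer pair splits at the smaller of \<open>l\<close> and
      \<open>l'\<close>, and there its values are strictly increasing.\<close>
    consider "l = l'" | "l \<in> underS \<kappa> l'" | "l' \<in> underS \<kappa> l" using linear[OF F] by blast
    then obtain k where "splits \<eta> \<zeta> k" "the (\<eta> k) < the (\<zeta> k)"
    proof cases
      case 1
      then have "splits \<eta> \<zeta> l" "the (\<eta> l) < the (\<zeta> l)" using 4 unfolding splits_def by auto
      then show ?thesis using that by blast
    next
      case 2
      have "\<nu> l = \<zeta> l" using 2 4(3) unfolding splits_def by blast
      moreover then have "splits \<eta> \<zeta> l" using 4(1,3) underS_trans[OF _ 2] unfolding splits_def by (metis domIff)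
      ultimately show ?thesis using that 4 by metis
    next
      case 3
      have "\<nu> l' = \<eta> l'" using 3 4(1) unfolding splits_def by metis
      moreover then have "splits \<eta> \<zeta> l'" using 4(1,3) underS_trans[OF _ 3] unfolding splits_def by (metis domIff)
      ultimately show ?thesis using that 4 by metis
    qed
    then show ?thesis using lex_iff[OF t(1,3)] by metis
  qed
qed

lemma meet_extend:
  assumes t: "\<eta> \<in> tr" "\<nu> \<in> tr" "\<eta>' \<in> tr" "\<nu>' \<in> tr" and i: "incomparable \<eta> \<nu>" and s: "\<eta> \<subseteq>\<^sub>m \<eta>'" "\<nu> \<subseteq>\<^sub>m \<nu>'"
  shows "mt \<eta>' \<nu>' = mt \<eta> \<nu>"
proof -
  obtain l where l: "splits \<eta> \<nu> l" using incomparable_iff t i by blast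
  then have l': "splits \<eta>' \<nu>' l" using splits_extend t s by blast
  have d: "dom (mt \<eta>' \<nu>') = dom (mt \<eta> \<nu>)"
    using splits_dom_meet[OF t(1) l] splits_dom_meet[OF t(3) l'] by simp
  have a: "mt \<eta> \<nu> \<subseteq>\<^sub>m \<eta>'" using meet_le1 s(1) map_le_trans by blast
  show ?thesis
  proof
    fix i
    show "mt \<eta>' \<nu>' i = mt \<eta> \<nu> i"
      using d a meet_le1[of \<eta>' \<nu>'] unfolding map_le_def by (metis domIff)
  qed
qed

text \<open>Two incomparable meets split inside themselves, so by \<open>meet_extend\<close> they
  meet where \<open>a\<close> and \<open>c\<close> do. Hence the pairwise meets of a tuple are
  closed under \<open>meet\<close>, which keeps the terms of \<open>L0\<close> under
  control.\<close>

lemma meet_meet: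
  assumes t: "a \<in> tr" "b \<in> tr" "c \<in> tr" "d \<in> tr"
  shows "mt (mt a b) (mt c d) =
    (if mt a b \<subseteq>\<^sub>m mt c d then mt a b else if mt c d \<subseteq>\<^sub>m mt a b then mt c d else mt a c)"
proof -
  have m: "mt a b \<in> tr" "mt c d \<in> tr" using t meet_tree by auto
  show ?thesis
    using meet_absorb1[OF m(1), of "mt c d"] meet_absorb1[OF m(2), of "mt a b"] meet_commute[OF m]
      meet_extend[OF m t(1,3) _ meet_le1 meet_le1] unfolding incomparable_def by auto
qed

lemma lex_meet:
  assumes t: "a \<in> tr" "b \<in> tr" "c \<in> tr" "d \<in> tr"
  shows "lx (mt a b) (mt c d) \<longleftrightarrow>
    (if mt a b \<subseteq>\<^sub>m mt c d then True else if mt c d \<subseteq>\<^sub>m mt a b then False else lx a c)"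
proof -
  have m: "mt a b \<in> tr" "mt c d \<in> tr" using t meet_tree by auto
  show ?thesis
    using lex_le[of "mt a b" "mt c d"] lex_antisym[OF m] lex_le[of "mt c d" "mt a b"]
      lex_extend[OF m t(1,3) _ meet_le1 meet_le1] unfolding incomparable_def by auto
qed

text \<open>The semantic content shared by \<open>sim0\<close> and \<open>sim_delta\<close>: on
  tuples of nodes both turn out to be this relation. Passing between the two kinds of types then
  costs nothing, and composing, restricting and reindexing need no formulas.\<close>

definition dsim :: "'i set \<Rightarrow> ('i \<Rightarrow> 'k seq) \<Rightarrow> ('i \<Rightarrow> 'k seq) \<Rightarrow> bool" where
  "dsim J \<rho> \<rho>' \<longleftrightarrow>
    (\<forall>i\<in>J. \<forall>j\<in>J. \<forall>k\<in>J. \<forall>l\<in>J. mt (\<rho> i) (\<rho> j) \<subseteq>\<^sub>m mt (\<rho> k) (\<rho> l) \<longleftrightarrow> mt (\<rho>' i) (\<rho>' j) \<subseteq>\<^sub>m mt (\<rho>' k) (\<rho>' l)) \<and>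
    (\<forall>i\<in>J. \<forall>j\<in>J. lx (\<rho> i) (\<rho> j) \<longleftrightarrow> lx (\<rho>' i) (\<rho>' j))"

lemma dsimD:
  assumes "dsim J \<rho> \<rho>'" "i \<in> J" "j \<in> J"
  shows "k \<in> J \<Longrightarrow> l \<in> J \<Longrightarrow> mt (\<rho> i) (\<rho> j) \<subseteq>\<^sub>m mt (\<rho> k) (\<rho> l) \<longleftrightarrow> mt (\<rho>' i) (\<rho>' j) \<subseteq>\<^sub>m mt (\<rho>' k) (\<rho>' l)"
    and "lx (\<rho> i) (\<rho> j) \<longleftrightarrow> lx (\<rho>' i) (\<rho>' j)"
  using assms unfolding dsim_def by blast+

lemma dsim_refl [simp]: "dsim J \<rho> \<rho>"
  by (simp add: dsim_def)

lemma dsim_sym: "dsim J \<rho> \<rho>' \<Longrightarrow> dsim J \<rho>' \<rho>"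
  by (simp add: dsim_def)

lemma dsim_trans: "dsim J \<rho> \<rho>' \<Longrightarrow> dsim J \<rho>' \<rho>'' \<Longrightarrow> dsim J \<rho> \<rho>''"
  by (simp add: dsim_def)

lemma dsim_reindex: "dsim J \<rho> \<rho>' \<Longrightarrow> f ` K \<subseteq> J \<Longrightarrow> dsim K (\<lambda>i. \<rho> (f i)) (\<lambda>i. \<rho>' (f i))"
  unfolding dsim_def image_subset_iff by simp

lemma dsim_cong: "(\<And>i. i \<in> J \<Longrightarrow> \<rho> i = \<sigma> i) \<Longrightarrow> (\<And>i. i \<in> J \<Longrightarrow> \<rho>' i = \<sigma>' i) \<Longrightarrow> dsim J \<rho> \<rho>' = dsim J \<sigma> \<sigma>'"
  unfolding dsim_def by simp

lemma dsim_mono: "dsim J \<rho> \<rho>' \<Longrightarrow> K \<subseteq> J \<Longrightarrow> dsim K \<rho> \<rho>'"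
  unfolding dsim_def by blast

lemma dsim_eq:
  assumes "dsim J \<rho> \<rho>'" "\<rho> ` J \<subseteq> tr" "\<rho>' ` J \<subseteq> tr" "i \<in> J" "j \<in> J"
  shows "\<rho> i = \<rho> j \<longleftrightarrow> \<rho>' i = \<rho>' j"
proof -
  have t: "\<rho> i \<in> tr" "\<rho> j \<in> tr" "\<rho>' i \<in> tr" "\<rho>' j \<in> tr" using assms by auto
  show ?thesis
    using lex_antisym[OF t(1,2)] lex_antisym[OF t(3,4)] dsimD(2)[OF assms(1,4,5)] dsimD(2)[OF assms(1,5,4)]
    by auto
qed

lemma dsim_le:
  assumes "dsim J \<rho> \<rho>'" "\<rho> ` J \<subseteq> tr" "\<rho>' ` J \<subseteq> tr" "i \<in> J" "j \<in> J"
  shows "\<rho> i \<subseteq>\<^sub>m \<rho> j \<longleftrightarrow> \<rho>' i \<subseteq>\<^sub>m \<rho>' j"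
proof -
  have t: "\<rho> i \<in> tr" "\<rho> j \<in> tr" "\<rho>' i \<in> tr" "\<rho>' j \<in> tr" using assms by auto
  show ?thesis using dsimD(1)[OF assms(1) assms(4,4,5,5)] t by simp
qed

lemma dsim_lex_meet:
  assumes "dsim J \<rho> \<rho>'" "\<rho> ` J \<subseteq> tr" "\<rho>' ` J \<subseteq> tr" "i \<in> J" "j \<in> J" "k \<in> J" "l \<in> J"
  shows "lx (mt (\<rho> i) (\<rho> j)) (mt (\<rho> k) (\<rho> l)) \<longleftrightarrow> lx (mt (\<rho>' i) (\<rho>' j)) (mt (\<rho>' k) (\<rho>' l))"
proof -
  have t: "\<rho> i \<in> tr" "\<rho> j \<in> tr" "\<rho> k \<in> tr" "\<rho> l \<in> tr" "\<rho>' i \<in> tr" "\<rho>' j \<in> tr" "\<rho>' k \<in> tr" "\<rho>' l \<in> tr"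
    using assms by auto
  show ?thesis
    unfolding lex_meet[OF t(1-4)] lex_meet[OF t(5-8)] using dsimD[OF assms(1)] assms by metis
qed

text \<open>By induction every term is the meet of two tuple members, and the same two indices serve
  both tuples: which case of \<open>meet_meet\<close> applies is decided by inclusions that
  \<open>dsim\<close> preserves.\<close>

lemma dsim_term:
  assumes d: "dsim J \<rho> \<rho>'" and t: "\<rho> ` J \<subseteq> tr" "\<rho>' ` J \<subseteq> tr"
  shows "wf_tm L0 0 s \<Longrightarrow> tm_vars s \<subseteq> J \<Longrightarrow> \<exists>i\<in>J. \<exists>j\<in>J.
    tm_val (tree_struct \<kappa>) [] \<rho> s = mt (\<rho> i) (\<rho> j) \<and> tm_val (tree_struct \<kappa>) [] \<rho>' s = mt (\<rho>' i) (\<rho>' j)"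
proof (induction s)
  case (Free i)
  then show ?case using t by (intro bexI[of _ i]) auto
next
  case (Bound x)
  then show ?case by simp
next
  case (Fn f ss)
  have "length ss = 2" using Fn.prems by (simp add: L0_def)
  then obtain s1 s2 where ss: "ss = [s1, s2]"
    by (metis (no_types, opaque_lifting) Suc_length_conv length_0_conv numeral_2_eq_2)
  obtain i j where s1: "i \<in> J" "j \<in> J" "tm_val (tree_struct \<kappa>) [] \<rho> s1 = mt (\<rho> i) (\<rho> j)"
    "tm_val (tree_struct \<kappa>) [] \<rho>' s1 = mt (\<rho>' i) (\<rho>' j)" using Fn.IH[of s1] Fn.prems ss by auto
  obtain k l where s2: "k \<in> J" "l \<in> J" "tm_val (tree_struct \<kappa>) [] \<rho> s2 = mt (\<rho> k) (\<rho> l)"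
    "tm_val (tree_struct \<kappa>) [] \<rho>' s2 = mt (\<rho>' k) (\<rho>' l)" using Fn.IH[of s2] Fn.prems ss by auto
  have v: "tm_val (tree_struct \<kappa>) [] \<rho> (Fn f ss) = mt (mt (\<rho> i) (\<rho> j)) (mt (\<rho> k) (\<rho> l))"
    "tm_val (tree_struct \<kappa>) [] \<rho>' (Fn f ss) = mt (mt (\<rho>' i) (\<rho>' j)) (mt (\<rho>' k) (\<rho>' l))"
    using s1 s2 ss by (simp_all add: tree_struct_def)
  have T: "\<rho> i \<in> tr" "\<rho> j \<in> tr" "\<rho> k \<in> tr" "\<rho> l \<in> tr" "\<rho>' i \<in> tr" "\<rho>' j \<in> tr" "\<rho>' k \<in> tr" "\<rho>' l \<in> tr"
    using t s1 s2 by auto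
  note D = dsimD(1)[OF d s1(1,2) s2(1,2)] dsimD(1)[OF d s2(1,2) s1(1,2)]
  consider "mt (\<rho> i) (\<rho> j) \<subseteq>\<^sub>m mt (\<rho> k) (\<rho> l)"
    | "\<not> mt (\<rho> i) (\<rho> j) \<subseteq>\<^sub>m mt (\<rho> k) (\<rho> l)" "mt (\<rho> k) (\<rho> l) \<subseteq>\<^sub>m mt (\<rho> i) (\<rho> j)"
    | "\<not> mt (\<rho> i) (\<rho> j) \<subseteq>\<^sub>m mt (\<rho> k) (\<rho> l)" "\<not> mt (\<rho> k) (\<rho> l) \<subseteq>\<^sub>m mt (\<rho> i) (\<rho> j)" by blast
  then show ?case
  proof cases
    case 1
    then show ?thesis unfolding v meet_meet[OF T(1-4)] meet_meet[OF T(5-8)]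
      using D s1(1,2) by (intro bexI[of _ i] bexI[of _ j]) auto
  next
    case 2
    then show ?thesis unfolding v meet_meet[OF T(1-4)] meet_meet[OF T(5-8)]
      using D s2(1,2) by (intro bexI[of _ k] bexI[of _ l]) auto
  next
    case 3
    then show ?thesis unfolding v meet_meet[OF T(1-4)] meet_meet[OF T(5-8)]
      using D s1 s2 by (intro bexI[of _ i] bexI[of _ k]) auto
  qed
qed

lemma dsim_sat:
  assumes d: "dsim J \<rho> \<rho>'" and t: "\<rho> ` J \<subseteq> tr" "\<rho>' ` J \<subseteq> tr"
  shows "qfree \<phi> \<Longrightarrow> wf_fm L0 0 \<phi> \<Longrightarrow> fm_vars \<phi> \<subseteq> J \<Longrightarrow>
    sat (tree_struct \<kappa>) [] \<rho> \<phi> \<longleftrightarrow> sat (tree_struct \<kappa>) [] \<rho>' \<phi>"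
proof (induction \<phi>)
  case (Eq s1 s2)
  obtain i j where s1: "i \<in> J" "j \<in> J" "tm_val (tree_struct \<kappa>) [] \<rho> s1 = mt (\<rho> i) (\<rho> j)"
    "tm_val (tree_struct \<kappa>) [] \<rho>' s1 = mt (\<rho>' i) (\<rho>' j)" using dsim_term[OF d t, of s1] Eq by auto
  obtain k l where s2: "k \<in> J" "l \<in> J" "tm_val (tree_struct \<kappa>) [] \<rho> s2 = mt (\<rho> k) (\<rho> l)"
    "tm_val (tree_struct \<kappa>) [] \<rho>' s2 = mt (\<rho>' k) (\<rho>' l)" using dsim_term[OF d t, of s2] Eq by auto
  note D = dsimD(1)[OF d s1(1,2) s2(1,2)] dsimD(1)[OF d s2(1,2) s1(1,2)]
  show ?case unfolding sat.simps s1(3,4) s2(3,4) using D map_le_antisym map_le_refl by metis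
next
  case (Rel R ss)
  have "length ss = 2" using Rel.prems by (auto simp: L0_def)
  then obtain s1 s2 where ss: "ss = [s1, s2]"
    by (metis (no_types, opaque_lifting) Suc_length_conv length_0_conv numeral_2_eq_2)
  obtain i j where s1: "i \<in> J" "j \<in> J" "tm_val (tree_struct \<kappa>) [] \<rho> s1 = mt (\<rho> i) (\<rho> j)"
    "tm_val (tree_struct \<kappa>) [] \<rho>' s1 = mt (\<rho>' i) (\<rho>' j)" using dsim_term[OF d t, of s1] Rel ss by auto
  obtain k l where s2: "k \<in> J" "l \<in> J" "tm_val (tree_struct \<kappa>) [] \<rho> s2 = mt (\<rho> k) (\<rho> l)"
    "tm_val (tree_struct \<kappa>) [] \<rho>' s2 = mt (\<rho>' k) (\<rho>' l)" using dsim_term[OF d t, of s2] Rel ss by auto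
  show ?case
    using dsimD(1)[OF d s1(1,2) s2(1,2)] dsim_lex_meet[OF d t s1(1,2) s2(1,2)] s1 s2 ss
    by (cases R) (simp_all add: tree_struct_def)
qed auto

lemma sim0_iff:
  assumes t: "\<rho> ` J \<subseteq> tr" "\<rho>' ` J \<subseteq> tr"
  shows "sim0 \<kappa> J \<rho> \<rho>' \<longleftrightarrow> dsim J \<rho> \<rho>'"
proof
  assume s: "sim0 \<kappa> J \<rho> \<rho>'"
  have eq: "sat (tree_struct \<kappa>) [] \<rho> \<phi> \<longleftrightarrow> sat (tree_struct \<kappa>) [] \<rho>' \<phi>"
    if "qfree \<phi>" "\<phi> \<in> formulas L0 J" for \<phi>
    using s that unfolding sim0_def qftp_def by blast
  show "dsim J \<rho> \<rho>'" unfolding dsim_def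
  proof (intro conjI ballI)
    fix i j k l assume J: "i \<in> J" "j \<in> J" "k \<in> J" "l \<in> J"
    show "mt (\<rho> i) (\<rho> j) \<subseteq>\<^sub>m mt (\<rho> k) (\<rho> l) \<longleftrightarrow> mt (\<rho>' i) (\<rho>' j) \<subseteq>\<^sub>m mt (\<rho>' k) (\<rho>' l)"
      using eq[of "Rel Initial [Fn Meet [Free i, Free j], Fn Meet [Free k, Free l]]"] J
      by (simp add: formulas_def L0_def tree_struct_def)
  next
    fix i j assume J: "i \<in> J" "j \<in> J"
    show "lx (\<rho> i) (\<rho> j) \<longleftrightarrow> lx (\<rho>' i) (\<rho>' j)"
      using eq[of "Rel TreeLex [Free i, Free j]"] J
      by (simp add: formulas_def L0_def tree_struct_def)
  qed
next
  assume "dsim J \<rho> \<rho>'"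
  then show "sim0 \<kappa> J \<rho> \<rho>'"
    using dsim_sat[OF _ t] unfolding sim0_def qftp_def formulas_def by auto
qed

lemma delta_term:
  assumes "wf_tm L\<delta> 0 s" "tm_vars s \<subseteq> J"
  obtains i where "i \<in> J" "s = Free i"
  using assms by (cases s) (auto simp: L\<delta>_def)

lemma delta_sat:
  assumes d: "dsim J \<rho> \<rho>'" and t: "\<rho> ` J \<subseteq> tr" "\<rho>' ` J \<subseteq> tr"
  shows "qfree \<phi> \<Longrightarrow> wf_fm L\<delta> 0 \<phi> \<Longrightarrow> fm_vars \<phi> \<subseteq> J \<Longrightarrow>
    sat (delta_struct \<kappa> X) [] \<rho> \<phi> \<longleftrightarrow> sat (delta_struct \<kappa> X) [] \<rho>' \<phi>"
proof (induction \<phi>)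
  case (Eq s1 s2)
  obtain i where "i \<in> J" "s1 = Free i" using delta_term[of s1 J] Eq.prems by auto
  moreover obtain j where "j \<in> J" "s2 = Free j" using delta_term[of s2 J] Eq.prems by auto
  ultimately have "i \<in> J" "j \<in> J" "s1 = Free i" "s2 = Free j" by auto
  then show ?case using dsim_eq[OF d t] by simp
next
  case (Rel R ss)
  have "\<exists>i\<in>J. s = Free i" if "s \<in> set ss" for s
  proof -
    have "wf_tm L\<delta> 0 s" "tm_vars s \<subseteq> J" using that Rel.prems by auto
    then show ?thesis by (rule delta_term) blast
  qed
  then obtain f where f: "\<And>s. s \<in> set ss \<Longrightarrow> f s \<in> J \<and> s = Free (f s)" by metis
  define us where "us = map f ss"
  have ss: "ss = map Free us" "set us \<subseteq> J" using f by (auto simp: us_def map_idI)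
  have l: "length us = (case R of Delta \<Rightarrow> 4 | DeltaLex \<Rightarrow> 2)" using Rel.prems ss by (auto simp: L\<delta>_def)
  have J: "us ! n \<in> J" if "n < (case R of Delta \<Rightarrow> 4 | DeltaLex \<Rightarrow> 2)" for n
    using ss(2) nth_mem[of n us] l that by auto
  show ?case
    using l J dsimD[OF d] ss(1) by (cases R) (simp_all add: delta_struct_def)
qed auto

lemma sim_delta_iff:
  assumes t: "\<rho> ` J \<subseteq> tr" "\<rho>' ` J \<subseteq> tr"
  shows "sim_delta \<kappa> X J \<rho> \<rho>' \<longleftrightarrow> dsim J \<rho> \<rho>'"
proof
  assume s: "sim_delta \<kappa> X J \<rho> \<rho>'"
  have eq: "sat (delta_struct \<kappa> X) [] \<rho> \<phi> \<longleftrightarrow> sat (delta_struct \<kappa> X) [] \<rho>' \<phi>"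
    if "qfree \<phi>" "\<phi> \<in> formulas L\<delta> J" for \<phi>
    using s that unfolding sim_delta_def qftp_def by blast
  show "dsim J \<rho> \<rho>'" unfolding dsim_def
  proof (intro conjI ballI)
    fix i j k l assume J: "i \<in> J" "j \<in> J" "k \<in> J" "l \<in> J"
    show "mt (\<rho> i) (\<rho> j) \<subseteq>\<^sub>m mt (\<rho> k) (\<rho> l) \<longleftrightarrow> mt (\<rho>' i) (\<rho>' j) \<subseteq>\<^sub>m mt (\<rho>' k) (\<rho>' l)"
      using eq[of "Rel Delta [Free i, Free j, Free k, Free l]"] J
      by (simp add: formulas_def L\<delta>_def delta_struct_def)
  next
    fix i j assume J: "i \<in> J" "j \<in> J"
    show "lx (\<rho> i) (\<rho> j) \<longleftrightarrow> lx (\<rho>' i) (\<rho>' j)"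
      using eq[of "Rel DeltaLex [Free i, Free j]"] J
      by (simp add: formulas_def L\<delta>_def delta_struct_def)
  qed
next
  assume "dsim J \<rho> \<rho>'"
  then show "sim_delta \<kappa> X J \<rho> \<rho>'"
    using delta_sat[OF _ t] unfolding sim_delta_def qftp_def formulas_def by auto
qed

section \<open>Concatenation\<close>

text \<open>Removing fewer than \<kappa> elements from an infinite cardinal \<kappa> leaves a set of
  full size, and a cardinal is the least well-order of its size; so \<kappa> embeds into the tail.
  Both \<open>card\<close> and \<open>inf\<close> enter here.\<close>

lemma shift_exists:
  assumes p: "p \<in> tr"
  obtains g where "embed \<kappa> (Restr \<kappa> (Field \<kappa> - dom p)) g"
proof -
  let ?R = "Restr \<kappa> (Field \<kappa> - dom p)"
  have R: "Well_order ?R" "Field ?R = Field \<kappa> - dom p"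
    by (rule Well_order_Restr[OF wo], rule Refl_Field_Restr2[OF wo.REFL Diff_subset])
  have "\<not> ?R <o \<kappa>"
  proof
    assume l: "?R <o \<kappa>"
    have "|Field \<kappa> - dom p| \<le>o ?R" using card_of_least[of "Field ?R" ?R] R by simp
    then have "|Field \<kappa> - dom p| <o \<kappa>" using l ordLeq_ordLess_trans by blast
    moreover have "|dom p| <o \<kappa>" using p card_of_underS[OF card] unfolding tree_def by auto
    ultimately have "|(Field \<kappa> - dom p) \<union> dom p| <o \<kappa>"
      using card_of_Un_ordLess_infinite_Field[OF inf card] by blast
    moreover have "(Field \<kappa> - dom p) \<union> dom p = Field \<kappa>" using dom_subset_Field[OF p] by blast
    ultimately show False using card_of_Field_ordIso[OF card] not_ordLess_ordIso[of "|Field \<kappa>|" \<kappa>] by simp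
  qed
  then have "\<kappa> \<le>o ?R" using ordLess_or_ordLeq[OF R(1) wo] by blast
  then show ?thesis using that unfolding ordLeq_def by blast
qed

text \<open>Ordinal addition, sending \<open>i\<close> to the length of \<open>p\<close> plus
  \<open>i\<close>. Embeddings of well-orders are unique on the field, so the choice is
  immaterial.\<close>

definition shift :: "'k seq \<Rightarrow> 'k \<Rightarrow> 'k" where
  "shift p = (SOME g. embed \<kappa> (Restr \<kappa> (Field \<kappa> - dom p)) g)"

text \<open>Concatenation with an explicit value at each coordinate, which is what computations of
  order and meet need; \<open>cat_ext\<close> identifies it with \<open>cat\<close>.\<close>

definition ext :: "'k seq \<Rightarrow> 'k seq \<Rightarrow> 'k seq" where
  "ext p x i = (if i \<in> dom p then p i else if i \<in> shift p ` Field \<kappa> then x (inv_into (Field \<kappa>) (shift p) i) else None)"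

context
  fixes p assumes p: "p \<in> tr"
begin

abbreviation (input) "D \<equiv> dom p"
abbreviation (input) "R \<equiv> Restr \<kappa> (Field \<kappa> - dom p)"

lemma tail_order: "Well_order R" "Field R = Field \<kappa> - D"
  by (rule Well_order_Restr[OF wo], rule Refl_Field_Restr2[OF wo.REFL Diff_subset])

lemma shift_embed: "embed \<kappa> R (shift p)"
  unfolding shift_def by (rule shift_exists[OF p]) (rule someI[of "embed \<kappa> R"])

lemma shift_inj: "inj_on (shift p) (Field \<kappa>)"
  using embed_inj_on[OF wo shift_embed] .

lemma shift_Field: "i \<in> Field \<kappa> \<Longrightarrow> shift p i \<in> Field \<kappa> - D"
  using embed_Field[OF shift_embed] tail_order(2) by blast

lemma shift_mono: "(i, j) \<in> \<kappa> \<Longrightarrow> (shift p i, shift p j) \<in> \<kappa>"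
  using embed_compat[OF shift_embed] unfolding compat_def by blast

lemma underS_dom: "k \<in> Field \<kappa> - D \<Longrightarrow> underS \<kappa> k = D \<union> underS R k"
proof (rule set_eqI)
  fix i assume k: "k \<in> Field \<kappa> - D"
  show "i \<in> underS \<kappa> k \<longleftrightarrow> i \<in> D \<union> underS R k"
  proof
    assume "i \<in> underS \<kappa> k"
    then have "(i, k) \<in> \<kappa>" "i \<noteq> k" "i \<in> Field \<kappa>" by (auto simp: underS_def Field_def)
    then show "i \<in> D \<union> underS R k" using k by (auto simp: underS_def)
  next
    assume "i \<in> D \<union> underS R k"
    then consider "i \<in> D" | "i \<in> underS R k" by blast
    then show "i \<in> underS \<kappa> k"
    proof cases
      case 1
      then have "k \<noteq> i" "k \<notin> underS \<kappa> i" using k dom_downS[OF p] by auto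
      then show ?thesis using linear[of i k] 1 k dom_subset_Field[OF p] by blast
    next
      case 2
      then show ?thesis by (auto simp: underS_def)
    qed
  qed
qed

lemma shift_underS: "k \<in> Field \<kappa> \<Longrightarrow> shift p ` underS \<kappa> k = underS R (shift p k)"
  using embed_underS[OF wo shift_embed] unfolding bij_betw_def by blast

lemma ext_dom: "i \<in> D \<Longrightarrow> ext p x i = p i"
  by (simp add: ext_def)

lemma ext_shift: "j \<in> Field \<kappa> \<Longrightarrow> ext p x (shift p j) = x j"
  using shift_Field[of j] inv_into_f_f[OF shift_inj] by (auto simp: ext_def)

lemma dom_ext: "x \<in> tr \<Longrightarrow> dom (ext p x) = D \<union> shift p ` dom x"
proof (rule set_eqI)
  fix i assume x: "x \<in> tr"
  consider "i \<in> D" | j where "j \<in> Field \<kappa>" "i = shift p j" | "i \<notin> D" "i \<notin> shift p ` Field \<kappa>" by blast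
  then show "i \<in> dom (ext p x) \<longleftrightarrow> i \<in> D \<union> shift p ` dom x"
  proof cases
    case 1
    then show ?thesis using ext_dom[of i x] by auto
  next
    case (2 j)
    have "i \<in> shift p ` dom x \<longleftrightarrow> j \<in> dom x"
      using inj_on_image_mem_iff[OF shift_inj 2(1) dom_subset_Field[OF x]] 2(2) by simp
    then show ?thesis using ext_shift[OF 2(1), of x] shift_Field[OF 2(1)] 2(2) by (auto simp: domIff)
  next
    case 3
    then have "ext p x i = None" by (simp add: ext_def)
    then show ?thesis using 3 dom_subset_Field[OF x] by (auto simp: domIff)
  qed
qed

lemma ext_tree: "x \<in> tr \<Longrightarrow> ext p x \<in> tr"
proof -
  assume x: "x \<in> tr"
  then obtain k where k: "k \<in> Field \<kappa>" "dom x = underS \<kappa> k" by (auto simp: tree_def)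
  have "dom (ext p x) = underS \<kappa> (shift p k)"
    unfolding dom_ext[OF x] k(2) shift_underS[OF k(1)] using underS_dom shift_Field[OF k(1)] by simp
  then show ?thesis using shift_Field[OF k(1)] by (auto simp: tree_def)
qed

lemma le_ext: "p \<subseteq>\<^sub>m ext p x"
  by (simp add: map_le_def ext_dom)

lemma ext_le: "x \<in> tr \<Longrightarrow> y \<in> tr \<Longrightarrow> ext p x \<subseteq>\<^sub>m ext p y \<longleftrightarrow> x \<subseteq>\<^sub>m y"
proof
  assume t: "x \<in> tr" "y \<in> tr" and s: "ext p x \<subseteq>\<^sub>m ext p y"
  show "x \<subseteq>\<^sub>m y"
  proof (unfold map_le_def, intro ballI)
    fix j assume j: "j \<in> dom x"
    then have F: "j \<in> Field \<kappa>" using dom_subset_Field t by blast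
    have "shift p j \<in> dom (ext p x)" using dom_ext[OF t(1)] j by blast
    then show "x j = y j" using s ext_shift[OF F] unfolding map_le_def by metis
  qed
next
  assume t: "x \<in> tr" "y \<in> tr" and s: "x \<subseteq>\<^sub>m y"
  show "ext p x \<subseteq>\<^sub>m ext p y"
  proof (unfold map_le_def, intro ballI)
    fix i assume "i \<in> dom (ext p x)"
    then consider "i \<in> D" | j where "j \<in> dom x" "i = shift p j" using dom_ext[OF t(1)] by blast
    then show "ext p x i = ext p y i"
    proof cases
      case 1
      then show ?thesis by (simp add: ext_dom)
    next
      case (2 j)
      then have F: "j \<in> Field \<kappa>" using dom_subset_Field t by blast
      then show ?thesis using 2 s ext_shift[OF F] unfolding map_le_def by metis
    qed
  qed
qed

lemma ext_splits:
  assumes t: "x \<in> tr" "y \<in> tr" and s: "splits x y l"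
  shows "splits (ext p x) (ext p y) (shift p l)"
proof -
  have F: "l \<in> Field \<kappa>" using splits_Field[OF t(1) s] .
  have l: "l \<in> dom x" "l \<in> dom y" "x l \<noteq> y l" "\<And>j. j \<in> underS \<kappa> l \<Longrightarrow> x j = y j"
    using s by (simp_all add: splits_def)
  have "ext p x i = ext p y i" if "i \<in> underS \<kappa> (shift p l)" for i
  proof -
    have "i \<in> D \<or> i \<in> shift p ` underS \<kappa> l"
      using that underS_dom[OF shift_Field[OF F]] shift_underS[OF F] by blast
    then show ?thesis
    proof
      assume "i \<in> D" then show ?thesis by (simp add: ext_dom)
    next
      assume "i \<in> shift p ` underS \<kappa> l"
      then obtain j where j: "j \<in> underS \<kappa> l" "i = shift p j" by blast
      then have "j \<in> Field \<kappa>" by (auto simp: underS_def Field_def)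
      then show ?thesis using ext_shift l(4)[OF j(1)] j(2) by simp
    qed
  qed
  then show ?thesis using l(1-3) ext_shift[OF F] unfolding splits_def by (auto simp: domIff)
qed

lemma ext_meet: "x \<in> tr \<Longrightarrow> y \<in> tr \<Longrightarrow> mt (ext p x) (ext p y) = ext p (mt x y)"
proof -
  assume t: "x \<in> tr" "y \<in> tr"
  show ?thesis using tree_cases[OF t]
  proof cases
    case 1
    then show ?thesis using t ext_le ext_tree meet_absorb1 by metis
  next
    case 2
    then show ?thesis using t ext_le ext_tree meet_absorb1 meet_commute by metis
  next
    case (3 l)
    have m: "mt x y \<in> tr" using meet_tree t by blast
    have F: "l \<in> Field \<kappa>" using splits_Field[OF t(1) 3] .
    have "dom (mt (ext p x) (ext p y)) = underS \<kappa> (shift p l)"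
      using splits_dom_meet[OF ext_tree[OF t(1)] ext_splits[OF t 3]] .
    also have "\<dots> = dom (ext p (mt x y))"
      using underS_dom[OF shift_Field[OF F]] shift_underS[OF F] dom_ext[OF m] splits_dom_meet[OF t(1) 3] by simp
    finally have d: "dom (mt (ext p x) (ext p y)) = dom (ext p (mt x y))" .
    have a: "ext p (mt x y) \<subseteq>\<^sub>m ext p x" using ext_le[OF m t(1)] meet_le1 by blast
    show ?thesis
    proof
      fix i
      show "mt (ext p x) (ext p y) i = ext p (mt x y) i"
        using d a meet_le1[of "ext p x" "ext p y"] unfolding map_le_def by (metis domIff)
    qed
  qed
qed

lemma ext_lex: "x \<in> tr \<Longrightarrow> y \<in> tr \<Longrightarrow> lx (ext p x) (ext p y) \<longleftrightarrow> lx x y"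
proof -
  assume t: "x \<in> tr" "y \<in> tr"
  have e: "ext p x \<in> tr" "ext p y \<in> tr" using ext_tree t by auto
  show ?thesis using tree_cases[OF t]
  proof cases
    case 1
    then show ?thesis using ext_le[OF t] lex_le by blast
  next
    case 2
    have *: "lx x y \<longleftrightarrow> x \<subseteq>\<^sub>m y" using 2 lex_le[of x y] lex_le[OF 2] lex_antisym[OF t] by auto
    have 3: "ext p y \<subseteq>\<^sub>m ext p x" using ext_le[OF t(2,1)] 2 by blast
    have "lx (ext p x) (ext p y) \<longleftrightarrow> ext p x \<subseteq>\<^sub>m ext p y"
      using 3 lex_le[of "ext p x" "ext p y"] lex_le[OF 3] lex_antisym[OF e] by auto
    then show ?thesis using * ext_le[OF t] by simp
  next
    case (3 l)
    note s = ext_splits[OF t 3]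
    have "lx x y \<longleftrightarrow> the (x l) < the (y l)"
      using lex_iff[OF t] 3 splits_unique[OF t(1) 3] splits_incomparable[OF 3] unfolding incomparable_def by blast
    moreover have "lx (ext p x) (ext p y) \<longleftrightarrow> the (ext p x (shift p l)) < the (ext p y (shift p l))"
      using lex_iff[OF e] s splits_unique[OF e(1) s] splits_incomparable[OF s] unfolding incomparable_def by blast
    ultimately show ?thesis using ext_shift[OF splits_Field[OF t(1) 3]] by simp
  qed
qed

text \<open>\<open>h\<close> and \<open>shift p\<close> both embed the well-order of
  \<open>dom x\<close> into the tail, each with an initial segment as image, so they agree by
  uniqueness of such embeddings.\<close>

lemma ext_unique:
  assumes x: "x \<in> tr" and r: "\<rho> \<in> tr" "p \<subseteq>\<^sub>m \<rho>" and h: "bij_betw h (dom x) (dom \<rho> - D)"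
    and o: "\<And>i j. i \<in> dom x \<Longrightarrow> j \<in> dom x \<Longrightarrow> (i, j) \<in> \<kappa> \<longleftrightarrow> (h i, h j) \<in> \<kappa>"
    and v: "\<And>i. i \<in> dom x \<Longrightarrow> \<rho> (h i) = x i"
  shows "\<rho> = ext p x"
proof -
  let ?r = "Restr \<kappa> (dom x)"
  note xF = dom_subset_Field[OF x] and rF = dom_subset_Field[OF r(1)]
  have r': "Well_order ?r" "Field ?r = dom x"
    by (rule Well_order_Restr[OF wo], rule Refl_Field_Restr2[OF wo.REFL xF])
  have im: "h ` dom x = dom \<rho> - D" and inj: "inj_on h (dom x)" using h by (auto simp: bij_betw_def)
  have w: "wo_rel R" using tail_order(1) by (simp add: wo_rel_def)
  have of1: "wo_rel.ofilter R (dom \<rho> - D)"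
    unfolding wo_rel.ofilter_def[OF w] tail_order(2) 
  proof (intro conjI ballI)
    show "dom \<rho> - D \<subseteq> Field \<kappa> - D" using rF by blast
    fix a assume "a \<in> dom \<rho> - D"
    then show "under R a \<subseteq> dom \<rho> - D" using dom_down[OF r(1), of a] unfolding under_def by blast
  qed
  obtain k where k: "k \<in> Field \<kappa>" "dom x = underS \<kappa> k" using x by (auto simp: tree_def)
  have of2: "wo_rel.ofilter R (shift p ` dom x)"
    unfolding k(2) shift_underS[OF k(1)] by (rule wo_rel.underS_ofilter[OF w])
  have "compat ?r R h" unfolding compat_def
  proof (intro allI impI)
    fix a b assume ab: "(a, b) \<in> ?r"
    then have "h a \<in> dom \<rho> - D" "h b \<in> dom \<rho> - D" using im by blast+
    then show "(h a, h b) \<in> R" using ab o rF by auto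
  qed
  then have e1: "embed ?r R h"
    unfolding embed_iff_compat_inj_on_ofilter[OF r'(1) tail_order(1)] using inj im of1 r'(2) by simp
  have "compat ?r R (shift p)" unfolding compat_def
  proof (intro allI impI)
    fix a b assume ab: "(a, b) \<in> ?r"
    then have "a \<in> Field \<kappa>" "b \<in> Field \<kappa>" using xF by blast+
    then show "(shift p a, shift p b) \<in> R" using ab shift_mono[of a b] shift_Field by blast
  qed
  then have e2: "embed ?r R (shift p)"
    unfolding embed_iff_compat_inj_on_ofilter[OF r'(1) tail_order(1)]
    using inj_on_subset[OF shift_inj xF] of2 r'(2) by simp
  have hg: "h i = shift p i" if "i \<in> dom x" for i
    using embed_unique[OF r'(1) tail_order(1) e1 e2, of i] r'(2) that by simp
  have "dom \<rho> = D \<union> h ` dom x" using im map_le_implies_dom_le[OF r(2)] by blast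
  also have "h ` dom x = shift p ` dom x" using hg by auto
  finally have d: "dom \<rho> = dom (ext p x)" using dom_ext[OF x] by simp
  show ?thesis
  proof
    fix i
    consider "i \<notin> dom \<rho>" | "i \<in> D" | j where "j \<in> dom x" "i = shift p j" using d dom_ext[OF x] by blast
    then show "\<rho> i = ext p x i"
    proof cases
      case 1
      then show ?thesis using d by (metis domIff)
    next
      case 2
      then show ?thesis using r(2) ext_dom unfolding map_le_def by simp
    next
      case (3 j)
      then show ?thesis using hg[of j] v[of j] ext_shift[of j x] xF by auto
    qed
  qed
qed

lemma cat_ext: "x \<in> tr \<Longrightarrow> cat \<kappa> p x = ext p x"
proof -
  assume x: "x \<in> tr"
  note xF = dom_subset_Field[OF x]
  show ?thesis unfolding cat_def
  proof (rule the_equality)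
    have "bij_betw (shift p) (dom x) (dom (ext p x) - D)"
    proof -
      have "shift p ` dom x \<inter> D = {}" using shift_Field xF by blast
      then show ?thesis unfolding bij_betw_def using inj_on_subset[OF shift_inj xF] dom_ext[OF x] by blast
    qed
    moreover have "(i, j) \<in> \<kappa> \<longleftrightarrow> (shift p i, shift p j) \<in> \<kappa>" if ij: "i \<in> dom x" "j \<in> dom x" for i j
    proof
      assume "(shift p i, shift p j) \<in> \<kappa>"
      show "(i, j) \<in> \<kappa>"
      proof (rule ccontr)
        assume n: "(i, j) \<notin> \<kappa>"
        then have "(j, i) \<in> \<kappa>" using wo.TOTALS ij xF by blast
        then have "(shift p j, shift p i) \<in> \<kappa>" by (rule shift_mono)
        then have "shift p j = shift p i"
          using \<open>(shift p i, shift p j) \<in> \<kappa>\<close> wo.ANTISYM unfolding antisym_def by blast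
        then have "j = i" using shift_inj ij xF unfolding inj_on_def by blast
        then show False using n \<open>(j, i) \<in> \<kappa>\<close> by simp
      qed
    qed (rule shift_mono)
    moreover have "\<forall>i\<in>dom x. ext p x (shift p i) = x i" using ext_shift xF by blast
    ultimately show "ext p x \<in> tr \<and> p \<subseteq>\<^sub>m ext p x \<and>
      (\<exists>h. bij_betw h (dom x) (dom (ext p x) - D) \<and>
        (\<forall>i\<in>dom x. \<forall>j\<in>dom x. (i, j) \<in> \<kappa> \<longleftrightarrow> (h i, h j) \<in> \<kappa>) \<and> (\<forall>i\<in>dom x. ext p x (h i) = x i))"
      using ext_tree[OF x] le_ext by (intro conjI exI[of _ "shift p"]) auto
  next
    fix \<rho> assume "\<rho> \<in> tr \<and> p \<subseteq>\<^sub>m \<rho> \<and>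
      (\<exists>h. bij_betw h (dom x) (dom \<rho> - D) \<and>
        (\<forall>i\<in>dom x. \<forall>j\<in>dom x. (i, j) \<in> \<kappa> \<longleftrightarrow> (h i, h j) \<in> \<kappa>) \<and> (\<forall>i\<in>dom x. \<rho> (h i) = x i))"
    then obtain h where "\<rho> \<in> tr" "p \<subseteq>\<^sub>m \<rho>" "bij_betw h (dom x) (dom \<rho> - D)"
      "\<forall>i\<in>dom x. \<forall>j\<in>dom x. (i, j) \<in> \<kappa> \<longleftrightarrow> (h i, h j) \<in> \<kappa>" "\<forall>i\<in>dom x. \<rho> (h i) = x i" by blast
    then show "\<rho> = ext p x" using ext_unique[OF x] by blast
  qed
qed

end

lemma ext_incomparable:
  "\<lbrakk>p \<in> tr; x \<in> tr; y \<in> tr\<rbrakk> \<Longrightarrow> incomparable (ext p x) (ext p y) \<longleftrightarrow> incomparable x y"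
  by (simp add: incomparable_def ext_le)

lemma dsim_ext:
  assumes "p \<in> tr" "\<rho> ` J \<subseteq> tr"
  shows "dsim J (\<lambda>i. ext p (\<rho> i)) \<rho>"
proof -
  have "\<rho> i \<in> tr" if "i \<in> J" for i using assms that by auto
  then show ?thesis using assms(1) unfolding dsim_def by (simp add: ext_le ext_meet ext_lex meet_tree)
qed

lemma finite_tree:
  assumes "A \<subseteq> Field \<kappa>" "finite A" "dom \<eta> = A" "\<And>i j. i \<in> A \<Longrightarrow> (j, i) \<in> \<kappa> \<Longrightarrow> j \<in> A"
  shows "\<eta> \<in> tr"
proof -
  have "A \<noteq> Field \<kappa>" using assms(2) inf by auto
  then show ?thesis using assms unfolding tree_iff wo.ofilter_def under_def by blast
qed

lemma empty_tree: "Map.empty \<in> tr"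
  by (rule finite_tree[of "{}"]) auto

definition start :: 'k where "start = wo.minim (Field \<kappa>)"

definition single :: "nat \<Rightarrow> 'k seq" where "single c = [start \<mapsto> c]"

lemma start: "start \<in> Field \<kappa>" "i \<in> Field \<kappa> \<Longrightarrow> (start, i) \<in> \<kappa>"
proof -
  have ne: "Field \<kappa> \<noteq> {}" using inf by auto
  show "start \<in> Field \<kappa>" unfolding start_def by (rule wo.minim_in[OF subset_refl ne])
  show "i \<in> Field \<kappa> \<Longrightarrow> (start, i) \<in> \<kappa>" unfolding start_def by (rule wo.minim_least[OF subset_refl])
qed

lemma single_tree: "single c \<in> tr"
proof (rule finite_tree[of "{start}"])
  show "j \<in> {start}" if "i \<in> {start}" "(j, i) \<in> \<kappa>" for i j
  proof -
    have "j \<in> Field \<kappa>" using that(2) by (auto simp: Field_def)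
    then have "(start, j) \<in> \<kappa>" by (rule start(2))
    then show ?thesis using that wo.ANTISYM unfolding antisym_def by blast
  qed
qed (use start in \<open>auto simp: single_def\<close>)

lemma splits_single: "c \<noteq> c' \<Longrightarrow> splits (single c) (single c') start"
  by (auto simp: splits_def single_def underS_def)

lemma single_lex: "lx (single c) (single c') \<longleftrightarrow> c \<le> c'"
proof (cases "c = c'")
  case False
  note s = splits_single[OF False]
  have "lx (single c) (single c') \<longleftrightarrow> the (single c start) < the (single c' start)"
    using lex_iff[OF single_tree single_tree, of c c'] s splits_unique[OF single_tree s] splits_incomparable[OF s]
    unfolding incomparable_def by blast
  then show ?thesis using False by (auto simp: single_def)
qed simp

lemma single_incomparable: "c \<noteq> c' \<Longrightarrow> incomparable (single c) (single c')"
  using splits_single splits_incomparable by blast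

lemma ext_single_strict:
  assumes "p \<in> tr"
  shows "p \<subseteq>\<^sub>m ext p (single c)" "p \<noteq> ext p (single c)"
proof -
  show "p \<subseteq>\<^sub>m ext p (single c)" by (rule le_ext[OF assms])
  have "start \<in> dom (single c)" by (simp add: single_def)
  then have "shift p start \<in> dom (ext p (single c))" unfolding dom_ext[OF assms single_tree] by blast
  moreover have "shift p start \<notin> dom p" using shift_Field[OF assms start(1)] by blast
  ultimately show "p \<noteq> ext p (single c)" by auto
qed

section \<open>Hanging a tree over one point of an antichain\<close>

context
  fixes \<sigma> :: "'i \<Rightarrow> 'k seq" and U t0 p
  assumes \<sigma>: "\<sigma> ` U \<subseteq> tr" and anti: "antichain \<kappa> (\<sigma> ` U)" and t0: "t0 \<in> U"
    and p: "p \<in> tr" and above: "\<sigma> t0 \<subseteq>\<^sub>m p" "\<sigma> t0 \<noteq> p"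
begin

lemma comb_incomparable: "u \<in> U \<Longrightarrow> \<sigma> u \<noteq> \<sigma> t0 \<Longrightarrow> incomparable (\<sigma> u) (\<sigma> t0)"
  using anti t0 unfolding antichain_def by blast

lemma comb_below: "x \<in> tr \<Longrightarrow> \<sigma> t0 \<subseteq>\<^sub>m ext p x"
  using above(1) le_ext[OF p] map_le_trans by blast

lemma comb_meet1: "u \<in> U \<Longrightarrow> x \<in> tr \<Longrightarrow> mt (\<sigma> u) (ext p x) = mt (\<sigma> u) (\<sigma> t0)"
proof (cases "\<sigma> u = \<sigma> t0")
  case True
  assume u: "u \<in> U" "x \<in> tr"
  have "\<sigma> t0 \<in> tr" using \<sigma> t0 by blast
  then show ?thesis using True comb_below[OF u(2)] meet_absorb1 by simp
next
  case False
  assume u: "u \<in> U" "x \<in> tr"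
  have t: "\<sigma> t0 \<in> tr" "\<sigma> u \<in> tr" using \<sigma> t0 u by auto
  show ?thesis
    using meet_extend[OF t(2,1) t(2) ext_tree[OF p u(2)] comb_incomparable[OF u(1) False] map_le_refl comb_below[OF u(2)]] .
qed

lemma comb_meet2: "u \<in> U \<Longrightarrow> x \<in> tr \<Longrightarrow> mt (ext p x) (\<sigma> u) = mt (\<sigma> u) (\<sigma> t0)"
  using comb_meet1 meet_commute[OF ext_tree[OF p]] \<sigma> by (metis image_subset_iff)

text \<open>A hung point below \<open>\<sigma> u\<close> would force
  \<open>\<sigma> u = \<sigma> t0\<close> by the antichain property, and then \<open>p\<close> below
  \<open>\<sigma> t0\<close>, against strictness.\<close>

lemma comb_not_below: "u \<in> U \<Longrightarrow> x \<in> tr \<Longrightarrow> \<not> ext p x \<subseteq>\<^sub>m \<sigma> u"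
proof
  assume u: "u \<in> U" "x \<in> tr" and s: "ext p x \<subseteq>\<^sub>m \<sigma> u"
  then have "\<sigma> t0 \<subseteq>\<^sub>m \<sigma> u" using comb_below map_le_trans by blast
  then have "\<sigma> t0 = \<sigma> u" using anti t0 u(1) unfolding antichain_def incomparable_def by blast
  then have "p \<subseteq>\<^sub>m \<sigma> t0" using s le_ext[OF p, of x] map_le_trans by metis
  then show False using above map_le_antisym by blast
qed

text \<open>The meet and \<open>\<sigma> t0\<close> both lie below \<open>ext p x\<close>, hence are
  comparable; if \<open>\<sigma> t0\<close> is the lower one, the antichain property gives
  \<open>\<sigma> u = \<sigma> t0\<close>, and the meet cannot exceed it.\<close>

lemma comb_le1: "\<lbrakk>u \<in> U; u' \<in> U; x \<in> tr\<rbrakk> \<Longrightarrow> mt (\<sigma> u) (\<sigma> u') \<subseteq>\<^sub>m ext p x \<longleftrightarrow> mt (\<sigma> u) (\<sigma> u') \<subseteq>\<^sub>m \<sigma> t0"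
proof
  assume u: "u \<in> U" "u' \<in> U" "x \<in> tr" and s: "mt (\<sigma> u) (\<sigma> u') \<subseteq>\<^sub>m ext p x"
  have t: "\<sigma> t0 \<in> tr" "\<sigma> u \<in> tr" using \<sigma> t0 u by auto
  have "mt (\<sigma> u) (\<sigma> u') \<subseteq>\<^sub>m \<sigma> t0 \<or> \<sigma> t0 \<subseteq>\<^sub>m mt (\<sigma> u) (\<sigma> u')"
    using below_linear[OF meet_tree[OF t(2)] t(1) s comb_below[OF u(3)]] .
  moreover have "\<sigma> t0 \<subseteq>\<^sub>m mt (\<sigma> u) (\<sigma> u') \<Longrightarrow> \<sigma> u = \<sigma> t0"
    using meet_le1[of "\<sigma> u" "\<sigma> u'"] map_le_trans[of "\<sigma> t0" _ "\<sigma> u"] comb_incomparable[OF u(1)]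
    unfolding incomparable_def by blast
  ultimately show "mt (\<sigma> u) (\<sigma> u') \<subseteq>\<^sub>m \<sigma> t0" using meet_le1[of "\<sigma> u" "\<sigma> u'"] by auto
next
  show "\<lbrakk>x \<in> tr; mt (\<sigma> u) (\<sigma> u') \<subseteq>\<^sub>m \<sigma> t0\<rbrakk> \<Longrightarrow> mt (\<sigma> u) (\<sigma> u') \<subseteq>\<^sub>m ext p x"
    using comb_below map_le_trans by blast
qed

lemma comb_le2: "\<lbrakk>u \<in> U; u' \<in> U; x \<in> tr\<rbrakk> \<Longrightarrow> \<not> ext p x \<subseteq>\<^sub>m mt (\<sigma> u) (\<sigma> u')"
  using comb_not_below[of u x] meet_le1[of "\<sigma> u" "\<sigma> u'"] map_le_trans by blast

lemma comb_lex1: "u \<in> U \<Longrightarrow> x \<in> tr \<Longrightarrow> lx (\<sigma> u) (ext p x) \<longleftrightarrow> lx (\<sigma> u) (\<sigma> t0)"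
proof (cases "\<sigma> u = \<sigma> t0")
  case True
  assume u: "u \<in> U" "x \<in> tr"
  then show ?thesis using True comb_below[OF u(2)] lex_le[of "\<sigma> t0" "ext p x"] by simp
next
  case False
  assume u: "u \<in> U" "x \<in> tr"
  have t: "\<sigma> t0 \<in> tr" "\<sigma> u \<in> tr" using \<sigma> t0 u by auto
  show ?thesis
    using lex_extend[OF t(2,1) t(2) ext_tree[OF p u(2)] comb_incomparable[OF u(1) False] map_le_refl comb_below[OF u(2)]] .
qed

lemma comb_lex2: "u \<in> U \<Longrightarrow> x \<in> tr \<Longrightarrow> lx (ext p x) (\<sigma> u) \<longleftrightarrow> \<sigma> u \<noteq> \<sigma> t0 \<and> lx (\<sigma> t0) (\<sigma> u)"
proof (cases "\<sigma> u = \<sigma> t0")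
  case True
  assume u: "u \<in> U" "x \<in> tr"
  have t: "\<sigma> u \<in> tr" using \<sigma> u by auto
  have "\<not> lx (ext p x) (\<sigma> u)"
    using lex_antisym[OF ext_tree[OF p u(2)] t] lex_le[OF comb_below[OF u(2)]] comb_not_below[OF u] True map_le_refl
    by metis
  then show ?thesis using True by simp
next
  case False
  assume u: "u \<in> U" "x \<in> tr"
  have t: "\<sigma> t0 \<in> tr" "\<sigma> u \<in> tr" using \<sigma> t0 u by auto
  show ?thesis using False
    lex_extend[OF t ext_tree[OF p u(2)] t(2) incomparable_sym[OF comb_incomparable[OF u(1) False]] comb_below[OF u(2)] map_le_refl]
    by simp
qed

lemmas comb_rules = comb_meet1 comb_meet2 comb_le1 comb_le2 comb_lex1 comb_lex2

end

text \<open>The rules in \<open>comb_rules\<close> express every relation between the antichain and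
  the hung points in terms of \<open>\<sigma>\<close> alone: neither \<open>p\<close> nor the
  position inside the hung tree occurs on the right. So the mixed type is determined by the type of
  the hung part.\<close>

lemma dsim_comb:
  assumes s: "\<sigma> ` U \<subseteq> tr" "antichain \<kappa> (\<sigma> ` U)" "t0 \<in> U"
    and p: "p \<in> tr" "\<sigma> t0 \<subseteq>\<^sub>m p" "\<sigma> t0 \<noteq> p" and q: "q \<in> tr" "\<sigma> t0 \<subseteq>\<^sub>m q" "\<sigma> t0 \<noteq> q"
    and t: "\<tau> ` V \<subseteq> tr" "\<tau>' ` V \<subseteq> tr" and d: "dsim V \<tau> \<tau>'"
  shows "dsim (U <+> V) (case_sum \<sigma> (\<lambda>v. ext p (\<tau> v))) (case_sum \<sigma> (\<lambda>v. ext q (\<tau>' v)))"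
proof -
  note R = comb_rules[OF s p] comb_rules[OF s q]
  have T: "\<tau> v \<in> tr" "\<tau>' v \<in> tr" if "v \<in> V" for v using t that by auto
  have T': "mt (\<tau> v) x \<in> tr" "mt (\<tau>' v) x \<in> tr" if "v \<in> V" for v x using T[OF that] meet_tree by auto
  note E = ext_meet[OF p(1)] ext_meet[OF q(1)] ext_le[OF p(1)] ext_le[OF q(1)] ext_lex[OF p(1)] ext_lex[OF q(1)]
  show ?thesis unfolding dsim_def
  proof (intro conjI ballI)
    fix i j k l assume J: "i \<in> U <+> V" "j \<in> U <+> V" "k \<in> U <+> V" "l \<in> U <+> V"
    then show "mt (case_sum \<sigma> (\<lambda>v. ext p (\<tau> v)) i) (case_sum \<sigma> (\<lambda>v. ext p (\<tau> v)) j) \<subseteq>\<^sub>m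
        mt (case_sum \<sigma> (\<lambda>v. ext p (\<tau> v)) k) (case_sum \<sigma> (\<lambda>v. ext p (\<tau> v)) l) \<longleftrightarrow>
      mt (case_sum \<sigma> (\<lambda>v. ext q (\<tau>' v)) i) (case_sum \<sigma> (\<lambda>v. ext q (\<tau>' v)) j) \<subseteq>\<^sub>m
        mt (case_sum \<sigma> (\<lambda>v. ext q (\<tau>' v)) k) (case_sum \<sigma> (\<lambda>v. ext q (\<tau>' v)) l)"
      by (elim PlusE) (use s(3) d in \<open>simp_all add: R T T' E dsimD(1)\<close>)
  next
    fix i j assume J: "i \<in> U <+> V" "j \<in> U <+> V"
    then show "lx (case_sum \<sigma> (\<lambda>v. ext p (\<tau> v)) i) (case_sum \<sigma> (\<lambda>v. ext p (\<tau> v)) j) \<longleftrightarrow>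
      lx (case_sum \<sigma> (\<lambda>v. ext q (\<tau>' v)) i) (case_sum \<sigma> (\<lambda>v. ext q (\<tau>' v)) j)"
      by (elim PlusE) (use s(3) d in \<open>simp_all add: R T E dsimD(2)\<close>)
  qed
qed

section \<open>Copies of an antichain along the binary tree\<close>

definition branch :: "'k seq \<Rightarrow> bool \<Rightarrow> 'k seq" where
  "branch s b = ext s (single (if b then 1 else 0))"

lemma branch:
  assumes "s \<in> tr"
  shows "branch s b \<in> tr" "s \<subseteq>\<^sub>m branch s b" "s \<noteq> branch s b"
  using ext_tree[OF assms single_tree] ext_single_strict[OF assms] by (auto simp: branch_def)

lemma branch_incomparable: "s \<in> tr \<Longrightarrow> b \<noteq> c \<Longrightarrow> incomparable (branch s b) (branch s c)"
  unfolding branch_def by (simp add: ext_incomparable single_tree single_incomparable)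

text \<open>Here \<open>s\<close> stands for the distinguished point of the antichain. Each bit
  contributes \<open>s\<close> followed by 0 or 1, so a copy sits above the distinguished point of
  the copy at every proper initial segment, and at a fork the copies go over incomparable
  successors.\<close>

fun place :: "'k seq \<Rightarrow> ('i \<Rightarrow> 'k seq) \<Rightarrow> bool list \<Rightarrow> 'i \<Rightarrow> 'k seq" where
  "place s \<sigma> [] t = \<sigma> t"
| "place s \<sigma> (b # bs) t = ext (branch s b) (place s \<sigma> bs t)"

context
  fixes \<sigma> :: "'i \<Rightarrow> 'k seq" and U t0
  assumes \<sigma>: "\<sigma> ` U \<subseteq> tr" and anti: "antichain \<kappa> (\<sigma> ` U)" and t0: "t0 \<in> U"
begin

abbreviation (input) "pl \<equiv> place (\<sigma> t0) \<sigma>"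

lemma st0: "\<sigma> t0 \<in> tr" using \<sigma> t0 by blast

lemma place_tree: "t \<in> U \<Longrightarrow> pl \<eta> t \<in> tr"
  using \<sigma> by (induction \<eta>) (auto simp: ext_tree branch(1)[OF st0])

lemma place_dsim: "dsim U (pl \<eta>) \<sigma>"
proof (induction \<eta>)
  case (Cons b \<eta>)
  have "pl \<eta> ` U \<subseteq> tr" using place_tree by blast
  from dsim_trans[OF dsim_ext[OF branch(1)[OF st0] this] Cons, of b]
  show ?case by (simp add: dsim_def)
qed (simp add: dsim_def)

text \<open>Equal first bits are stripped off; at the first differing bit the copies pass over two
  incomparable successors of the distinguished point.\<close>

lemma place_incomparable:
  "\<lbrakk>t \<in> U; u \<in> U; \<not> prefix \<eta> \<nu>; \<not> prefix \<nu> \<eta>\<rbrakk> \<Longrightarrow> incomparable (pl \<eta> t) (pl \<nu> u)"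
proof (induction \<eta> arbitrary: \<nu>)
  case (Cons b \<eta>)
  then obtain c \<nu>' where \<nu>: "\<nu> = c # \<nu>'" by (cases \<nu>) auto
  show ?case
  proof (cases "b = c")
    case True
    then show ?thesis using Cons \<nu> by (simp add: ext_incomparable branch(1)[OF st0] place_tree)
  next
    case False
    have "incomparable (ext (branch (\<sigma> t0) b) (pl \<eta> t)) (ext (branch (\<sigma> t0) c) (pl \<nu>' u))"
      by (rule incomparable_extend[OF _ _ _ _ branch_incomparable[OF st0 False]])
        (simp_all add: branch(1)[OF st0] ext_tree place_tree Cons.prems le_ext)
    then show ?thesis using \<nu> by simp
  qed
qed simp

lemma place_antichain:
  assumes "\<forall>\<eta>\<in>A. \<forall>\<nu>\<in>A. \<eta> \<noteq> \<nu> \<longrightarrow> \<not> prefix \<eta> \<nu>"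
  shows "antichain \<kappa> ((\<lambda>(\<eta>, t). pl \<eta> t) ` (A \<times> U))"
proof -
  have "pl \<eta> t = pl \<nu> u \<or> incomparable (pl \<eta> t) (pl \<nu> u)" if "\<eta> \<in> A" "\<nu> \<in> A" "t \<in> U" "u \<in> U" for \<eta> \<nu> t u
  proof (cases "\<eta> = \<nu>")
    case True
    have p: "pl \<nu> ` U \<subseteq> tr" using place_tree by blast
    have "\<sigma> t = \<sigma> u \<or> incomparable (\<sigma> t) (\<sigma> u)" using anti that unfolding antichain_def by blast
    then show ?thesis
      using True dsim_eq[OF place_dsim p \<sigma> that(3,4)] dsim_le[OF place_dsim p \<sigma> that(3,4)]
        dsim_le[OF place_dsim p \<sigma> that(4,3)] unfolding incomparable_def by blast
  next
    case False
    then have "\<not> prefix \<eta> \<nu>" "\<not> prefix \<nu> \<eta>" using assms that(1,2) by metis+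
    then show ?thesis using place_incomparable[OF that(3,4)] by simp
  qed
  note inc = this
  show ?thesis unfolding antichain_def
  proof (intro conjI ballI impI)
    show "(\<lambda>(\<eta>, t). pl \<eta> t) ` (A \<times> U) \<subseteq> tr" using place_tree by auto
    fix x y assume "x \<in> (\<lambda>(\<eta>, t). pl \<eta> t) ` (A \<times> U)" "y \<in> (\<lambda>(\<eta>, t). pl \<eta> t) ` (A \<times> U)" "x \<noteq> y"
    then show "incomparable x y" using inc by (elim imageE SigmaE) (simp, metis)
  qed
qed

text \<open>A common first bit is stripped off by \<open>dsim_ext\<close>; once the shorter list is
  empty, \<open>dsim_comb\<close> forgets the rest of the longer one. So all comparable pairs of
  copies have one and the same type, and the inconsistency of a single pair suffices.\<close>

lemma place_pair:
  "\<lbrakk>prefix \<eta> \<nu>; \<eta> \<noteq> \<nu>\<rbrakk> \<Longrightarrow> dsim (U <+> U) (case_sum (pl \<eta>) (pl \<nu>))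
    (case_sum \<sigma> (\<lambda>t. ext (branch (\<sigma> t0) False) (\<sigma> t)))"
proof (induction \<eta> arbitrary: \<nu>)
  case Nil
  then obtain b \<nu>' where \<nu>: "\<nu> = b # \<nu>'" by (cases \<nu>) auto
  have "pl \<nu>' ` U \<subseteq> tr" using place_tree by blast
  note dsim_comb[OF \<sigma> anti t0 branch[OF st0, of b] branch[OF st0, of False] this \<sigma> place_dsim]
  moreover have "pl [] = \<sigma>" "pl \<nu> = (\<lambda>v. ext (branch (\<sigma> t0) b) (pl \<nu>' v))" using \<nu> by (auto simp: fun_eq_iff)
  ultimately show ?case by (simp only:)
next
  case (Cons b \<eta>)
  then obtain \<nu>' where \<nu>: "\<nu> = b # \<nu>'" "prefix \<eta> \<nu>'" "\<eta> \<noteq> \<nu>'" by (cases \<nu>) auto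
  let ?\<rho> = "case_sum (pl \<eta>) (pl \<nu>')"
  have "?\<rho> ` (U <+> U) \<subseteq> tr" using place_tree by auto
  note dsim_trans[OF dsim_ext[OF branch(1)[OF st0] this, of b] Cons.IH[OF \<nu>(2,3)]]
  moreover have "(\<lambda>i. ext (branch (\<sigma> t0) b) (?\<rho> i)) = case_sum (pl (b # \<eta>)) (pl \<nu>)"
    using \<nu> by (auto simp: fun_eq_iff split: sum.split)
  ultimately show ?case by (simp only:)
qed

end

end

section \<open>Ramsey's theorem for finite antichains\<close>

definition homogeneous :: "(nat set \<Rightarrow> bool) \<Rightarrow> nat \<Rightarrow> nat set \<Rightarrow> bool" where
  "homogeneous c s H \<longleftrightarrow> (\<forall>\<Lambda> \<Lambda>'. \<Lambda> \<subseteq> H \<and> \<Lambda>' \<subseteq> H \<and> card \<Lambda> = s \<and> card \<Lambda>' = s \<longrightarrow> c \<Lambda> = c \<Lambda>')"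

lemma homogeneousD:
  "\<lbrakk>homogeneous c s H; \<Lambda> \<subseteq> H; \<Lambda>' \<subseteq> H; card \<Lambda> = s; card \<Lambda>' = s\<rbrakk> \<Longrightarrow> c \<Lambda> = c \<Lambda>'"
  unfolding homogeneous_def by blast

lemma homogeneous_subset: "homogeneous c s H \<Longrightarrow> H' \<subseteq> H \<Longrightarrow> homogeneous c s H'"
  unfolding homogeneous_def by (elim all_forward imp_forward) auto

lemma ramsey_sets:
  "\<exists>N. \<forall>(A::nat set) c. finite A \<and> N \<le> card A \<longrightarrow> (\<exists>H\<subseteq>A. card H = K \<and> homogeneous c s H)"
proof -
  obtain N :: nat where N: "partn_lst {..<N} [K, K] s" using ramsey_full by blast
  have "\<exists>H\<subseteq>A. card H = K \<and> homogeneous c s H"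
    if A: "finite A" "N \<le> card A" for A :: "nat set" and c :: "nat set \<Rightarrow> bool"
  proof -
    obtain B where B: "B \<subseteq> A" "card B = N" "finite B" using A by (metis finite_subset obtain_subset_with_card_n)
    obtain g where g: "bij_betw g {..<N} B" using B ex_bij_betw_nat_finite[of B] by (auto simp: atLeast0LessThan)
    define f where "f = (\<lambda>S. if c (g ` S) then 0 else 1 :: nat)"
    have "f \<in> nsets {..<N} s \<rightarrow> {..<length [K, K]}" by (auto simp: f_def)
    then obtain i H where H: "i < length [K, K]" "H \<in> nsets {..<N} ([K, K] ! i)" "f ` nsets H s \<subseteq> {i}"
      by (rule partn_lstE[OF N _ refl]) blast
    have HN: "H \<subseteq> {..<N}" "finite H" "card H = K" using H(1,2) by (auto simp: nsets_def less_Suc_eq)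
    have gi: "inj_on g H" using g HN by (metis bij_betw_def inj_on_subset)
    show ?thesis
      unfolding homogeneous_def
    proof (intro exI[of _ "g ` H"] conjI allI impI)
      show "g ` H \<subseteq> A" using g HN B unfolding bij_betw_def by blast
      show "card (g ` H) = K" using card_image[OF gi] HN by simp
      fix \<Lambda> \<Lambda>' assume L: "\<Lambda> \<subseteq> g ` H \<and> \<Lambda>' \<subseteq> g ` H \<and> card \<Lambda> = s \<and> card \<Lambda>' = s"
      have col: "f {x \<in> H. g x \<in> T} = i \<and> g ` {x \<in> H. g x \<in> T} = T" if T: "T \<subseteq> g ` H" "card T = s" for T
      proof -
        define S where T': "S = {x \<in> H. g x \<in> T}"
        have gS: "g ` S = T" using T(1) unfolding T' by auto
        have "S \<subseteq> H" using T' by simp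
        have "inj_on g S" by (rule inj_on_subset[OF gi \<open>S \<subseteq> H\<close>])
        then have "card S = s" using card_image gS T(2) by metis
        then have "S \<in> nsets H s" using HN(2) \<open>S \<subseteq> H\<close> finite_subset[of S H] by (simp add: nsets_def)
        then have "f S = i" using H(3) by (simp add: image_subset_iff)
        then show ?thesis using gS unfolding T' by simp
      qed
      have "f {x \<in> H. g x \<in> \<Lambda>} = f {x \<in> H. g x \<in> \<Lambda>'}" using col[of \<Lambda>] col[of \<Lambda>'] L by simp
      then show "c \<Lambda> = c \<Lambda>'" using col[of \<Lambda>] col[of \<Lambda>'] L unfolding f_def by (simp split: if_splits)
    qed
  qed
  then show ?thesis by blast
qed

text \<open>\<open>K\<close> is generalized in the induction: the set that is homogeneous for the
  remaining colourings must be large enough, of size \<open>N1\<close>, to be thinned once more for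
  the new one. The arities \<open>s\<close> may vary with the colouring.\<close>

lemma ramsey_family:
  assumes "finite P"
  shows "\<exists>N. \<forall>(A::nat set) c. finite A \<and> N \<le> card A \<longrightarrow>
     (\<exists>H\<subseteq>A. card H = K \<and> (\<forall>\<pi>\<in>P. homogeneous (c \<pi>) (s \<pi>) H))"
  using assms
proof (induction P arbitrary: K rule: finite_induct)
  case empty
  have "\<exists>H\<subseteq>A. card H = K" if "K \<le> card A" for A :: "nat set"
    by (rule obtain_subset_with_card_n[OF that]) blast
  then show ?case by (intro exI[of _ K]) simp
next
  case (insert p P)
  obtain N1 where N1: "\<forall>(A::nat set) c. finite A \<and> N1 \<le> card A \<longrightarrow> (\<exists>H\<subseteq>A. card H = K \<and> homogeneous c (s p) H)"
    using ramsey_sets[of K "s p"] ..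
  obtain N2 where N2: "\<forall>(A::nat set) c. finite A \<and> N2 \<le> card A \<longrightarrow>
      (\<exists>H\<subseteq>A. card H = N1 \<and> (\<forall>\<pi>\<in>P. homogeneous (c \<pi>) (s \<pi>) H))"
    using insert.IH[of N1] ..
  show ?case
  proof (intro exI[of _ N2] allI impI, elim conjE)
    fix A :: "nat set" and c assume A: "finite A" "N2 \<le> card A"
    then obtain H where H: "H \<subseteq> A" "card H = N1" "\<forall>\<pi>\<in>P. homogeneous (c \<pi>) (s \<pi>) H"
      using N2 by blast
    have "finite H" using H(1) A(1) finite_subset by blast
    then obtain H' where H': "H' \<subseteq> H" "card H' = K" "homogeneous (c p) (s p) H'"
      using N1 H(2) by blast
    have "\<forall>\<pi>\<in>insert p P. homogeneous (c \<pi>) (s \<pi>) H'"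
      using H(3) H'(1,3) homogeneous_subset by blast
    then show "\<exists>H\<subseteq>A. card H = K \<and> (\<forall>\<pi>\<in>insert p P. homogeneous (c \<pi>) (s \<pi>) H)"
      using H(1) H'(1,2) by (intro exI[of _ H']) auto
  qed
qed

text \<open>A list is coded by the set of its entries and this list of ranks. The set is what
  Ramsey's theorem can colour; the ranks depend only on the relative order of the entries.\<close>

definition pattern :: "nat list \<Rightarrow> nat list" where
  "pattern r = map (\<lambda>x. card {y \<in> set r. y < x}) r"

lemma sorted_list_nth_card:
  assumes "finite A" "x \<in> A"
  shows "card {y \<in> A. y < x} < card A" "sorted_list_of_set A ! card {y \<in> A. y < x} = (x :: nat)"
proof -
  let ?L = "sorted_list_of_set A"
  have L: "set ?L = A" "sorted_wrt (<) ?L" "length ?L = card A" using assms by (auto simp: length_sorted_list_of_set)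
  obtain k where k: "k < card A" "?L ! k = x" using assms L by (metis in_set_conv_nth)
  have lt: "?L ! i < ?L ! k \<longleftrightarrow> i < k" if "i < card A" for i
    using that k(1) L(2,3) sorted_wrt_nth_less[of "(<)" ?L i k] sorted_wrt_nth_less[of "(<)" ?L k i]
    by (metis less_asym less_irrefl nat_neq_iff)
  have "{y \<in> A. y < x} = (!) ?L ` {..<k}"
  proof (intro set_eqI iffI)
    fix y assume "y \<in> {y \<in> A. y < x}"
    then obtain i where "i < card A" "?L ! i = y" "y < x" using L by (metis (no_types, lifting) in_set_conv_nth mem_Collect_eq)
    then show "y \<in> (!) ?L ` {..<k}" using lt k by auto
  next
    fix y assume "y \<in> (!) ?L ` {..<k}"
    then obtain i where "i < k" "y = ?L ! i" by auto
    then show "y \<in> {y \<in> A. y < x}" using lt[of i] k L nth_mem[of i ?L] by auto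
  qed
  moreover have "inj_on ((!) ?L) {..<k}"
    using L k by (auto simp: inj_on_def nth_eq_iff_index_eq)
  ultimately have "card {y \<in> A. y < x} = k" by (simp add: card_image)
  then show "card {y \<in> A. y < x} < card A" "?L ! card {y \<in> A. y < x} = x" using k by simp_all
qed

lemma pattern_nth: "s < length r \<Longrightarrow> pattern r ! s < card (set r) \<and> sorted_list_of_set (set r) ! (pattern r ! s) = r ! s"
  using sorted_list_nth_card[of "set r" "r ! s"] by (simp add: pattern_def)

lemma length_pattern [simp]: "length (pattern r) = length r"
  by (simp add: pattern_def)

lemma pattern_map: "map ((!) (sorted_list_of_set (set r))) (pattern r) = r"
  by (rule nth_equalityI) (simp_all add: pattern_nth)

lemma pattern_bound: "set (pattern r) \<subseteq> {..<length r}"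
proof
  fix k assume "k \<in> set (pattern r)"
  then obtain s where "s < length r" "k = pattern r ! s" by (auto simp: in_set_conv_nth)
  then have "k < card (set r)" using pattern_nth by blast
  then show "k \<in> {..<length r}" using card_length[of r] by simp
qed

text \<open>Sending \<open>r ! s\<close> to \<open>r' ! s\<close> is well defined and injective,
  because equality of entries can be read off the order; it carries the entries below
  \<open>r ! t\<close> onto those below \<open>r' ! t\<close>.\<close>

lemma pattern_eq:
  assumes l: "length r = length r'"
    and o: "\<And>s t. s < length r \<Longrightarrow> t < length r \<Longrightarrow> r ! s < r ! t \<longleftrightarrow> r' ! s < r' ! t"
  shows "pattern r = pattern r'" "card (set r) = card (set r')"
proof -
  have eq: "r ! s = r ! t \<longleftrightarrow> r' ! s = r' ! t" if "s < length r" "t < length r" for s t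
    using o[OF that] o[OF that(2,1)] by (metis nat_neq_iff)
  define f where "f x = r' ! (SOME s. s < length r \<and> r ! s = x)" for x
  have f: "f (r ! s) = r' ! s" if "s < length r" for s
  proof -
    have "\<exists>t. t < length r \<and> r ! t = r ! s" using that by blast
    then have "(SOME t. t < length r \<and> r ! t = r ! s) < length r \<and> r ! (SOME t. t < length r \<and> r ! t = r ! s) = r ! s"
      by (rule someI_ex)
    then show ?thesis unfolding f_def using eq that by blast
  qed
  have S: "set r = (!) r ` {..<length r}" "set r' = (!) r' ` {..<length r}"
    using l by (auto simp: set_conv_nth)
  have im: "f ` {y \<in> set r. y < r ! t} = {y \<in> set r'. y < r' ! t}" if "t < length r" for t
    using f o that unfolding S by (auto simp: image_iff) (metis lessThan_iff)
  have inj: "inj_on f (set r)" unfolding S inj_on_def using f eq by auto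
  have "f ` set r = set r'" unfolding S using f by (auto simp: image_iff)
  then show "card (set r) = card (set r')" using card_image[OF inj] by simp
  have "card {y \<in> set r. y < r ! t} = card {y \<in> set r'. y < r' ! t}" if "t < length r" for t
    unfolding im[OF that, symmetric] using inj by (subst card_image) (auto simp: inj_on_def)
  then show "pattern r = pattern r'" using l by (auto simp: pattern_def intro!: nth_equalityI)
qed

text \<open>Leaves of a tree of height \<open>h\<close> whose labels increase in depth-first order: a tuple of such leaves
  is determined by the set of its labels and the levels at which consecutive leaves split, so
  Ramsey's theorem for sets of labels and then for sets of levels applies.\<close>

definition late :: "nat \<Rightarrow> nat list \<Rightarrow> nat list \<Rightarrow> bool" where
  "late h x y \<longleftrightarrow> (\<exists>\<mu><h. take \<mu> x = take \<mu> y \<and> x ! (h - 1) < y ! \<mu>)"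

definition dfs :: "nat \<Rightarrow> nat list list \<Rightarrow> bool" where
  "dfs h ys \<longleftrightarrow> (\<forall>y\<in>set ys. length y = h \<and> sorted_wrt (<) y) \<and> sorted_wrt (late h) ys"

definition lev :: "nat list \<Rightarrow> nat list \<Rightarrow> nat" where
  "lev x y = (LEAST i. x ! i \<noteq> y ! i)"

fun levs :: "nat list \<Rightarrow> nat list list \<Rightarrow> nat list" where
  "levs x [] = []"
| "levs x (y # ys) = lev x y # levs y ys"

text \<open>The labels of each leaf that are not shared with its predecessor. Appended to the first
  leaf, they list all labels of the tuple once each.\<close>

fun rest :: "nat list \<Rightarrow> nat list list \<Rightarrow> nat list" where
  "rest x [] = []"
| "rest x (y # ys) = drop (lev x y) y @ rest y ys"

text \<open>The inverse of \<open>rest\<close> for a given list of levels: each leaf copies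
  \<open>\<mu>\<close> labels from the previous one and consumes \<open>h - \<mu>\<close> new
  ones.\<close>

fun unfl :: "nat \<Rightarrow> nat list \<Rightarrow> nat list \<Rightarrow> nat list \<Rightarrow> nat list list" where
  "unfl h x [] L = []"
| "unfl h x (\<mu> # \<mu>s) L = (take \<mu> x @ take (h - \<mu>) L) # unfl h (take \<mu> x @ take (h - \<mu>) L) \<mu>s (drop (h - \<mu>) L)"

lemma length_levs [simp]: "length (levs x ys) = length ys"
  by (induction ys arbitrary: x) auto

lemma levs_nth: "s < length ys \<Longrightarrow> levs x ys ! s = lev ((x # ys) ! s) (ys ! s)"
  by (induction ys arbitrary: x s) (auto simp: nth_Cons split: nat.split)

lemma lev_eq: "take \<mu> x = take \<mu> y \<Longrightarrow> \<mu> \<le> length x \<Longrightarrow> \<mu> \<le> length y \<Longrightarrow> x ! \<mu> \<noteq> y ! \<mu> \<Longrightarrow> lev x y = \<mu>"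
  unfolding lev_def
proof (rule Least_equality)
  fix i assume a: "take \<mu> x = take \<mu> y" "\<mu> \<le> length x" "\<mu> \<le> length y" "x ! i \<noteq> y ! i"
  show "\<mu> \<le> i" using a(4) nth_take[of i \<mu> x] nth_take[of i \<mu> y] a(1) by (metis not_le)
qed

lemma sorted_le_last: "sorted_wrt (<) (y :: nat list) \<Longrightarrow> length y = h \<Longrightarrow> i < h \<Longrightarrow> y ! i \<le> y ! (h - 1)"
  using sorted_wrt_nth_less[of "(<)" y i "h - 1"] by (cases "i = h - 1") (simp, fastforce)

lemma late_lev:
  assumes "late h x y" "length x = h" "length y = h" "sorted_wrt (<) x"
  shows "lev x y < h" "take (lev x y) x = take (lev x y) y" "x ! (h - 1) < y ! lev x y"
proof -
  obtain \<mu> where \<mu>: "\<mu> < h" "take \<mu> x = take \<mu> y" "x ! (h - 1) < y ! \<mu>" using assms(1) by (auto simp: late_def)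
  have "x ! \<mu> \<noteq> y ! \<mu>" using sorted_le_last[OF assms(4,2) \<mu>(1)] \<mu>(3) by simp
  then have "lev x y = \<mu>" using lev_eq \<mu> assms by simp
  then show "lev x y < h" "take (lev x y) x = take (lev x y) y" "x ! (h - 1) < y ! lev x y" using \<mu> by simp_all
qed

lemma unfl_rest: "dfs h (x # ys) \<Longrightarrow> unfl h x (levs x ys) (rest x ys) = ys"
proof (induction ys arbitrary: x)
  case (Cons y ys)
  have xy: "late h x y" "length x = h" "length y = h" "sorted_wrt (<) x" and "dfs h (y # ys)"
    using Cons.prems by (auto simp: dfs_def)
  note lev = late_lev[OF xy]
  have "take (lev x y) x @ take (h - lev x y) (drop (lev x y) y @ rest y ys) = y"
    using lev xy by simp
  moreover have "drop (h - lev x y) (drop (lev x y) y @ rest y ys) = rest y ys"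
    using lev xy by simp
  ultimately show ?case using Cons.IH[OF \<open>dfs h (y # ys)\<close>] by simp
qed simp

text \<open>By \<open>late\<close> the new labels of a leaf exceed the last, hence the largest,
  label of its predecessor. So the labels in order of appearance are already sorted and can be
  recovered from their set.\<close>

lemma sorted_rest: "dfs h (x # ys) \<Longrightarrow> sorted_wrt (<) (x @ rest x ys)"
proof (induction ys arbitrary: x)
  case (Cons y ys)
  have xy: "late h x y" "length x = h" "length y = h" "sorted_wrt (<) x" and "dfs h (y # ys)"
    using Cons.prems by (auto simp: dfs_def)
  note lev = late_lev[OF xy]
  have s: "sorted_wrt (<) (y @ rest y ys)" using Cons.IH[OF \<open>dfs h (y # ys)\<close>] .
  then have "sorted_wrt (<) (drop (lev x y) (y @ rest y ys))" by (rule sorted_wrt_drop)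
  then have s': "sorted_wrt (<) (drop (lev x y) y @ rest y ys)" using lev(1) xy by simp
  obtain D where D: "drop (lev x y) y @ rest y ys = y ! lev x y # D"
    using Cons_nth_drop_Suc[of "lev x y" y] lev(1) xy(3) append_Cons by metis
  have "b = y ! lev x y \<or> y ! lev x y < b" if "b \<in> set (drop (lev x y) y @ rest y ys)" for b
  proof -
    have "\<forall>b\<in>set D. y ! lev x y < b" using s' unfolding D sorted_wrt.simps by simp
    then show ?thesis using that unfolding D by auto
  qed
  moreover have "a < y ! lev x y" if a: "a \<in> set x" for a
  proof -
    obtain i where i: "i < length x" "x ! i = a" using a unfolding in_set_conv_nth by blast
    then show ?thesis using sorted_le_last[OF xy(4,2), of i] xy(2) lev(3) by simp
  qed
  ultimately have "a < b" if "a \<in> set x" "b \<in> set (drop (lev x y) y @ rest y ys)" for a b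
    using that by fastforce
  then show ?case using s' xy(4) by (simp add: sorted_wrt_append)
qed (simp add: dfs_def)

lemma length_rest: "dfs h (x # ys) \<Longrightarrow> length (rest x ys) = (\<Sum>\<mu>\<leftarrow>levs x ys. h - \<mu>)"
proof (induction ys arbitrary: x)
  case (Cons y ys)
  then have "dfs h (y # ys)" "length y = h" by (auto simp: dfs_def)
  then show ?case using Cons.IH by simp
qed simp

lemma set_rest: "set (rest x ys) \<subseteq> \<Union> (set ` set ys)"
  by (induction ys arbitrary: x) (auto dest: in_set_dropD)

definition tup :: "nat \<Rightarrow> nat list \<Rightarrow> nat set \<Rightarrow> nat list list" where
  "tup h \<mu>s Q = (let L = sorted_list_of_set Q in take h L # unfl h (take h L) \<mu>s (drop h L))"

lemma dfs_tup:
  assumes "dfs h (x # ys)"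
  shows "card (set (x @ rest x ys)) = h + (\<Sum>\<mu>\<leftarrow>levs x ys. h - \<mu>)"
    and "tup h (levs x ys) (set (x @ rest x ys)) = x # ys"
proof -
  have s: "sorted_wrt (<) (x @ rest x ys)" by (rule sorted_rest[OF assms])
  have "length x = h" using assms by (simp add: dfs_def)
  have L: "sorted_list_of_set (set (x @ rest x ys)) = x @ rest x ys"
    using s by (metis sorted_list_of_set.idem_if_sorted_distinct strict_sorted_iff)
  have "card (set (x @ rest x ys)) = length (x @ rest x ys)"
    using s distinct_card strict_sorted_iff by blast
  then show "card (set (x @ rest x ys)) = h + (\<Sum>\<mu>\<leftarrow>levs x ys. h - \<mu>)"
    using length_rest[OF assms] \<open>length x = h\<close> by simp
  show "tup h (levs x ys) (set (x @ rest x ys)) = x # ys"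
    unfolding tup_def L Let_def using unfl_rest[OF assms] \<open>length x = h\<close> by simp
qed

lemma dfs_levs_less: "dfs h (x # ys) \<Longrightarrow> set (levs x ys) \<subseteq> {..<h}"
proof (induction ys arbitrary: x)
  case (Cons y ys)
  then have "late h x y" "length x = h" "length y = h" "sorted_wrt (<) x" "dfs h (y # ys)" by (auto simp: dfs_def)
  then show ?case using Cons.IH late_lev(1) by simp
qed simp

text \<open>Once the level list is fixed, a tuple amounts to a set of labels of a fixed size,
  decoded by \<open>tup\<close>, so \<open>Q q\<close> becomes a colouring of sets. Only finitely
  many level lists occur, as both their entries and their lengths are bounded.\<close>

lemma dfs_ramsey_labels:
  assumes "finite J"
  shows "\<exists>N. \<forall>Q :: 'q \<Rightarrow> nat list list \<Rightarrow> bool. \<exists>H\<subseteq>{..<N}. card H = K \<and>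
    (\<forall>q\<in>J. \<forall>x ys x' ys'. dfs h (x # ys) \<and> dfs h (x' # ys') \<and> length ys < n \<and> levs x ys = levs x' ys' \<and>
      set x \<union> \<Union> (set ` set ys) \<subseteq> H \<and> set x' \<union> \<Union> (set ` set ys') \<subseteq> H \<longrightarrow> Q q (x # ys) = Q q (x' # ys'))"
proof -
  let ?P = "J \<times> {\<mu>s. set \<mu>s \<subseteq> {..<h} \<and> length \<mu>s \<le> n}"
  have "finite ?P" using assms finite_lists_length_le[of "{..<h}" n] by simp
  from ramsey_family[OF this, of K "\<lambda>(q, \<mu>s). h + (\<Sum>\<mu>\<leftarrow>\<mu>s. h - \<mu>)"]
  obtain N where N: "\<forall>(A::nat set) c. finite A \<and> N \<le> card A \<longrightarrow> (\<exists>H\<subseteq>A. card H = K \<and>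
    (\<forall>\<pi>\<in>?P. homogeneous (c \<pi>) (case \<pi> of (q, \<mu>s) \<Rightarrow> h + (\<Sum>\<mu>\<leftarrow>\<mu>s. h - \<mu>)) H))" ..
  show ?thesis
  proof (intro exI[of _ N] allI)
    fix Q :: "'q \<Rightarrow> nat list list \<Rightarrow> bool"
    define c where "c = (\<lambda>(q, \<mu>s) \<Lambda>. Q q (tup h \<mu>s \<Lambda>))"
    have "\<exists>H\<subseteq>{..<N}. card H = K \<and> (\<forall>\<pi>\<in>?P. homogeneous (c \<pi>) (case \<pi> of (q, \<mu>s) \<Rightarrow> h + (\<Sum>\<mu>\<leftarrow>\<mu>s. h - \<mu>)) H)"
      by (rule mp[OF spec[OF spec[OF N]]]) simp
    then obtain H where H0: "H \<subseteq> {..<N} \<and> card H = K \<and>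
        (\<forall>\<pi>\<in>?P. homogeneous (c \<pi>) (case \<pi> of (q, \<mu>s) \<Rightarrow> h + (\<Sum>\<mu>\<leftarrow>\<mu>s. h - \<mu>)) H)" ..
    have H: "Q q (tup h \<mu>s \<Lambda>) = Q q (tup h \<mu>s \<Lambda>')"
      if "q \<in> J" "set \<mu>s \<subseteq> {..<h}" "length \<mu>s \<le> n" "\<Lambda> \<subseteq> H" "\<Lambda>' \<subseteq> H"
        "card \<Lambda> = h + (\<Sum>\<mu>\<leftarrow>\<mu>s. h - \<mu>)" "card \<Lambda>' = h + (\<Sum>\<mu>\<leftarrow>\<mu>s. h - \<mu>)" for q \<mu>s \<Lambda> \<Lambda>'
    proof -
      have "(q, \<mu>s) \<in> ?P" using that(1-3) by simp
      with H0 have "homogeneous (c (q, \<mu>s)) (h + (\<Sum>\<mu>\<leftarrow>\<mu>s. h - \<mu>)) H" by fastforce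
      from homogeneousD[OF this that(4-7)] show ?thesis by (simp add: c_def)
    qed
    show "\<exists>H\<subseteq>{..<N}. card H = K \<and>
      (\<forall>q\<in>J. \<forall>x ys x' ys'. dfs h (x # ys) \<and> dfs h (x' # ys') \<and> length ys < n \<and> levs x ys = levs x' ys' \<and>
        set x \<union> \<Union> (set ` set ys) \<subseteq> H \<and> set x' \<union> \<Union> (set ` set ys') \<subseteq> H \<longrightarrow> Q q (x # ys) = Q q (x' # ys'))"
    proof (intro exI[of _ H] conjI ballI allI impI; (elim conjE)?)
      fix q x ys x' ys'
      assume a: "q \<in> J" "dfs h (x # ys)" "dfs h (x' # ys')" "length ys < n" "levs x ys = levs x' ys'"
        "set x \<union> \<Union> (set ` set ys) \<subseteq> H" "set x' \<union> \<Union> (set ` set ys') \<subseteq> H"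
      have "Q q (tup h (levs x ys) (set (x @ rest x ys))) = Q q (tup h (levs x ys) (set (x' @ rest x' ys')))"
      proof (rule H[OF a(1)])
        show "set (levs x ys) \<subseteq> {..<h}" by (rule dfs_levs_less[OF a(2)])
        show "length (levs x ys) \<le> n" using a(4) by simp
        show "set (x @ rest x ys) \<subseteq> H" using set_rest[of x ys] a(6) by auto
        show "set (x' @ rest x' ys') \<subseteq> H" using set_rest[of x' ys'] a(7) by auto
      qed (use dfs_tup(1)[OF a(2)] dfs_tup(1)[OF a(3)] a(5) in simp_all)
      then show "Q q (x # ys) = Q q (x' # ys')" using dfs_tup(2)[OF a(2)] dfs_tup(2)[OF a(3)] a(5) by simp
    qed (use H0 in auto)
  qed
qed

text \<open>After the labels are thinned, \<open>Q\<close> depends on the level list only, and for a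
  fixed pattern a level list is a set of levels: a second use of Ramsey's theorem. The bounds are
  chosen in the opposite order, since the number of labels depends on the height \<open>h\<close>,
  which must be large enough to thin the levels. The size \<open>h * n\<close> of \<open>H\<close>
  leaves \<open>n\<close> disjoint blocks of \<open>h\<close> labels from which leaves can be
  built.\<close>

lemma dfs_ramsey:
  assumes "finite J"
  shows "\<exists>h N. \<forall>Q :: 'q \<Rightarrow> nat list list \<Rightarrow> bool. \<exists>E\<subseteq>{..<h}. \<exists>H\<subseteq>{..<N}. card E = k \<and> card H = h * n \<and>
    (\<forall>q\<in>J. \<forall>x ys x' ys'. dfs h (x # ys) \<and> dfs h (x' # ys') \<and> length ys < n \<and>
      pattern (levs x ys) = pattern (levs x' ys') \<and> card (set (levs x ys)) = card (set (levs x' ys')) \<and>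
      set (levs x ys) \<subseteq> E \<and> set (levs x' ys') \<subseteq> E \<and>
      set x \<union> \<Union> (set ` set ys) \<subseteq> H \<and> set x' \<union> \<Union> (set ` set ys') \<subseteq> H \<longrightarrow> Q q (x # ys) = Q q (x' # ys'))"
proof -
  let ?P = "J \<times> {\<pi>. set \<pi> \<subseteq> {..<n} \<and> length \<pi> \<le> n} \<times> {..n}"
  have "finite ?P" using assms finite_lists_length_le[of "{..<n}" n] by simp
  from ramsey_family[OF this, of k "\<lambda>(q, \<pi>, m). m"]
  obtain h where h: "\<forall>(A::nat set) c. finite A \<and> h \<le> card A \<longrightarrow> (\<exists>H\<subseteq>A. card H = k \<and>
    (\<forall>\<pi>\<in>?P. homogeneous (c \<pi>) (case \<pi> of (q, \<pi>, m) \<Rightarrow> m) H))" ..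
  from dfs_ramsey_labels[OF assms, of "h * n" h n]
  obtain N where N: "\<And>Q :: 'q \<Rightarrow> nat list list \<Rightarrow> bool. \<exists>H\<subseteq>{..<N}. card H = h * n \<and>
    (\<forall>q\<in>J. \<forall>x ys x' ys'. dfs h (x # ys) \<and> dfs h (x' # ys') \<and> length ys < n \<and> levs x ys = levs x' ys' \<and>
      set x \<union> \<Union> (set ` set ys) \<subseteq> H \<and> set x' \<union> \<Union> (set ` set ys') \<subseteq> H \<longrightarrow> Q q (x # ys) = Q q (x' # ys'))"
    by (elim exE) (rule, erule spec)
  show ?thesis
  proof (rule exI[of _ h], rule exI[of _ N], rule allI)
    fix Q :: "'q \<Rightarrow> nat list list \<Rightarrow> bool"
    obtain H where H0: "H \<subseteq> {..<N} \<and> card H = h * n \<and>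
      (\<forall>q\<in>J. \<forall>x ys x' ys'. dfs h (x # ys) \<and> dfs h (x' # ys') \<and> length ys < n \<and> levs x ys = levs x' ys' \<and>
      set x \<union> \<Union> (set ` set ys) \<subseteq> H \<and> set x' \<union> \<Union> (set ` set ys') \<subseteq> H \<longrightarrow> Q q (x # ys) = Q q (x' # ys'))"
      using N[of Q] ..
    then have H: "H \<subseteq> {..<N}" "card H = h * n" "\<And>q x ys x' ys'. \<lbrakk>q \<in> J; dfs h (x # ys); dfs h (x' # ys'); length ys < n; levs x ys = levs x' ys';
      set x \<union> \<Union> (set ` set ys) \<subseteq> H; set x' \<union> \<Union> (set ` set ys') \<subseteq> H\<rbrakk> \<Longrightarrow> Q q (x # ys) = Q q (x' # ys')"
      by blast+
    \<comment> \<open>The common truth value of \<open>Q q\<close> on the tuples with level list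
      \<open>\<mu>s\<close> and labels in \<open>H\<close>; false if there are none.\<close>
    define c where "c q \<mu>s \<longleftrightarrow> (\<exists>x ys. dfs h (x # ys) \<and> length ys < n \<and> levs x ys = \<mu>s \<and>
      set x \<union> \<Union> (set ` set ys) \<subseteq> H \<and> Q q (x # ys))" for q \<mu>s
    have c: "c q (levs x ys) \<longleftrightarrow> Q q (x # ys)"
      if "q \<in> J" "dfs h (x # ys)" "length ys < n" "set x \<union> \<Union> (set ` set ys) \<subseteq> H" for q x ys
      using H(3)[OF that(1)] that unfolding c_def by metis
    define d where "d = (\<lambda>(q, \<pi>, m :: nat) \<Lambda>. c q (map ((!) (sorted_list_of_set \<Lambda>)) \<pi>))"
    have "\<exists>E\<subseteq>{..<h}. card E = k \<and> (\<forall>\<pi>\<in>?P. homogeneous (d \<pi>) (case \<pi> of (q, \<pi>, m) \<Rightarrow> m) E)"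
      by (rule mp[OF spec[OF spec[OF h]]]) simp
    then obtain E where E0: "E \<subseteq> {..<h} \<and> card E = k \<and>
        (\<forall>\<pi>\<in>?P. homogeneous (d \<pi>) (case \<pi> of (q, \<pi>, m) \<Rightarrow> m) E)" ..
    have E: "c q (map ((!) (sorted_list_of_set \<Lambda>)) \<pi>) = c q (map ((!) (sorted_list_of_set \<Lambda>')) \<pi>)"
      if "q \<in> J" "set \<pi> \<subseteq> {..<n}" "length \<pi> \<le> n" "m \<le> n" "\<Lambda> \<subseteq> E" "\<Lambda>' \<subseteq> E" "card \<Lambda> = m" "card \<Lambda>' = m"
      for q \<pi> m \<Lambda> \<Lambda>'
    proof -
      have "(q, \<pi>, m) \<in> ?P" using that(1-4) by simp
      with E0 have "homogeneous (d (q, \<pi>, m)) m E" by fastforce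
      from homogeneousD[OF this that(5-8)] show ?thesis by (simp add: d_def)
    qed
    show "\<exists>E\<subseteq>{..<h}. \<exists>H\<subseteq>{..<N}. card E = k \<and> card H = h * n \<and>
    (\<forall>q\<in>J. \<forall>x ys x' ys'. dfs h (x # ys) \<and> dfs h (x' # ys') \<and> length ys < n \<and>
      pattern (levs x ys) = pattern (levs x' ys') \<and> card (set (levs x ys)) = card (set (levs x' ys')) \<and>
      set (levs x ys) \<subseteq> E \<and> set (levs x' ys') \<subseteq> E \<and>
      set x \<union> \<Union> (set ` set ys) \<subseteq> H \<and> set x' \<union> \<Union> (set ` set ys') \<subseteq> H \<longrightarrow> Q q (x # ys) = Q q (x' # ys'))"
    proof (rule exI[of _ E], rule conjI, goal_cases)
      case 2
      show ?case
      proof (rule exI[of _ H], intro conjI ballI allI impI; (elim conjE)?)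
      fix q x ys x' ys'
      assume a: "q \<in> J" "dfs h (x # ys)" "dfs h (x' # ys')" "length ys < n"
        "pattern (levs x ys) = pattern (levs x' ys')" "card (set (levs x ys)) = card (set (levs x' ys'))"
        "set (levs x ys) \<subseteq> E" "set (levs x' ys') \<subseteq> E"
        "set x \<union> \<Union> (set ` set ys) \<subseteq> H" "set x' \<union> \<Union> (set ` set ys') \<subseteq> H"
      have l: "length ys' = length ys" using arg_cong[OF a(5), of length] by simp
      have "c q (map ((!) (sorted_list_of_set (set (levs x ys)))) (pattern (levs x ys))) =
        c q (map ((!) (sorted_list_of_set (set (levs x' ys')))) (pattern (levs x ys)))"
      proof (rule E[OF a(1) _ _ _ a(7,8) refl a(6)[symmetric]])
        show "set (pattern (levs x ys)) \<subseteq> {..<n}" using pattern_bound[of "levs x ys"] a(4) by auto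
        show "length (pattern (levs x ys)) \<le> n" using a(4) by simp
        show "card (set (levs x ys)) \<le> n" using card_length[of "levs x ys"] a(4) by simp
      qed
      then have "c q (levs x ys) = c q (levs x' ys')" using a(5) pattern_map by metis
      then show "Q q (x # ys) = Q q (x' # ys')" using c a l by metis
      qed (use H E0 in auto)
    qed (use E0 in simp)
  qed
qed

section \<open>Leaves with prescribed splitting levels\<close>

lemma sorted_list_nth_less:
  assumes "finite A" "i < j" "j < card A"
  shows "sorted_list_of_set A ! i < sorted_list_of_set A ! (j :: nat)"
proof -
  have "sorted_wrt (<) (sorted_list_of_set A)" using assms(1) by simp
  then show ?thesis using sorted_wrt_nth_less[of "(<)" "sorted_list_of_set A" i j] assms by simp
qed

lemma sorted_list_nth_in: "finite A \<Longrightarrow> i < card A \<Longrightarrow> sorted_list_of_set A ! i \<in> A"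
  using nth_mem[of i "sorted_list_of_set A"] by simp

text \<open>The label of the \<open>i\<close>-th leaf at depth \<open>l\<close>: leaf
  \<open>Suc i\<close> keeps the first \<open>lam i\<close> labels of leaf \<open>i\<close> and
  takes the others from its own block of \<open>h\<close> fresh numbers.\<close>

primrec leaf :: "(nat \<Rightarrow> nat) \<Rightarrow> nat \<Rightarrow> (nat \<Rightarrow> nat) \<Rightarrow> nat \<Rightarrow> nat \<Rightarrow> nat" where
  "leaf g h lam 0 l = g l"
| "leaf g h lam (Suc i) l = (if l < lam i then leaf g h lam i l else g (h * Suc i + l))"

context
  fixes g :: "nat \<Rightarrow> nat" and h M :: nat and lam :: "nat \<Rightarrow> nat"
  assumes g: "\<And>i j. i < j \<Longrightarrow> j < h * M \<Longrightarrow> g i < g j"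
begin

lemma block_less: "\<lbrakk>j \<le> i; i < M; l < h\<rbrakk> \<Longrightarrow> h * j + l < h * M"
proof -
  assume a: "j \<le> i" "i < M" "l < h"
  then have "h * Suc j \<le> h * M" by (intro mult_le_mono2) simp
  then show ?thesis using a(3) by simp
qed

lemma leaf_form: "\<exists>j\<le>i. leaf g h lam i l = g (h * j + l)"
proof (induction i)
  case (Suc i)
  then obtain j where "j \<le> i" "leaf g h lam i l = g (h * j + l)" by blast
  then show ?case by (cases "l < lam i") (auto intro: exI[of _ j] exI[of _ "Suc i"])
qed simp

lemma leaf_new: "\<lbrakk>i < k; k < M; l < h; l' < h\<rbrakk> \<Longrightarrow> leaf g h lam i l < g (h * k + l')"
proof -
  assume a: "i < k" "k < M" "l < h" "l' < h"
  obtain j where j: "j \<le> i" "leaf g h lam i l = g (h * j + l)" using leaf_form by blast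
  have "h * Suc j \<le> h * k" using j(1) a(1) by (intro mult_le_mono2) simp
  then have "h * j + l < h * k + l'" using a(3) by simp
  then show ?thesis using g block_less[of k k l'] a j(2) by simp
qed

lemma leaf_sorted: "\<lbrakk>i < M; l < l'; l' < h\<rbrakk> \<Longrightarrow> leaf g h lam i l < leaf g h lam i l'"
proof (induction i)
  case 0
  then show ?case using g[of l l'] block_less[of 0 0 l'] by simp
next
  case (Suc i)
  show ?case
  proof (cases "l < lam i")
    case True
    then show ?thesis using Suc leaf_new[of i "Suc i" l l'] by auto
  next
    case False
    then show ?thesis using Suc.prems g[of "h * Suc i + l" "h * Suc i + l'"] block_less[of "Suc i" "Suc i" l'] by simp
  qed
qed

text \<open>In passing from leaf \<open>j\<close> to the next, the number of labels shared with leaf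
  \<open>i\<close> drops to its minimum with \<open>lam j\<close>. The ultrametric identity says the
  same of \<open>a\<close>, so prescribing the levels of neighbours prescribes all of them.\<close>

lemma leaf_late:
  assumes a: "\<And>i j k. i < j \<Longrightarrow> j < k \<Longrightarrow> k < M \<Longrightarrow> a i k = min (a i j) (a j k)"
    and lam: "\<And>i. Suc i < M \<Longrightarrow> a i (Suc i) = lam i"
  shows "i < j \<Longrightarrow> j < M \<Longrightarrow> l < h \<Longrightarrow>
    (l < a i j \<longrightarrow> leaf g h lam j l = leaf g h lam i l) \<and> (a i j \<le> l \<longrightarrow> leaf g h lam i (h - 1) < leaf g h lam j l)"
proof (induction j)
  case (Suc j)
  have new: "leaf g h lam i (h - 1) < g (h * Suc j + l)" using leaf_new[of i "Suc j" "h - 1" l] Suc.prems by simp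
  show ?case
  proof (cases "i = j")
    case True
    then show ?thesis using lam[of j] Suc.prems new by auto
  next
    case False
    then have ij: "i < j" using Suc.prems by simp
    have "a i (Suc j) = min (a i j) (lam j)" using a[OF ij, of "Suc j"] lam[of j] Suc.prems by simp
    then show ?thesis using Suc.IH[OF ij] Suc.prems new by auto
  qed
qed simp

end

text \<open>In increasing order \<open>H\<close> falls into \<open>M\<close> blocks of
  \<open>h\<close> labels, one block of fresh labels for each leaf.\<close>

lemma dfs_build:
  assumes H: "finite H" "card H = h * M"
    and less: "\<And>i j. i < j \<Longrightarrow> j < M \<Longrightarrow> a i j < h"
    and a: "\<And>i j k. i < j \<Longrightarrow> j < k \<Longrightarrow> k < M \<Longrightarrow> a i k = min (a i j) (a j k)"
  obtains y where "\<And>i. i < M \<Longrightarrow> length (y i) = h \<and> sorted_wrt (<) (y i) \<and> set (y i) \<subseteq> H"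
    and "\<And>i j. i < j \<Longrightarrow> j < M \<Longrightarrow> late h (y i) (y j) \<and> lev (y i) (y j) = a i j"
proof -
  define g where "g = (!) (sorted_list_of_set H)"
  define Y where "Y i l = leaf g h (\<lambda>i. a i (Suc i)) i l" for i l
  have g: "i < j \<Longrightarrow> j < h * M \<Longrightarrow> g i < g j" for i j
    using sorted_list_nth_less[of H i j] H by (simp add: g_def)
  define y where "y i = map (Y i) [0..<h]" for i
  have nth: "y i ! l = Y i l" if "l < h" for i l using that by (simp add: y_def)
  have sorted: "sorted_wrt (<) (y i)" if "i < M" for i
    using leaf_sorted[of h M g i, OF g] that by (auto simp: y_def Y_def sorted_wrt_iff_nth_less)
  have in_H: "set (y i) \<subseteq> H" if i: "i < M" for i
  proof
    fix b assume "b \<in> set (y i)"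
    then obtain l where l: "l < h" "b = Y i l" by (auto simp: y_def)
    obtain j where j: "j \<le> i" "Y i l = g (h * j + l)" using leaf_form[of h M g, OF g] unfolding Y_def by blast
    show "b \<in> H" using sorted_list_nth_in[of H "h * j + l"] H block_less[of h M g j i l, OF g j(1) i l(1)] l(2) j(2)
      by (simp add: g_def)
  qed
  have "late h (y i) (y j) \<and> lev (y i) (y j) = a i j" if ij: "i < j" "j < M" for i j
  proof -
    have L: "(l < a i j \<longrightarrow> Y j l = Y i l) \<and> (a i j \<le> l \<longrightarrow> Y i (h - 1) < Y j l)" if "l < h" for l
      unfolding Y_def using leaf_late[of h M g a "\<lambda>i. a i (Suc i)", OF g a _ ij that] by simp
    have m: "a i j < h" using less ij by blast
    have "take (a i j) (y i) = take (a i j) (y j)"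
      using L m by (intro nth_equalityI) (auto simp: y_def)
    moreover have "y i ! (h - 1) < y j ! a i j" using L[OF m] m by (simp add: nth)
    moreover have "y i ! a i j \<noteq> y j ! a i j"
      using sorted_le_last[of "y i" h "a i j"] sorted[of i] ij calculation(2) m by (simp add: y_def)
    ultimately show ?thesis using m lev_eq[of "a i j" "y i" "y j"] by (auto simp: late_def y_def)
  qed
  then show ?thesis using that[of y] sorted in_H by (simp add: y_def)
qed

section \<open>Finite lists as nodes of the tree\<close>

context card_tree begin

lemma underS_start: "underS \<kappa> start = {}"
proof -
  have False if i: "(i, start) \<in> \<kappa>" "i \<noteq> start" for i
  proof -
    have "i \<in> Field \<kappa>" using i(1) by (rule FieldI1)
    then have "(start, i) \<in> \<kappa>" by (rule start(2))
    then show False using antisymD[OF wo.ANTISYM i(1)] i(2) by simp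
  qed
  then show ?thesis by (auto simp: underS_def)
qed

text \<open>Iterated concatenation, so that \<open>ext_le\<close>, \<open>ext_meet\<close> and
  \<open>ext_lex\<close> strip a common head from each comparison.\<close>

fun emb :: "nat list \<Rightarrow> 'k seq" where
  "emb [] = Map.empty"
| "emb (c # xs) = ext (single c) (emb xs)"

lemma emb_tree: "emb xs \<in> tr"
  by (induction xs) (auto simp: empty_tree ext_tree single_tree)

lemma emb_Cons_incomparable: "c \<noteq> d \<Longrightarrow> incomparable (emb (c # xs)) (emb (d # ys))"
  unfolding emb.simps
  by (rule incomparable_extend[OF single_tree single_tree _ _ single_incomparable])
    (simp_all only: ext_tree single_tree emb_tree, (rule le_ext[OF single_tree])+)

lemma emb_le: "emb xs \<subseteq>\<^sub>m emb ys \<longleftrightarrow> prefix xs ys"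
proof (induction xs arbitrary: ys)
  case (Cons c xs)
  show ?case
  proof (cases ys)
    case Nil
    have "start \<in> dom (emb (c # xs))" using le_ext[OF single_tree, of c "emb xs"] by (force simp: map_le_def single_def)
    then show ?thesis using Nil by (force simp: map_le_def)
  next
    case (Cons d zs)
    show ?thesis
    proof (cases "c = d")
      case True
      then show ?thesis using Cons Cons.IH ext_le[OF single_tree emb_tree emb_tree] by simp
    next
      case False
      then show ?thesis using Cons emb_Cons_incomparable[OF False, of xs zs] by (simp add: incomparable_def)
    qed
  qed
qed simp

lemma emb_meet:
  "\<lbrakk>take m xs = take m ys; m < length xs; m < length ys; xs ! m \<noteq> ys ! m\<rbrakk> \<Longrightarrow>
    mt (emb xs) (emb ys) = emb (take m xs)"
proof (induction m arbitrary: xs ys)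
  case 0
  then obtain c xs' d ys' where e: "xs = c # xs'" "ys = d # ys'" "c \<noteq> d" by (cases xs; cases ys) auto
  have "mt (emb xs) (emb ys) = mt (single c) (single d)"
    unfolding e emb.simps
    by (rule meet_extend[OF single_tree single_tree _ _ single_incomparable[OF e(3)]])
      (simp_all only: ext_tree single_tree emb_tree, (rule le_ext[OF single_tree])+)
  also have "dom \<dots> = underS \<kappa> start" using splits_dom_meet[OF single_tree splits_single[OF e(3)]] .
  then have "mt (single c) (single d) = Map.empty" by (simp add: underS_start)
  finally show ?case by simp
next
  case (Suc m)
  then obtain c xs' ys' where e: "xs = c # xs'" "ys = c # ys'" by (cases xs; cases ys) auto
  then have "mt (emb xs') (emb ys') = emb (take m xs')" using Suc by simp
  then show ?case using e ext_meet[OF single_tree emb_tree emb_tree] by simp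
qed

lemma emb_lex:
  "\<lbrakk>take m xs = take m ys; m < length xs; m < length ys; xs ! m < ys ! m\<rbrakk> \<Longrightarrow> lx (emb xs) (emb ys)"
proof (induction m arbitrary: xs ys)
  case 0
  then obtain c xs' d ys' where e: "xs = c # xs'" "ys = d # ys'" "c < d" by (cases xs; cases ys) auto
  then have "c \<noteq> d" by simp
  have "lx (emb xs) (emb ys) \<longleftrightarrow> lx (single c) (single d)"
    unfolding e emb.simps
    by (rule lex_extend[OF single_tree single_tree _ _ single_incomparable[OF \<open>c \<noteq> d\<close>]])
      (simp_all only: ext_tree single_tree emb_tree, (rule le_ext[OF single_tree])+)
  then show ?case using e(3) by (simp add: single_lex)
next
  case (Suc m)
  then obtain c xs' ys' where e: "xs = c # xs'" "ys = c # ys'" by (cases xs; cases ys) auto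
  then have "lx (emb xs') (emb ys')" using Suc by simp
  then show ?case using e ext_lex[OF single_tree emb_tree emb_tree] by simp
qed

lemma emb_antichain: "antichain \<kappa> (emb ` {xs. length xs = h \<and> P xs})"
proof -
  have "incomparable (emb xs) (emb ys)" if "length xs = length ys" "emb xs \<noteq> emb ys" for xs ys
  proof -
    have "xs \<noteq> ys" using that by auto
    then show ?thesis using that(1) unfolding incomparable_def emb_le by (auto simp: prefix_def)
  qed
  then show ?thesis unfolding antichain_def using emb_tree by auto
qed

text \<open>Meets below a common node are comparable, which settles all cases but that of equal
  inner meets. There the values at the common splitting coordinate strictly increase from
  \<open>a\<close> over \<open>b\<close> to \<open>c\<close>, so \<open>a\<close> and
  \<open>c\<close> split at it too.\<close>

lemma meet_between:
  assumes t: "a \<in> tr" "b \<in> tr" "c \<in> tr" and l: "lx a b" "lx b c"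
    and i: "incomparable a b" "incomparable b c"
  shows "mt a b \<subseteq>\<^sub>m mt b c \<Longrightarrow> mt a c = mt a b" and "mt b c \<subseteq>\<^sub>m mt a b \<Longrightarrow> mt a c = mt b c"
proof -
  let ?s = "mt a b" and ?t = "mt b c" and ?u = "mt a c"
  have m: "?s \<in> tr" "?t \<in> tr" "?u \<in> tr" using t meet_tree by auto
  note le = meet_le1 meet_le2[OF t(1)] meet_le2[OF t(2)]
  have eq: "?u = ?s" if st: "?s = ?t"
  proof -
    obtain k where k: "splits a b k" "the (a k) < the (b k)"
      using lex_iff[OF t(1,2)] l(1) i(1) unfolding incomparable_def by blast
    obtain k' where k': "splits b c k'" "the (b k') < the (c k')"
      using lex_iff[OF t(2,3)] l(2) i(2) unfolding incomparable_def by blast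
    have "underS \<kappa> k = underS \<kappa> k'"
      using splits_dom_meet[OF t(1) k(1)] splits_dom_meet[OF t(2) k'(1)] st by simp
    then have kk: "k' = k" using underS_inj[OF splits_Field[OF t(1) k(1)] splits_Field[OF t(2) k'(1)]] by simp
    have "a k \<noteq> c k" using k(2) k'(2) kk by force
    then have "splits a c k" using k(1) k'(1) kk unfolding splits_def by auto
    then have d: "dom ?u = dom ?s" using splits_dom_meet[OF t(1)] k(1) by simp
    have a: "?s \<subseteq>\<^sub>m a" "?u \<subseteq>\<^sub>m a" using le by auto
    show ?thesis
    proof
      fix j show "?u j = ?s j" using d a unfolding map_le_def by (metis domIff)
    qed
  qed
  have c: "x \<subseteq>\<^sub>m z" if "x \<subseteq>\<^sub>m y" "y \<subseteq>\<^sub>m z" for x y z :: "'k seq" using that map_le_trans by blast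
  show "?u = ?s" if st: "?s \<subseteq>\<^sub>m ?t"
  proof -
    have su: "?s \<subseteq>\<^sub>m ?u" using meet_greatest[OF t(1) m(1)] le c[OF st] by blast
    have "?u \<subseteq>\<^sub>m ?t \<or> ?t \<subseteq>\<^sub>m ?u" by (rule below_linear[OF m(3,2), of c]) (use le in blast)+
    then show ?thesis
    proof
      assume "?u \<subseteq>\<^sub>m ?t"
      then have "?u \<subseteq>\<^sub>m b" by (rule c) (rule meet_le1)
      then have "?u \<subseteq>\<^sub>m ?s" using meet_greatest[OF t(1) m(3)] le by blast
      then show ?thesis using su map_le_antisym by blast
    next
      assume "?t \<subseteq>\<^sub>m ?u"
      then have "?t \<subseteq>\<^sub>m a" by (rule c) (rule meet_le1)
      then have "?t \<subseteq>\<^sub>m ?s" using meet_greatest[OF t(1) m(2)] le by blast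
      then show ?thesis using st eq map_le_antisym by blast
    qed
  qed
  show "?u = ?t" if ts: "?t \<subseteq>\<^sub>m ?s"
  proof -
    have tu: "?t \<subseteq>\<^sub>m ?u" using meet_greatest[OF t(1) m(2)] le c[OF ts] by blast
    have "?u \<subseteq>\<^sub>m ?s \<or> ?s \<subseteq>\<^sub>m ?u" by (rule below_linear[OF m(3,1), of a]) (use le in blast)+
    then show ?thesis
    proof
      assume "?u \<subseteq>\<^sub>m ?s"
      then have "?u \<subseteq>\<^sub>m b" by (rule c) (rule meet_le2[OF t(1)])
      then have "?u \<subseteq>\<^sub>m ?t" using meet_greatest[OF t(2) m(3)] le by blast
      then show ?thesis using tu map_le_antisym by blast
    next
      assume "?s \<subseteq>\<^sub>m ?u"
      then have "?s \<subseteq>\<^sub>m c" by (rule c) (rule meet_le2[OF t(1)])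
      then have "?s \<subseteq>\<^sub>m ?t" using meet_greatest[OF t(2) m(1)] le by blast
      then have "?s = ?t" using ts map_le_antisym by blast
      then show ?thesis using eq by simp
    qed
  qed
qed

lemma lex_rank:
  assumes N: "finite N" "N \<subseteq> tr" and m: "m \<in> N" "m' \<in> N"
  defines "rk \<equiv> \<lambda>m. card {n \<in> N. lx n m \<and> n \<noteq> m}"
  shows "rk m < rk m' \<longleftrightarrow> lx m m' \<and> m \<noteq> m'" "rk m < card N"
proof -
  have less: "rk a < rk b" if "a \<in> N" "b \<in> N" "lx a b" "a \<noteq> b" for a b
  proof -
    have t: "a \<in> tr" "b \<in> tr" using that N by auto
    have "{n \<in> N. lx n a \<and> n \<noteq> a} \<subset> {n \<in> N. lx n b \<and> n \<noteq> b}"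
    proof (intro psubsetI subsetI)
      fix n assume "n \<in> {n \<in> N. lx n a \<and> n \<noteq> a}"
      then have n: "n \<in> N" "lx n a" "n \<noteq> a" "n \<in> tr" using N by auto
      have "lx n b" using lex_trans[OF n(4) t n(2) that(3)] .
      moreover have "n \<noteq> b" using lex_antisym[OF t(1,2)] that(3,4) n(2) by auto
      ultimately show "n \<in> {n \<in> N. lx n b \<and> n \<noteq> b}" using n by simp
    next
      have "a \<in> {n \<in> N. lx n b \<and> n \<noteq> b}" "a \<notin> {n \<in> N. lx n a \<and> n \<noteq> a}" using that by auto
      then show "{n \<in> N. lx n a \<and> n \<noteq> a} \<noteq> {n \<in> N. lx n b \<and> n \<noteq> b}" by blast
    qed
    then show ?thesis unfolding rk_def using N(1) by (intro psubset_card_mono) auto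
  qed
  have t: "m \<in> tr" "m' \<in> tr" using m N by auto
  show "rk m < rk m' \<longleftrightarrow> lx m m' \<and> m \<noteq> m'"
  proof
    assume r: "rk m < rk m'"
    then have "m \<noteq> m'" by auto
    moreover have "\<not> (lx m' m \<and> m' \<noteq> m)" using less[OF m(2,1)] r by auto
    ultimately show "lx m m' \<and> m \<noteq> m'" using lex_total[OF t] by auto
  qed (use less m in blast)
  have "{n \<in> N. lx n m \<and> n \<noteq> m} \<subset> N" using m(1) by blast
  then show "rk m < card N" unfolding rk_def using N(1) by (rule psubset_card_mono[rotated])
qed

text \<open>Since \<open>lexle\<close> orders the meets in preorder, ranking them by it makes the relative order of the
  levels occurring in a subtuple depend on the quantifier-free type of the subtuple only.\<close>

lemma level_assignment:
  fixes x :: "nat \<Rightarrow> 'k seq"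
  assumes x: "\<And>i. i < M \<Longrightarrow> x i \<in> tr" and E: "E \<subseteq> {..<h}" "card E = M * M"
  obtains a :: "nat \<Rightarrow> nat \<Rightarrow> nat"
  where "\<And>i. a i i = h" and "\<And>i j. i < M \<Longrightarrow> j < M \<Longrightarrow> a i j = a j i"
    and "\<And>i j. i < M \<Longrightarrow> j < M \<Longrightarrow> i \<noteq> j \<Longrightarrow> a i j \<in> E"
    and "\<And>i j k l. \<lbrakk>i < M; j < M; k < M; l < M; i \<noteq> j; k \<noteq> l\<rbrakk> \<Longrightarrow>
      a i j < a k l \<longleftrightarrow> lx (mt (x i) (x j)) (mt (x k) (x l)) \<and> mt (x i) (x j) \<noteq> mt (x k) (x l)"
proof -
  define N where "N = (\<lambda>(i, j). mt (x i) (x j)) ` {(i, j). i < M \<and> j < M \<and> i \<noteq> j}"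
  have fin: "finite {(i, j). i < M \<and> j < M \<and> i \<noteq> j}"
    by (rule finite_subset[of _ "{..<M} \<times> {..<M}"]) auto
  have N: "finite N" "N \<subseteq> tr" using fin x meet_tree by (auto simp: N_def)
  have "card N \<le> card ({..<M} \<times> {..<M})" unfolding N_def
    by (rule order_trans[OF card_image_le[OF fin]], rule card_mono) auto
  then have cN: "card N \<le> card E" using E by simp
  have fE: "finite E" using E(1) finite_subset by blast
  define rk where "rk m = card {n \<in> N. lx n m \<and> n \<noteq> m}" for m
  define e where "e m = sorted_list_of_set E ! rk m" for m
  \<comment> \<open>The diagonal value \<open>h\<close> is the length of a leaf, so that
    \<open>take (a i i)\<close> will return the whole leaf; the other values lie in
    \<open>E\<close>, hence below \<open>h\<close>.\<close>
  define a where "a i j = (if i = j then h else e (mt (x i) (x j)))" for i j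
  have mN: "mt (x i) (x j) \<in> N" if "i < M" "j < M" "i \<noteq> j" for i j using that by (force simp: N_def)
  have rk: "rk m < rk m' \<longleftrightarrow> lx m m' \<and> m \<noteq> m'" "rk m < card E" if "m \<in> N" "m' \<in> N" for m m'
    using lex_rank[OF N that] cN unfolding rk_def by auto
  have e: "e m < e m' \<longleftrightarrow> lx m m' \<and> m \<noteq> m'" if m: "m \<in> N" "m' \<in> N" for m m'
  proof -
    have "e m < e m' \<longleftrightarrow> rk m < rk m'"
      using sorted_list_nth_less[OF fE, of "rk m" "rk m'"] sorted_list_nth_less[OF fE, of "rk m'" "rk m"]
        rk(2)[OF m] rk(2)[OF m(2,1)] unfolding e_def by (metis less_asym less_irrefl nat_neq_iff)
    then show ?thesis using rk(1)[OF m] by simp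
  qed
  show ?thesis
  proof (rule that[of a])
    show "a i i = h" for i by (simp add: a_def)
    show "a i j = a j i" if "i < M" "j < M" for i j
      using meet_commute[OF x[OF that(1)] x[OF that(2)]] by (simp add: a_def)
    show "a i j \<in> E" if "i < M" "j < M" "i \<noteq> j" for i j
      using sorted_list_nth_in[OF fE rk(2)[OF mN[OF that] mN[OF that]]] that(3) by (simp add: a_def e_def)
    show "a i j < a k l \<longleftrightarrow> lx (mt (x i) (x j)) (mt (x k) (x l)) \<and> mt (x i) (x j) \<noteq> mt (x k) (x l)"
      if "i < M" "j < M" "k < M" "l < M" "i \<noteq> j" "k \<noteq> l" for i j k l
      using e[OF mN[OF that(1,2,5)] mN[OF that(3,4,6)]] that(5,6) by (simp add: a_def)
  qed
qed

text \<open>Both sides obey one rule: the meet of \<open>i\<close>, \<open>j\<close> is below the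
  meet of \<open>k\<close>, \<open>l\<close> iff \<open>a i j \<le> a k l\<close> and
  \<open>a i j \<le> a i k\<close>. For lists this compares lengths and the common prefix of
  \<open>y i\<close> and \<open>y k\<close>. In the tree, meets below a common node are linearly
  ordered, and on them the rank \<open>a\<close> agrees with inclusion.\<close>

lemma leaf_dsim:
  fixes x :: "nat \<Rightarrow> 'k seq"
  assumes x: "\<And>i. i < M \<Longrightarrow> x i \<in> tr"
    and sorted: "\<And>i j. i < j \<Longrightarrow> j < M \<Longrightarrow> lx (x i) (x j) \<and> incomparable (x i) (x j)"
    and E: "E \<subseteq> {..<h}"
    and a1: "\<And>i. a i i = h" and a2: "\<And>i j. i < M \<Longrightarrow> j < M \<Longrightarrow> a i j = a j i"
    and a3: "\<And>i j. i < M \<Longrightarrow> j < M \<Longrightarrow> i \<noteq> j \<Longrightarrow> a i j \<in> E"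
    and a4: "\<And>i j k l. \<lbrakk>i < M; j < M; k < M; l < M; i \<noteq> j; k \<noteq> l\<rbrakk> \<Longrightarrow>
      a i j < a k l \<longleftrightarrow> lx (mt (x i) (x j)) (mt (x k) (x l)) \<and> mt (x i) (x j) \<noteq> mt (x k) (x l)"
    and y1: "\<And>i. i < M \<Longrightarrow> length (y i) = h \<and> sorted_wrt (<) (y i)"
    and y2: "\<And>i j. i < j \<Longrightarrow> j < M \<Longrightarrow> late h (y i) (y j) \<and> lev (y i) (y j) = a i j"
  shows "dsim {..<M} x (\<lambda>i. emb (y i))"
proof -
  have inc: "incomparable (x i) (x j)" if "i < M" "j < M" "i \<noteq> j" for i j
    using that sorted[of i j] sorted[of j i] incomparable_sym by (metis nat_neq_iff)
  have ah: "a i j < h" if "i < M" "j < M" "i \<noteq> j" for i j using a3[OF that] E by auto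
  have ale: "a i j \<le> h" if "i < M" "j < M" for i j using ah[OF that] a1 by (cases "i = j") auto
  have split: "take (a i j) (y i) = take (a i j) (y j)" "y i ! a i j < y j ! a i j" if "i < j" "j < M" for i j
  proof -
    have "i < M" using that by simp
    note l = late_lev[of h "y i" "y j"] y1[OF this] y1[OF that(2)] y2[OF that]
    then show "take (a i j) (y i) = take (a i j) (y j)" by metis
    have "y i ! a i j \<le> y i ! (h - 1)" using sorted_le_last[of "y i" h] l ah[OF \<open>i < M\<close> that(2)] that by simp
    then show "y i ! a i j < y j ! a i j" using l by (metis le_less_trans)
  qed
  have tk: "take (a i j) (y i) = take (a i j) (y j)" if "i < M" "j < M" for i j
    using split(1)[of i j] split(1)[of j i] a2[OF that] that by (metis nat_neq_iff)
  have ne: "y i ! a i j \<noteq> y j ! a i j" if "i < M" "j < M" "i \<noteq> j" for i j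
    using split(2)[of i j] split(2)[of j i] a2[OF that(1,2)] that by (metis nat_neq_iff)
  have me: "mt (emb (y i)) (emb (y j)) = emb (take (a i j) (y i))" if "i < M" "j < M" for i j
  proof (cases "i = j")
    case True
    then show ?thesis using a1 y1[OF that(1)] emb_tree by simp
  next
    case False
    then show ?thesis using emb_meet[OF tk[OF that]] ne[OF that] y1[OF that(1)] y1[OF that(2)] ah[OF that] by simp
  qed
  have take_eq: "take m (y i) = take m (y k) \<longleftrightarrow> m \<le> a i k" if "i < M" "k < M" "m \<le> h" for i k m
  proof
    assume e: "take m (y i) = take m (y k)"
    show "m \<le> a i k"
    proof (cases "i = k")
      case True
      then show ?thesis using a1 that by simp
    next
      case False
      show ?thesis
      proof (rule ccontr)
        assume "\<not> m \<le> a i k"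
        then have "a i k < m" by simp
        then have "y i ! a i k = y k ! a i k"
          using nth_take[of "a i k" m "y i"] nth_take[of "a i k" m "y k"] e by simp
        then show False using ne[OF that(1,2) False] by simp
      qed
    qed
  next
    assume "m \<le> a i k"
    then have "take m (take (a i k) (y i)) = take m (y i)" "take m (take (a i k) (y k)) = take m (y k)"
      by (simp_all add: min_absorb1)
    then show "take m (y i) = take m (y k)" using tk[OF that(1,2)] by simp
  qed
  have L: "emb (take (a i j) (y i)) \<subseteq>\<^sub>m emb (take (a k l) (y k)) \<longleftrightarrow> a i j \<le> a k l \<and> a i j \<le> a i k"
    if M: "i < M" "j < M" "k < M" "l < M" for i j k l
  proof -
    have "prefix (take (a i j) (y i)) (take (a k l) (y k)) \<longleftrightarrow>
        a i j \<le> a k l \<and> take (a i j) (y i) = take (a i j) (y k)"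
    proof
      assume p: "prefix (take (a i j) (y i)) (take (a k l) (y k))"
      have len: "length (take (a i j) (y i)) = a i j" "length (take (a k l) (y k)) = a k l"
        using y1 M ale[OF M(1,2)] ale[OF M(3,4)] by auto
      have le: "a i j \<le> a k l" using prefix_length_le[OF p] len by simp
      have "take (a i j) (y i) = take (a i j) (take (a k l) (y k))"
        using p len(1) unfolding prefix_def by (metis append_eq_conv_conj)
      then show "a i j \<le> a k l \<and> take (a i j) (y i) = take (a i j) (y k)" using le by (simp add: min_absorb1)
    next
      assume r: "a i j \<le> a k l \<and> take (a i j) (y i) = take (a i j) (y k)"
      then have "take (a i j) (y i) = take (a i j) (take (a k l) (y k))" by (simp add: min_absorb1)
      then show "prefix (take (a i j) (y i)) (take (a k l) (y k))" by (metis take_is_prefix)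
    qed
    then show ?thesis unfolding emb_le using take_eq[OF M(1,3) ale[OF M(1,2)]] by simp
  qed
  have mtr: "mt (x i) (x j) \<in> tr" if "i < M" for i j using meet_tree x[OF that] by blast
  have le2: "mt (x i) (x j) \<subseteq>\<^sub>m x j" if "i < M" for i j using meet_le2 x[OF that] by blast
  have mono: "a i j \<le> a k l" if "mt (x i) (x j) \<subseteq>\<^sub>m mt (x k) (x l)" "i < M" "j < M" "k < M" "l < M" "i \<noteq> j" "k \<noteq> l" for i j k l
  proof (rule ccontr)
    assume "\<not> a i j \<le> a k l"
    then have "lx (mt (x k) (x l)) (mt (x i) (x j)) \<and> mt (x k) (x l) \<noteq> mt (x i) (x j)"
      using a4[of k l i j] that by simp
    then show False using lex_antisym[OF mtr[OF that(2)] mtr[OF that(4)] lex_le[OF that(1)]] by auto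
  qed
  have refl: "mt (x i) (x j) \<subseteq>\<^sub>m mt (x k) (x l)"
    if "mt (x i) (x j) \<subseteq>\<^sub>m z" "mt (x k) (x l) \<subseteq>\<^sub>m z" "a i j \<le> a k l"
      "i < M" "j < M" "k < M" "l < M" "i \<noteq> j" "k \<noteq> l" for i j k l z
  proof -
    have "\<not> (lx (mt (x k) (x l)) (mt (x i) (x j)) \<and> mt (x k) (x l) \<noteq> mt (x i) (x j))"
      using a4[of k l i j] that by simp
    then show ?thesis
      using below_linear[OF mtr[OF that(4)] mtr[OF that(6)] that(1,2)] lex_le[of "mt (x k) (x l)" "mt (x i) (x j)"] by auto
  qed
  have R: "mt (x i) (x j) \<subseteq>\<^sub>m mt (x k) (x l) \<longleftrightarrow> a i j \<le> a k l \<and> a i j \<le> a i k"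
    if M: "i < M" "j < M" "k < M" "l < M" for i j k l
  proof (cases "i = j")
    case True
    have "mt (x i) (x j) = x i" using True x M by simp
    moreover have "x i \<subseteq>\<^sub>m mt (x k) (x l) \<longleftrightarrow> i = k \<and> i = l"
    proof
      assume s: "x i \<subseteq>\<^sub>m mt (x k) (x l)"
      then have "x i \<subseteq>\<^sub>m x k" "x i \<subseteq>\<^sub>m x l" using meet_le1 le2[OF M(3)] map_le_trans by blast+
      then show "i = k \<and> i = l" using inc M unfolding incomparable_def by blast
    next
      assume "i = k \<and> i = l"
      then show "x i \<subseteq>\<^sub>m mt (x k) (x l)" using x M by auto
    qed
    moreover have "h \<le> a k l \<longleftrightarrow> k = l" "h \<le> a i k \<longleftrightarrow> i = k" using ah[OF M(3,4)] ah[OF M(1,3)] a1 by force+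
    ultimately show ?thesis using True a1 by auto
  next
    case ij: False
    show ?thesis
    proof
      assume s: "mt (x i) (x j) \<subseteq>\<^sub>m mt (x k) (x l)"
      have "mt (x i) (x j) \<subseteq>\<^sub>m x k" using s meet_le1 map_le_trans by blast
      then have "mt (x i) (x j) \<subseteq>\<^sub>m mt (x i) (x k)" using meet_greatest[OF x[OF M(1)] mtr[OF M(1)] meet_le1] by blast
      then have "a i j \<le> a i k" using mono[of i j i k] M ij ale[OF M(1,2)] a1 by (cases "i = k") auto
      moreover have "a i j \<le> a k l" using mono[OF s M] ij ale[OF M(1,2)] a1 by (cases "k = l") auto
      ultimately show "a i j \<le> a k l \<and> a i j \<le> a i k" by simp
    next
      assume r: "a i j \<le> a k l \<and> a i j \<le> a i k"
      \<comment> \<open>The inequality with \<open>a i k\<close> puts the meet of \<open>i\<close>,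
        \<open>j\<close> below \<open>x k\<close>; then both meets lie below \<open>x k\<close>,
        where the ranks compare them.\<close>
      have k: "mt (x i) (x j) \<subseteq>\<^sub>m x k"
      proof (cases "i = k")
        case True
        then show ?thesis using meet_le1 by blast
      next
        case False
        have "mt (x i) (x j) \<subseteq>\<^sub>m mt (x i) (x k)"
          using refl[OF meet_le1 meet_le1 _ M(1,2,1,3) ij False] r by blast
        then show ?thesis using le2[OF M(1)] map_le_trans by blast
      qed
      show "mt (x i) (x j) \<subseteq>\<^sub>m mt (x k) (x l)"
      proof (cases "k = l")
        case True
        then show ?thesis using k x M by simp
      next
        case False
        then show ?thesis using refl[OF k meet_le1 _ M ij] r by blast
      qed
    qed
  qed
  have lx1: "lx (x i) (x j) \<longleftrightarrow> i \<le> j" if "i < M" "j < M" for i j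
  proof (cases i j rule: linorder_cases)
    case less
    then show ?thesis using sorted that by simp
  next
    case greater
    then show ?thesis using sorted[of j i] lex_antisym[OF x[OF that(1)] x[OF that(2)]] that
      by (auto simp: incomparable_def)
  qed simp
  have lx2: "lx (emb (y i)) (emb (y j)) \<longleftrightarrow> i \<le> j" if "i < M" "j < M" for i j
  proof -
    have *: "lx (emb (y i)) (emb (y j)) \<and> emb (y i) \<noteq> emb (y j)" if ij: "i < j" "j < M" for i j
    proof -
      have i: "i < M" "i \<noteq> j" using ij by auto
      have "lx (emb (y i)) (emb (y j))"
        using emb_lex[OF split(1)[OF ij] _ _ split(2)[OF ij]] y1[OF i(1)] y1[OF ij(2)] ah[OF i(1) ij(2) i(2)] by simp
      moreover have "y i \<noteq> y j" using split(2)[OF ij] by auto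
      then have "\<not> prefix (y i) (y j)" using y1[OF i(1)] y1[OF ij(2)] by (auto simp: prefix_def)
      then have "emb (y i) \<noteq> emb (y j)" using emb_le[of "y i" "y j"] by auto
      ultimately show ?thesis by simp
    qed
    show ?thesis
    proof (cases i j rule: linorder_cases)
      case less
      then show ?thesis using *[of i j] that by simp
    next
      case greater
      then show ?thesis using *[of j i] lex_antisym[OF emb_tree emb_tree] that by auto
    qed simp
  qed
  show ?thesis unfolding dsim_def
  proof (intro conjI ballI)
    fix i j k l assume "i \<in> {..<M}" "j \<in> {..<M}" "k \<in> {..<M}" "l \<in> {..<M}"
    then show "mt (x i) (x j) \<subseteq>\<^sub>m mt (x k) (x l) \<longleftrightarrow> mt (emb (y i)) (emb (y j)) \<subseteq>\<^sub>m mt (emb (y k)) (emb (y l))"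
      using R L me by simp
  next
    fix i j assume "i \<in> {..<M}" "j \<in> {..<M}"
    then show "lx (x i) (x j) \<longleftrightarrow> lx (emb (y i)) (emb (y j))" using lx1 lx2 by simp
  qed
qed

text \<open>This is \<open>meet_between\<close> in numbers: the outer meet is the lower of the two
  inner ones, and the rank is monotone along inclusions.\<close>

lemma ultrametric_level:
  fixes x :: "nat \<Rightarrow> 'k seq"
  assumes x: "\<And>i. i < M \<Longrightarrow> x i \<in> tr"
    and sorted: "\<And>i j. i < j \<Longrightarrow> j < M \<Longrightarrow> lx (x i) (x j) \<and> incomparable (x i) (x j)"
    and a4: "\<And>i j k l. \<lbrakk>i < M; j < M; k < M; l < M; i \<noteq> j; k \<noteq> l\<rbrakk> \<Longrightarrow>
      a i j < a k l \<longleftrightarrow> lx (mt (x i) (x j)) (mt (x k) (x l)) \<and> mt (x i) (x j) \<noteq> mt (x k) (x l)"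
    and ijk: "i < j" "j < k" "k < M"
  shows "a i k = min (a i j) (a j k :: nat)"
proof -
  have M: "i < M" "j < M" "i \<noteq> j" "j \<noteq> k" "i \<noteq> k" using ijk by simp_all
  let ?s = "mt (x i) (x j)" and ?t = "mt (x j) (x k)" and ?u = "mt (x i) (x k)"
  have tr: "?s \<in> tr" "?t \<in> tr" "?u \<in> tr" using x M meet_tree by auto
  have sx: "lx (x i) (x j)" "lx (x j) (x k)" "incomparable (x i) (x j)" "incomparable (x j) (x k)"
    using sorted ijk M by auto
  note b = meet_between[OF x[OF M(1)] x[OF M(2)] x[OF ijk(3)] sx]
  have eq: "a i j = a k l" if "mt (x i) (x j) = mt (x k) (x l)" "i < M" "j < M" "k < M" "l < M" "i \<noteq> j" "k \<noteq> l" for i j k l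
    using a4[of i j k l] a4[of k l i j] that by simp
  have le: "a i j \<le> a k l" if "mt (x i) (x j) \<subseteq>\<^sub>m mt (x k) (x l)" "i < M" "j < M" "k < M" "l < M" "i \<noteq> j" "k \<noteq> l" for i j k l
  proof -
    have "mt (x i) (x j) \<in> tr" "mt (x k) (x l) \<in> tr" using x that meet_tree by auto
    then show ?thesis
      using a4[of k l i j] lex_antisym lex_le[OF that(1)] that by (metis not_le)
  qed
  have "?s \<subseteq>\<^sub>m ?t \<or> ?t \<subseteq>\<^sub>m ?s"
    by (rule below_linear[OF tr(1,2), of "x j"]) (use meet_le1 meet_le2[OF x[OF M(1)]] in blast)+
  then show ?thesis
  proof
    assume s: "?s \<subseteq>\<^sub>m ?t"
    then show ?thesis using eq[OF b(1)[OF s]] le[OF s] M ijk by simp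
  next
    assume s: "?t \<subseteq>\<^sub>m ?s"
    then show ?thesis using eq[OF b(2)[OF s]] le[OF s] M ijk by simp
  qed
qed

text \<open>The levels of neighbours in a subtuple are ranks of meets, and the comparison of these
  meets is part of the quantifier-free type; so equal types give equal patterns, and
  \<open>dfs_ramsey\<close> applies. \<open>Z\<close> consists of all candidate leaves and is
  therefore fixed before the colouring \<open>Q\<close>.\<close>

lemma tree_ramsey_sorted:
  fixes x :: "nat \<Rightarrow> 'k seq"
  assumes fin: "finite J" and x0: "\<forall>i<M. x i \<in> tr"
    and sorted0: "\<forall>i j. i < j \<and> j < M \<longrightarrow> lx (x i) (x j) \<and> incomparable (x i) (x j)"
  shows "\<exists>Z. finite Z \<and> antichain \<kappa> Z \<and> (\<forall>Q :: 'q \<Rightarrow> 'k seq list \<Rightarrow> bool. \<exists>f. f ` {..<M} \<subseteq> Z \<and> dsim {..<M} x f \<and>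
    (\<forall>q\<in>J. \<forall>js js'. js \<noteq> [] \<and> sorted_wrt (<) js \<and> sorted_wrt (<) js' \<and> set js \<subseteq> {..<M} \<and> set js' \<subseteq> {..<M} \<and>
      length js = length js' \<and> dsim {..<length js} (\<lambda>s. x (js ! s)) (\<lambda>s. x (js' ! s)) \<longrightarrow>
      Q q (map f js) = Q q (map f js')))"
proof -
  have x: "\<And>i. i < M \<Longrightarrow> x i \<in> tr"
    and sorted: "\<And>i j. i < j \<Longrightarrow> j < M \<Longrightarrow> lx (x i) (x j) \<and> incomparable (x i) (x j)"
    using x0 sorted0 by blast+
  from dfs_ramsey[OF fin, of "M * M" M] obtain h N where
    R: "\<forall>Q :: 'q \<Rightarrow> nat list list \<Rightarrow> bool. \<exists>E\<subseteq>{..<h}. \<exists>H\<subseteq>{..<N}. card E = M * M \<and> card H = h * M \<and>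
    (\<forall>q\<in>J. \<forall>x ys x' ys'. dfs h (x # ys) \<and> dfs h (x' # ys') \<and> length ys < M \<and>
      pattern (levs x ys) = pattern (levs x' ys') \<and> card (set (levs x ys)) = card (set (levs x' ys')) \<and>
      set (levs x ys) \<subseteq> E \<and> set (levs x' ys') \<subseteq> E \<and>
      set x \<union> \<Union> (set ` set ys) \<subseteq> H \<and> set x' \<union> \<Union> (set ` set ys') \<subseteq> H \<longrightarrow> Q q (x # ys) = Q q (x' # ys'))"
    by (elim exE)
  define Z where "Z = emb ` {xs. length xs = h \<and> set xs \<subseteq> {..<N}}"
  have "finite Z" using finite_lists_length_eq[of "{..<N}" h] by (simp add: Z_def conj_commute)
  moreover have "antichain \<kappa> Z" unfolding Z_def by (rule emb_antichain)
  moreover have "\<exists>f. f ` {..<M} \<subseteq> Z \<and> dsim {..<M} x f \<and>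
    (\<forall>q\<in>J. \<forall>js js'. js \<noteq> [] \<and> sorted_wrt (<) js \<and> sorted_wrt (<) js' \<and> set js \<subseteq> {..<M} \<and> set js' \<subseteq> {..<M} \<and>
      length js = length js' \<and> dsim {..<length js} (\<lambda>s. x (js ! s)) (\<lambda>s. x (js' ! s)) \<longrightarrow>
      Q q (map f js) = Q q (map f js'))" for Q :: "'q \<Rightarrow> 'k seq list \<Rightarrow> bool"
  proof -
    from spec[OF R, of "\<lambda>q ys. Q q (map emb ys)"] obtain E H where E: "E \<subseteq> {..<h}" and H: "H \<subseteq> {..<N}"
      and c: "card E = M * M" "card H = h * M"
      and hom: "\<forall>q\<in>J. \<forall>x ys x' ys'. dfs h (x # ys) \<and> dfs h (x' # ys') \<and> length ys < M \<and>
      pattern (levs x ys) = pattern (levs x' ys') \<and> card (set (levs x ys)) = card (set (levs x' ys')) \<and>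
      set (levs x ys) \<subseteq> E \<and> set (levs x' ys') \<subseteq> E \<and>
      set x \<union> \<Union> (set ` set ys) \<subseteq> H \<and> set x' \<union> \<Union> (set ` set ys') \<subseteq> H \<longrightarrow>
      Q q (map emb (x # ys)) = Q q (map emb (x' # ys'))" by (elim exE conjE)
    obtain a where a: "\<And>i. a i i = h" "\<And>i j. i < M \<Longrightarrow> j < M \<Longrightarrow> a i j = a j i"
      "\<And>i j. i < M \<Longrightarrow> j < M \<Longrightarrow> i \<noteq> j \<Longrightarrow> a i j \<in> E"
      "\<And>i j k l. \<lbrakk>i < M; j < M; k < M; l < M; i \<noteq> j; k \<noteq> l\<rbrakk> \<Longrightarrow>
        a i j < a k l \<longleftrightarrow> lx (mt (x i) (x j)) (mt (x k) (x l)) \<and> mt (x i) (x j) \<noteq> mt (x k) (x l)"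
      by (rule level_assignment[where x = x and M = M and E = E and h = h]) (use x E c(1) in blast)+
    have fH: "finite H" using H finite_subset by blast
    have ah: "a i j < h" if "i < j" "j < M" for i j using a(3)[of i j] E that by auto
    obtain y where y1: "\<And>i. i < M \<Longrightarrow> length (y i) = h \<and> sorted_wrt (<) (y i) \<and> set (y i) \<subseteq> H"
      and y2: "\<And>i j. i < j \<Longrightarrow> j < M \<Longrightarrow> late h (y i) (y j) \<and> lev (y i) (y j) = a i j"
    proof (rule dfs_build[OF fH c(2), of a])
      show "a i k = min (a i j) (a j k)" if "i < j" "j < k" "k < M" for i j k
        by (rule ultrametric_level[where x = x and M = M and a = a]) (use x sorted a(4) that in blast)+
    qed (use ah in blast)+
    have yl: "\<And>i. i < M \<Longrightarrow> length (y i) = h \<and> sorted_wrt (<) (y i)" using y1 by blast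
    show ?thesis
    proof (intro exI[of _ "\<lambda>i. emb (y i)"] conjI ballI allI impI)
      show "(\<lambda>i. emb (y i)) ` {..<M} \<subseteq> Z" using y1 H by (fastforce simp: Z_def)
      show "dsim {..<M} x (\<lambda>i. emb (y i))" by (rule leaf_dsim[OF x sorted E a yl y2])
    next
      fix q js js'
      assume q: "q \<in> J" and A: "js \<noteq> [] \<and> sorted_wrt (<) js \<and> sorted_wrt (<) js' \<and> set js \<subseteq> {..<M} \<and> set js' \<subseteq> {..<M} \<and>
        length js = length js' \<and> dsim {..<length js} (\<lambda>s. x (js ! s)) (\<lambda>s. x (js' ! s))"
      have dfs: "dfs h (map y js)" if "sorted_wrt (<) js" "set js \<subseteq> {..<M}" for js
      proof -
        have "sorted_wrt (\<lambda>i j. late h (y i) (y j)) js"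
          using that(1) by (rule sorted_wrt_mono_rel[rotated]) (use that(2) y2 in blast)
        then show ?thesis unfolding dfs_def sorted_wrt_map using y1 that(2) by auto
      qed
      obtain j ks j' ks' where e: "js = j # ks" "js' = j' # ks'" using A by (cases js; cases js') auto
      let ?r = "levs (y j) (map y ks)" and ?r' = "levs (y j') (map y ks')"
      have L: "levs (y j) (map y ks) ! s = a ((j # ks) ! s) ((j # ks) ! Suc s) \<and>
          (j # ks) ! s < M \<and> (j # ks) ! Suc s < M \<and> (j # ks) ! s < (j # ks) ! Suc s"
        if "sorted_wrt (<) (j # ks)" "set (j # ks) \<subseteq> {..<M}" "s < length ks" for j ks s
      proof -
        have m: "(j # ks) ! s \<in> set (j # ks)" "(j # ks) ! Suc s \<in> set (j # ks)"
          using that(3) by (simp_all only: nth_mem length_Cons Suc_less_eq less_SucI)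
        have lt: "(j # ks) ! s < (j # ks) ! Suc s"
          using sorted_wrt_nth_less[OF that(1), of s "Suc s"] that(3) by simp
        have "levs (y j) (map y ks) ! s = lev ((y j # map y ks) ! s) (map y ks ! s)"
          using levs_nth[of s "map y ks" "y j"] that(3) by simp
        also have "(y j # map y ks) ! s = y ((j # ks) ! s)"
          using that(3) nth_map[of s "j # ks" y] by simp
        also have "map y ks ! s = y ((j # ks) ! Suc s)" using that(3) by simp
        finally show ?thesis using y2[OF lt] lt m that(2) by auto
      qed
      have l: "length ks = length ks'" using A e by simp
      have s1: "sorted_wrt (<) (j # ks)" "set (j # ks) \<subseteq> {..<M}" and s2: "sorted_wrt (<) (j' # ks')" "set (j' # ks') \<subseteq> {..<M}"
        and ds: "dsim {..<length (j # ks)} (\<lambda>s. x ((j # ks) ! s)) (\<lambda>s. x ((j' # ks') ! s))"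
        using A unfolding e by blast+
      have t1: "(\<lambda>s. x ((j # ks) ! s)) ` {..<length (j # ks)} \<subseteq> tr"
      proof (rule image_subsetI)
        fix s assume "s \<in> {..<length (j # ks)}"
        then have "(j # ks) ! s \<in> set (j # ks)" by (intro nth_mem) simp
        then show "x ((j # ks) ! s) \<in> tr" using s1(2) x by blast
      qed
      have t2: "(\<lambda>s. x ((j' # ks') ! s)) ` {..<length (j # ks)} \<subseteq> tr"
      proof (rule image_subsetI)
        fix s assume "s \<in> {..<length (j # ks)}"
        then have "(j' # ks') ! s \<in> set (j' # ks')" using l by (intro nth_mem) simp
        then show "x ((j' # ks') ! s) \<in> tr" using s2(2) x by blast
      qed
      have eqv: "mt (x ((j # ks) ! s)) (x ((j # ks) ! Suc s)) = mt (x ((j # ks) ! t)) (x ((j # ks) ! Suc t)) \<longleftrightarrow>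
          mt (x ((j' # ks') ! s)) (x ((j' # ks') ! Suc s)) = mt (x ((j' # ks') ! t)) (x ((j' # ks') ! Suc t))"
        if "s < length ks" "t < length ks" for s t
        using dsimD(1)[OF ds, of s "Suc s" t "Suc t"] dsimD(1)[OF ds, of t "Suc t" s "Suc s"] that
          map_le_antisym map_le_refl by (metis Suc_less_eq length_Cons lessThan_iff less_SucI)
      have ord: "?r ! s < ?r ! t \<longleftrightarrow> ?r' ! s < ?r' ! t" if st: "s < length ks" "t < length ks" for s t
      proof -
        have st': "s < length ks'" "t < length ks'" using st l by auto
        note L1 = L[OF s1 st(1)] L[OF s1 st(2)] and L2 = L[OF s2 st'(1)] L[OF s2 st'(2)]
        have "?r ! s < ?r ! t \<longleftrightarrow> lx (mt (x ((j # ks) ! s)) (x ((j # ks) ! Suc s))) (mt (x ((j # ks) ! t)) (x ((j # ks) ! Suc t)))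
          \<and> mt (x ((j # ks) ! s)) (x ((j # ks) ! Suc s)) \<noteq> mt (x ((j # ks) ! t)) (x ((j # ks) ! Suc t))"
          using L1 a(4) by (metis less_irrefl)
        moreover have "?r' ! s < ?r' ! t \<longleftrightarrow> lx (mt (x ((j' # ks') ! s)) (x ((j' # ks') ! Suc s))) (mt (x ((j' # ks') ! t)) (x ((j' # ks') ! Suc t)))
          \<and> mt (x ((j' # ks') ! s)) (x ((j' # ks') ! Suc s)) \<noteq> mt (x ((j' # ks') ! t)) (x ((j' # ks') ! Suc t))"
          using L2 a(4) by (metis less_irrefl)
        moreover have "lx (mt (x ((j # ks) ! s)) (x ((j # ks) ! Suc s))) (mt (x ((j # ks) ! t)) (x ((j # ks) ! Suc t))) \<longleftrightarrow>
          lx (mt (x ((j' # ks') ! s)) (x ((j' # ks') ! Suc s))) (mt (x ((j' # ks') ! t)) (x ((j' # ks') ! Suc t)))"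
          by (rule dsim_lex_meet[OF ds t1 t2]) (use st in auto)
        ultimately show ?thesis using eqv[OF st] by blast
      qed
      have lr: "length ?r = length ?r'" using l by simp
      have ord': "?r ! s < ?r ! t \<longleftrightarrow> ?r' ! s < ?r' ! t" if "s < length ?r" "t < length ?r" for s t
        using ord that by simp
      have inE: "set (levs (y j) (map y ks)) \<subseteq> E" if "sorted_wrt (<) (j # ks)" "set (j # ks) \<subseteq> {..<M}" for j ks
      proof
        fix m assume "m \<in> set (levs (y j) (map y ks))"
        then obtain s where s: "s < length ks" "m = levs (y j) (map y ks) ! s" by (auto simp: in_set_conv_nth)
        show "m \<in> E" using L[OF that s(1)] s(2) a(3) by (metis less_irrefl)
      qed
      have inH: "set (y j) \<union> \<Union> (set ` set (map y ks)) \<subseteq> H" if "set (j # ks) \<subseteq> {..<M}" for j ks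
        using y1 that by fastforce
      have "distinct (j # ks)" using s1(1) strict_sorted_iff by blast
      then have "length (j # ks) \<le> M" using card_mono[OF _ s1(2)] distinct_card[of "j # ks"] by simp
      then have len: "length (map y ks) < M" by simp
      have D1: "dfs h (y j # map y ks)" using dfs[OF s1] by simp
      have D2: "dfs h (y j' # map y ks')" using dfs[OF s2] by simp
      have "Q q (map emb (y j # map y ks)) = Q q (map emb (y j' # map y ks'))"
        by (rule hom[rule_format, OF q], intro conjI)
          (rule D1 D2 len pattern_eq[OF lr ord'] inE[OF s1] inE[OF s2] inH[OF s1(2)] inH[OF s2(2)] | assumption)+
      then show "Q q (map (\<lambda>i. emb (y i)) js) = Q q (map (\<lambda>i. emb (y i)) js')" unfolding e by (simp add: comp_def)
    qed
  qed
  ultimately show ?thesis by blast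
qed

lemma lex_enumerate:
  "finite B \<Longrightarrow> B \<subseteq> tr \<Longrightarrow> \<exists>xs. set xs = B \<and> sorted_wrt (\<lambda>a b. lx a b \<and> a \<noteq> b) xs"
proof (induction "card B" arbitrary: B)
  case 0
  then show ?case by (intro exI[of _ "[]"]) simp
next
  case (Suc n)
  have max: "\<exists>m\<in>A. \<forall>a\<in>A. lx a m" if "finite A" "A \<noteq> {}" "A \<subseteq> tr" for A
    using that
  proof (induction A rule: finite_ne_induct)
    case (insert b F)
    then obtain m where m: "m \<in> F" "\<forall>a\<in>F. lx a m" by auto
    have t: "m \<in> tr" "b \<in> tr" using insert m by auto
    show ?case
    proof (cases "lx b m")
      case True
      then show ?thesis using m by auto
    next
      case False
      then have mb: "lx m b" using lex_total[OF t] by simp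
      have "lx a b" if a: "a \<in> F" for a
      proof -
        have "a \<in> tr" "lx a m" using a m(2) insert.prems by auto
        then show ?thesis using lex_trans[OF _ t _ mb] by blast
      qed
      then show ?thesis by auto
    qed
  qed simp
  have "B \<noteq> {}" using Suc.hyps(2) by auto
  then obtain m where m: "m \<in> B" "\<forall>a\<in>B. lx a m" using max[OF Suc.prems(1) _ Suc.prems(2)] by blast
  have "card (B - {m}) = n" using Suc.hyps(2) m(1) Suc.prems(1) by simp
  then obtain xs where xs: "set xs = B - {m}" "sorted_wrt (\<lambda>a b. lx a b \<and> a \<noteq> b) xs"
    using Suc.hyps(1)[of "B - {m}"] Suc.prems by auto
  show ?case
  proof (intro exI[of _ "xs @ [m]"] conjI)
    show "set (xs @ [m]) = B" using xs(1) m(1) by auto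
    show "sorted_wrt (\<lambda>a b. lx a b \<and> a \<noteq> b) (xs @ [m])" using xs m(2) by (auto simp: sorted_wrt_append)
  qed
qed

lemma pattern_position:
  assumes "k < card (set us)"
  obtains s where "s < length us" "pattern us ! s = k"
proof -
  let ?L = "sorted_list_of_set (set us)"
  have "?L ! k \<in> set us" using sorted_list_nth_in[of "set us" k] assms by simp
  then obtain s where s: "s < length us" "us ! s = ?L ! k" by (auto simp: in_set_conv_nth)
  have p: "pattern us ! s < card (set us)" "?L ! (pattern us ! s) = ?L ! k" using pattern_nth[OF s(1)] s(2) by auto
  have "distinct ?L" "length ?L = card (set us)" by simp_all
  then have "pattern us ! s = k" using p assms nth_eq_iff_index_eq by metis
  then show ?thesis using that s(1) by blast
qed

text \<open>An arbitrary tuple is the sorted list of its indices together with a pattern that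
  restores order and repetitions. The pattern is added to the colour; it is the same for tuples of
  the same type because the indices follow \<open>lexle\<close>. That \<open>Z\<close> precedes
  \<open>Q\<close> is essential, as the later colouring comes from a tuple found with the help of
  \<open>Z\<close>.\<close>

lemma antichain_ramsey:
  fixes \<beta> :: "'i \<Rightarrow> 'k seq"
  assumes fin: "finite J" "finite W" and inj: "inj_on \<beta> W" and anti: "antichain \<kappa> (\<beta> ` W)"
  shows "\<exists>Z. finite Z \<and> antichain \<kappa> Z \<and> (\<forall>Q :: 'q \<Rightarrow> 'k seq list \<Rightarrow> bool. \<exists>f. f ` W \<subseteq> Z \<and> dsim W \<beta> f \<and>
    (\<forall>q\<in>J. \<forall>us us'. set us \<subseteq> W \<and> set us' \<subseteq> W \<and> length us = length us' \<and> length us \<le> n \<and>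
      dsim {..<length us} (\<lambda>s. \<beta> (us ! s)) (\<lambda>s. \<beta> (us' ! s)) \<longrightarrow> Q q (map f us) = Q q (map f us')))"
proof -
  have Wt: "\<beta> ` W \<subseteq> tr" using anti by (simp add: antichain_def)
  obtain xs where xs: "set xs = \<beta> ` W" "sorted_wrt (\<lambda>a b. lx a b \<and> a \<noteq> b) xs"
    using lex_enumerate[OF finite_imageI[OF fin(2)] Wt] by blast
  define M where "M = length xs"
  define x where "x = (!) xs"
  have x: "x i \<in> tr" if "i < M" for i using that xs(1) Wt nth_mem[of i xs] by (auto simp: x_def M_def)
  have sorted: "lx (x i) (x j) \<and> incomparable (x i) (x j)" if "i < j" "j < M" for i j
  proof -
    have "lx (x i) (x j)" "x i \<noteq> x j" using sorted_wrt_nth_less[OF xs(2), of i j] that by (auto simp: x_def M_def)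
    moreover have "x i \<in> \<beta> ` W" "x j \<in> \<beta> ` W" using that xs(1) nth_mem[of i xs] nth_mem[of j xs] by (auto simp: x_def M_def)
    ultimately show ?thesis using anti unfolding antichain_def by blast
  qed
  have lxx: "lx (x i) (x j) \<longleftrightarrow> i \<le> j" if "i < M" "j < M" for i j
  proof (cases i j rule: linorder_cases)
    case greater
    then show ?thesis using sorted[of j i] lex_antisym[OF x[OF that(1)] x[OF that(2)]] that
      by (auto simp: incomparable_def)
  qed (use sorted that in auto)
  have "\<exists>i. i < M \<and> x i = \<beta> w" if w: "w \<in> W" for w
  proof -
    have "\<beta> w \<in> set xs" using xs(1) w by blast
    then show ?thesis unfolding x_def M_def in_set_conv_nth .
  qed
  then obtain idx where idx: "\<And>w. w \<in> W \<Longrightarrow> idx w < M \<and> x (idx w) = \<beta> w" by metis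
  let ?J = "J \<times> {\<pi>. set \<pi> \<subseteq> {..<n} \<and> length \<pi> \<le> n}"
  have fJ: "finite ?J" using fin(1) finite_lists_length_le[of "{..<n}" n] by simp
  have x': "\<forall>i<M. x i \<in> tr"
    and sorted': "\<forall>i j. i < j \<and> j < M \<longrightarrow> lx (x i) (x j) \<and> incomparable (x i) (x j)"
    using x sorted by blast+
  from tree_ramsey_sorted[where x = x and M = M and J = ?J and 'q = "'q \<times> nat list", OF fJ x' sorted']
  obtain Z where Z: "finite Z" "antichain \<kappa> Z" and R: "\<forall>Q :: 'q \<times> nat list \<Rightarrow> 'k seq list \<Rightarrow> bool.
    \<exists>f. f ` {..<M} \<subseteq> Z \<and> dsim {..<M} x f \<and>
    (\<forall>q\<in>?J. \<forall>js js'. js \<noteq> [] \<and> sorted_wrt (<) js \<and> sorted_wrt (<) js' \<and> set js \<subseteq> {..<M} \<and> set js' \<subseteq> {..<M} \<and>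
      length js = length js' \<and> dsim {..<length js} (\<lambda>s. x (js ! s)) (\<lambda>s. x (js' ! s)) \<longrightarrow>
      Q q (map f js) = Q q (map f js'))" by (elim exE conjE)
  have "\<exists>f. f ` W \<subseteq> Z \<and> dsim W \<beta> f \<and>
    (\<forall>q\<in>J. \<forall>us us'. set us \<subseteq> W \<and> set us' \<subseteq> W \<and> length us = length us' \<and> length us \<le> n \<and>
      dsim {..<length us} (\<lambda>s. \<beta> (us ! s)) (\<lambda>s. \<beta> (us' ! s)) \<longrightarrow> Q q (map f us) = Q q (map f us'))"
    for Q :: "'q \<Rightarrow> 'k seq list \<Rightarrow> bool"
  proof -
    from spec[OF R, of "\<lambda>(q, \<pi>) zs. Q q (map ((!) zs) \<pi>)"] obtain f where f: "f ` {..<M} \<subseteq> Z" "dsim {..<M} x f"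
      and hom0: "\<forall>q\<in>?J. \<forall>js js'. js \<noteq> [] \<and> sorted_wrt (<) js \<and> sorted_wrt (<) js' \<and> set js \<subseteq> {..<M} \<and> set js' \<subseteq> {..<M} \<and>
      length js = length js' \<and> dsim {..<length js} (\<lambda>s. x (js ! s)) (\<lambda>s. x (js' ! s)) \<longrightarrow>
      (case q of (q, \<pi>) \<Rightarrow> \<lambda>zs. Q q (map ((!) zs) \<pi>)) (map f js) = (case q of (q, \<pi>) \<Rightarrow> \<lambda>zs. Q q (map ((!) zs) \<pi>)) (map f js')"
      by (elim exE conjE)
    have hom: "Q q (map ((!) (map f js)) \<pi>) = Q q (map ((!) (map f js')) \<pi>)"
      if "q \<in> J" "set \<pi> \<subseteq> {..<n}" "length \<pi> \<le> n" "js \<noteq> []" "sorted_wrt (<) js" "sorted_wrt (<) js'" "set js \<subseteq> {..<M}"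
        "set js' \<subseteq> {..<M}" "length js = length js'" "dsim {..<length js} (\<lambda>s. x (js ! s)) (\<lambda>s. x (js' ! s))" for q \<pi> js js'
      using bspec[OF hom0, of "(q, \<pi>)"] that by simp
    show ?thesis
    proof (intro exI[of _ "\<lambda>w. f (idx w)"] conjI ballI allI impI)
      show "(\<lambda>w. f (idx w)) ` W \<subseteq> Z" using f(1) idx by auto
      have "dsim W (\<lambda>w. x (idx w)) (\<lambda>w. f (idx w))" by (rule dsim_reindex[OF f(2)]) (use idx in auto)
      moreover have "dsim W (\<lambda>w. x (idx w)) (\<lambda>w. f (idx w)) = dsim W \<beta> (\<lambda>w. f (idx w))"
        by (rule dsim_cong) (use idx in auto)
      ultimately show "dsim W \<beta> (\<lambda>w. f (idx w))" by simp
    next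
      fix q us us'
      assume q: "q \<in> J" and A: "set us \<subseteq> W \<and> set us' \<subseteq> W \<and> length us = length us' \<and> length us \<le> n \<and>
        dsim {..<length us} (\<lambda>s. \<beta> (us ! s)) (\<lambda>s. \<beta> (us' ! s))"
      define is0 where "is0 = map idx us"
      define is1 where "is1 = map idx us'"
      let ?js = "sorted_list_of_set (set is0)" and ?js' = "sorted_list_of_set (set is1)"
      have len: "length is0 = length us" "length is1 = length us" using A by (auto simp: is0_def is1_def)
      have sub: "set is0 \<subseteq> {..<M}" "set is1 \<subseteq> {..<M}" using A idx by (auto simp: is0_def is1_def)
      have W: "us ! s \<in> W" "us' ! s \<in> W" if "s < length us" for s using A that nth_mem by (metis subsetD)+
      have nth: "is0 ! s < M" "x (is0 ! s) = \<beta> (us ! s)" "is1 ! s < M" "x (is1 ! s) = \<beta> (us' ! s)" if "s < length us" for s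
        using idx W[OF that] that A by (auto simp: is0_def is1_def)
      have d: "dsim {..<length us} (\<lambda>s. x (is0 ! s)) (\<lambda>s. x (is1 ! s))"
      proof -
        have "dsim {..<length us} (\<lambda>s. x (is0 ! s)) (\<lambda>s. x (is1 ! s)) = dsim {..<length us} (\<lambda>s. \<beta> (us ! s)) (\<lambda>s. \<beta> (us' ! s))"
          by (rule dsim_cong) (use nth in auto)
        then show ?thesis using A by blast
      qed
      have o: "is0 ! s < is0 ! t \<longleftrightarrow> is1 ! s < is1 ! t" if "s < length is0" "t < length is0" for s t
        using dsimD(2)[OF d, of t s] lxx[of "is0 ! t" "is0 ! s"] lxx[of "is1 ! t" "is1 ! s"] nth[of s] nth[of t] that len
        by (simp add: linorder_not_le[symmetric])
      have l01: "length is0 = length is1" using len by simp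
      note pat = pattern_eq[OF l01 o]
      have "Q q (map ((!) (map f ?js)) (pattern is0)) = Q q (map ((!) (map f ?js')) (pattern is0))" if ne: "us \<noteq> []"
      proof (rule hom[OF q])
        show "set (pattern is0) \<subseteq> {..<n}" using pattern_bound[of is0] len A by auto
        show "length (pattern is0) \<le> n" using len A by simp
        have "card (set is0) \<noteq> 0" using ne by (simp add: is0_def)
        then show "?js \<noteq> []" by (metis length_sorted_list_of_set list.size(3))
        show "sorted_wrt (<) ?js" "sorted_wrt (<) ?js'" by simp_all
        show "set ?js \<subseteq> {..<M}" "set ?js' \<subseteq> {..<M}" using sub by simp_all
        show l: "length ?js = length ?js'" using pat(2) by simp
        \<comment> \<open>A position at which the \<open>k\<close>-th smallest index occurs. It
          serves both tuples, since their patterns agree, and makes the type of the sorted lists a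
          reindexing of the type of the given tuples.\<close>
        define pos where "pos k = (SOME s. s < length is0 \<and> pattern is0 ! s = k)" for k
        have pos: "pos k < length us \<and> pattern is0 ! pos k = k" if k: "k < length ?js" for k
        proof -
          have "\<exists>s. s < length is0 \<and> pattern is0 ! s = k" using pattern_position[of k is0] k by auto
          then show ?thesis unfolding pos_def len[symmetric] using someI_ex by (metis (mono_tags, lifting))
        qed
        have js: "?js ! k = is0 ! pos k \<and> ?js' ! k = is1 ! pos k" if k: "k < length ?js" for k
          using pattern_nth[of "pos k" is0] pattern_nth[of "pos k" is1] pos[OF k] pat(1) len by simp
        have "dsim {..<length ?js} (\<lambda>k. x (is0 ! pos k)) (\<lambda>k. x (is1 ! pos k))"
          by (rule dsim_reindex[OF d]) (use pos in auto)
        moreover have "dsim {..<length ?js} (\<lambda>k. x (?js ! k)) (\<lambda>k. x (?js' ! k)) =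
            dsim {..<length ?js} (\<lambda>k. x (is0 ! pos k)) (\<lambda>k. x (is1 ! pos k))"
          by (rule dsim_cong) (use js in auto)
        ultimately show "dsim {..<length ?js} (\<lambda>k. x (?js ! k)) (\<lambda>k. x (?js' ! k))" by simp
      qed
      moreover have "map ((!) (map f (sorted_list_of_set (set r)))) (pattern r) = map f r" for r
      proof (rule nth_equalityI)
        fix s assume "s < length (map ((!) (map f (sorted_list_of_set (set r)))) (pattern r))"
        then have s: "s < length r" by simp
        show "map ((!) (map f (sorted_list_of_set (set r)))) (pattern r) ! s = map f r ! s"
          using pattern_nth[OF s] s by simp
      qed simp
      ultimately have "Q q (map f is0) = Q q (map f is1)" if "us \<noteq> []" using that pat(1) by metis
      \<comment> \<open>The Ramsey property covers nonempty lists only; two empty tuples are simply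
        equal.\<close>
      moreover have "us = [] \<Longrightarrow> us' = []" using A by simp
      ultimately show "Q q (map (\<lambda>w. f (idx w)) us) = Q q (map (\<lambda>w. f (idx w)) us')"
        by (cases "us = []") (auto simp: is0_def is1_def comp_def)
    qed
  qed
  then show ?thesis using Z by blast
qed

end

section \<open>Formulas and saturation\<close>

lemma tm_val_map: "tm_val M xs e (map_tm id g t) = tm_val M xs (e \<circ> g) t"
  by (induction t) (auto simp: comp_def cong: map_cong)

lemma sat_map: "sat M xs e (map_fm id id g \<phi>) = sat M xs (e \<circ> g) \<phi>"
proof (induction \<phi> arbitrary: xs)
  case (Rel R ts)
  have "map (tm_val M xs e \<circ> map_tm id g) ts = map (tm_val M xs (e \<circ> g)) ts" by (simp add: tm_val_map)
  then show ?case by (simp only: fm.map sat.simps list.map_comp id_def)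
qed (simp_all add: tm_val_map)

lemma wf_tm_map: "wf_tm L k (map_tm id g t) = wf_tm L k t"
  by (induction t) auto

lemma wf_fm_map: "wf_fm L k (map_fm id id g \<phi>) = wf_fm L k \<phi>"
  by (induction \<phi> arbitrary: k) (auto simp: wf_tm_map)

lemma map_in_formulas: "\<phi> \<in> formulas L V \<Longrightarrow> g ` (V \<inter> fm_vars \<phi>) \<subseteq> V' \<Longrightarrow> map_fm id id g \<phi> \<in> formulas L V'"
  unfolding formulas_def by (auto simp: wf_fm_map fm.set_map)

lemma tm_val_cong: "(\<And>v. v \<in> tm_vars t \<Longrightarrow> e v = e' v) \<Longrightarrow> tm_val M xs e t = tm_val M xs e' t"
proof (induction t)
  case (Fn f ts)
  have "map (tm_val M xs e) ts = map (tm_val M xs e') ts" using Fn by (intro map_cong) auto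
  then show ?case by (simp only: tm_val.simps)
qed auto

lemma sat_cong: "(\<And>v. v \<in> fm_vars \<phi> \<Longrightarrow> e v = e' v) \<Longrightarrow> sat M xs e \<phi> = sat M xs e' \<phi>"
proof (induction \<phi> arbitrary: xs)
  case (Eq s t)
  then show ?case using tm_val_cong[of s e e' M xs] tm_val_cong[of t e e' M xs] by simp
next
  case (Rel R ts)
  have "map (tm_val M xs e) ts = map (tm_val M xs e') ts" using Rel by (auto intro: tm_val_cong)
  then show ?case by (simp only: sat.simps)
next
  case (Conj \<phi> \<psi>)
  then show ?case using Conj.IH(1)[of xs] Conj.IH(2)[of xs] by simp
next
  case (Ex \<phi>)
  have "sat M (x # xs) e \<phi> = sat M (x # xs) e' \<phi>" for x using Ex by simp
  then show ?case by simp
qed simp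

lemma sat_formulas_cong: "\<phi> \<in> formulas L V \<Longrightarrow> (\<And>v. v \<in> V \<Longrightarrow> e v = e' v) \<Longrightarrow> sat M xs e \<phi> = sat M xs e' \<phi>"
  by (rule sat_cong) (auto simp: formulas_def)

lemma finite_tm_vars: "finite (tm_vars t)"
  by (induction t) auto

lemma finite_fm_vars: "finite (fm_vars \<phi>)"
  by (induction \<phi>) (auto simp: finite_tm_vars)

lemma formulas_mono: "\<phi> \<in> formulas L V \<Longrightarrow> V \<subseteq> V' \<Longrightarrow> \<phi> \<in> formulas L V'"
  by (auto simp: formulas_def)

text \<open>The new quantifier goes outermost: under \<open>k\<close> inner binders its variable has
  index \<open>k\<close>, and the indices already present are not shifted. Accordingly its value is
  appended at the end of the list in \<open>sat_abs\<close>.\<close>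

fun abs_tm :: "'v \<Rightarrow> nat \<Rightarrow> ('f, 'v) tm \<Rightarrow> ('f, 'v) tm" where
  "abs_tm v k (Free u) = (if u = v then Bound k else Free u)"
| "abs_tm v k (Bound i) = Bound i"
| "abs_tm v k (Fn f ts) = Fn f (map (abs_tm v k) ts)"

fun abs_fm :: "'v \<Rightarrow> nat \<Rightarrow> ('f, 'p, 'v) fm \<Rightarrow> ('f, 'p, 'v) fm" where
  "abs_fm v k (Eq s t) = Eq (abs_tm v k s) (abs_tm v k t)"
| "abs_fm v k (Rel R ts) = Rel R (map (abs_tm v k) ts)"
| "abs_fm v k (Neg \<phi>) = Neg (abs_fm v k \<phi>)"
| "abs_fm v k (Conj \<phi> \<psi>) = Conj (abs_fm v k \<phi>) (abs_fm v k \<psi>)"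
| "abs_fm v k (Ex \<phi>) = Ex (abs_fm v (Suc k) \<phi>)"

lemma tm_val_abs: "wf_tm L (length xs) t \<Longrightarrow> tm_val M (xs @ [a]) e (abs_tm v (length xs) t) = tm_val M xs (e(v := a)) t"
  by (induction t) (auto simp: nth_append cong: map_cong)

lemma sat_abs: "wf_fm L (length xs) \<phi> \<Longrightarrow> sat M (xs @ [a]) e (abs_fm v (length xs) \<phi>) = sat M xs (e(v := a)) \<phi>"
proof (induction \<phi> arbitrary: xs)
  case (Rel R ts)
  have "map (tm_val M (xs @ [a]) e \<circ> abs_tm v (length xs)) ts = map (tm_val M xs (e(v := a))) ts"
    using Rel by (auto simp: tm_val_abs)
  then show ?case by (simp only: abs_fm.simps sat.simps list.map_comp)
next
  case (Ex \<phi>)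
  have "sat M (x # xs @ [a]) e (abs_fm v (Suc (length xs)) \<phi>) = sat M (x # xs) (e(v := a)) \<phi>" for x
    using Ex.IH[of "x # xs"] Ex.prems by (simp add: fun_upd_def)
  then show ?case by (simp add: fun_upd_def)
qed (auto simp: tm_val_abs)

lemma wf_tm_abs: "wf_tm L k t \<Longrightarrow> wf_tm L (Suc k) (abs_tm v k t)"
  by (induction t) auto

lemma wf_fm_abs: "wf_fm L k \<phi> \<Longrightarrow> wf_fm L (Suc k) (abs_fm v k \<phi>)"
  by (induction \<phi> arbitrary: k) (auto simp: wf_tm_abs)

lemma tm_vars_abs: "tm_vars (abs_tm v k t) \<subseteq> tm_vars t - {v}"
  by (induction t) auto

lemma fm_vars_abs: "fm_vars (abs_fm v k \<phi>) \<subseteq> fm_vars \<phi> - {v}"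
proof (induction \<phi> arbitrary: k)
  case (Eq s t)
  then show ?case using tm_vars_abs[of v k s] tm_vars_abs[of v k t] by auto
next
  case (Rel R ts)
  then show ?case using tm_vars_abs[of v k] by fastforce
next
  case (Conj \<phi> \<psi>)
  then show ?case using Conj.IH(1)[of k] Conj.IH(2)[of k] by auto
qed auto

lemma ex_formula:
  assumes "finite S" "\<psi> \<in> formulas L V"
  obtains \<chi> where "\<chi> \<in> formulas L (V - S)"
    and "\<And>e. sat M [] e \<chi> \<longleftrightarrow> (\<exists>e'. (\<forall>v. v \<notin> S \<longrightarrow> e' v = e v) \<and> e' ` S \<subseteq> univ M \<and> sat M [] e' \<psi>)"
proof -
  have "\<exists>\<chi>\<in>formulas L (V - S). \<forall>e. sat M [] e \<chi> \<longleftrightarrow>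
    (\<exists>e'. (\<forall>v. v \<notin> S \<longrightarrow> e' v = e v) \<and> e' ` S \<subseteq> univ M \<and> sat M [] e' \<psi>)"
    using assms(1)
  proof (induction S rule: finite_induct)
    case empty
    show ?case using assms(2) by (intro bexI[of _ \<psi>]) (auto simp: fun_eq_iff[symmetric])
  next
    case (insert x S)
    then obtain \<chi> where \<chi>: "\<chi> \<in> formulas L (V - S)" "\<And>e. sat M [] e \<chi> \<longleftrightarrow>
      (\<exists>e'. (\<forall>v. v \<notin> S \<longrightarrow> e' v = e v) \<and> e' ` S \<subseteq> univ M \<and> sat M [] e' \<psi>)" by blast
    have w: "wf_fm L 0 \<chi>" using \<chi>(1) by (simp add: formulas_def)
    show ?case
    proof (intro bexI[of _ "Ex (abs_fm x 0 \<chi>)"] allI)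
      show "Ex (abs_fm x 0 \<chi>) \<in> formulas L (V - insert x S)"
        using \<chi>(1) wf_fm_abs[OF w] fm_vars_abs[of x 0 \<chi>] by (auto simp: formulas_def)
      fix e
      have "sat M [] e (Ex (abs_fm x 0 \<chi>)) \<longleftrightarrow> (\<exists>a\<in>univ M. sat M [] (e(x := a)) \<chi>)"
        using sat_abs[of L "[]" \<chi> M] w by simp
      also have "\<dots> \<longleftrightarrow> (\<exists>e'. (\<forall>v. v \<notin> insert x S \<longrightarrow> e' v = e v) \<and> e' ` insert x S \<subseteq> univ M \<and> sat M [] e' \<psi>)"
      proof
        assume "\<exists>a\<in>univ M. sat M [] (e(x := a)) \<chi>"
        then obtain a e' where a: "a \<in> univ M" and e': "\<forall>v. v \<notin> S \<longrightarrow> e' v = (e(x := a)) v" "e' ` S \<subseteq> univ M" "sat M [] e' \<psi>"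
          unfolding \<chi>(2) by blast
        have "e' x = a" using e'(1) insert.hyps(2) by simp
        then have "(\<forall>v. v \<notin> insert x S \<longrightarrow> e' v = e v) \<and> e' ` insert x S \<subseteq> univ M" using e'(1,2) a by simp
        then show "\<exists>e'. (\<forall>v. v \<notin> insert x S \<longrightarrow> e' v = e v) \<and> e' ` insert x S \<subseteq> univ M \<and> sat M [] e' \<psi>"
          using e'(3) by blast
      next
        assume "\<exists>e'. (\<forall>v. v \<notin> insert x S \<longrightarrow> e' v = e v) \<and> e' ` insert x S \<subseteq> univ M \<and> sat M [] e' \<psi>"
        then obtain e' where e': "\<forall>v. v \<notin> insert x S \<longrightarrow> e' v = e v" "e' ` insert x S \<subseteq> univ M" "sat M [] e' \<psi>" by blast
        have "\<forall>v. v \<notin> S \<longrightarrow> e' v = (e(x := e' x)) v" using e'(1) by simp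
        then have "sat M [] (e(x := e' x)) \<chi>" unfolding \<chi>(2) using e'(2,3) by (intro exI[of _ e']) auto
        then show "\<exists>a\<in>univ M. sat M [] (e(x := a)) \<chi>" using e'(2) by blast
      qed
      finally show "sat M [] e (Ex (abs_fm x 0 \<chi>)) \<longleftrightarrow>
        (\<exists>e'. (\<forall>v. v \<notin> insert x S \<longrightarrow> e' v = e v) \<and> e' ` insert x S \<subseteq> univ M \<and> sat M [] e' \<psi>)" .
    qed
  qed
  then show ?thesis using that by blast
qed

lemma conj_formula:
  assumes "finite \<Psi>" "\<Psi> \<subseteq> formulas L V" "univ M \<noteq> {}"
  obtains \<psi> where "\<psi> \<in> formulas L V" "\<And>e. sat M [] e \<psi> \<longleftrightarrow> (\<forall>\<phi>\<in>\<Psi>. sat M [] e \<phi>)"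
proof -
  have "\<exists>\<psi>\<in>formulas L V. \<forall>e. sat M [] e \<psi> \<longleftrightarrow> (\<forall>\<phi>\<in>\<Psi>. sat M [] e \<phi>)"
    using assms(1,2)
  proof (induction \<Psi> rule: finite_induct)
    case empty
    \<comment> \<open>A true sentence. There may be no free variable and no symbol to build it from,
      hence the quantifier over the nonempty universe.\<close>
    show ?case using assms(3) by (intro bexI[of _ "Ex (Eq (Bound 0) (Bound 0))"]) (auto simp: formulas_def)
  next
    case (insert \<phi> \<Psi>)
    then obtain \<psi> where "\<psi> \<in> formulas L V" "\<forall>e. sat M [] e \<psi> \<longleftrightarrow> (\<forall>\<phi>\<in>\<Psi>. sat M [] e \<phi>)" by auto
    then show ?case using insert.prems by (intro bexI[of _ "Conj \<phi> \<psi>"]) (auto simp: formulas_def)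
  qed
  then show ?thesis using that by blast
qed

definition iff_fm :: "('f, 'p, 'v) fm \<Rightarrow> ('f, 'p, 'v) fm \<Rightarrow> ('f, 'p, 'v) fm" where
  "iff_fm \<phi> \<psi> = Conj (Neg (Conj \<phi> (Neg \<psi>))) (Neg (Conj \<psi> (Neg \<phi>)))"

lemma sat_iff_fm [simp]: "sat M xs e (iff_fm \<phi> \<psi>) \<longleftrightarrow> (sat M xs e \<phi> \<longleftrightarrow> sat M xs e \<psi>)"
  by (auto simp: iff_fm_def)

lemma iff_fm_formulas: "iff_fm \<phi> \<psi> \<in> formulas L V \<longleftrightarrow> \<phi> \<in> formulas L V \<and> \<psi> \<in> formulas L V"
  by (auto simp: iff_fm_def formulas_def)

text \<open>Coordinates before \<open>k\<close> become parameters, those after \<open>k\<close> are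
  quantified out, and coordinate \<open>k\<close> becomes the single variable: a formula of the kind
  that \<open>saturated\<close> can handle.\<close>

lemma partial_realization:
  assumes \<Gamma>: "\<Gamma> \<subseteq> formulas L ({..<m} <+> A)" and k: "k < m" and ne: "univ M \<noteq> {}" and fin: "finite \<Gamma>0" "\<Gamma>0 \<subseteq> \<Gamma>"
  obtains \<theta> where "\<theta> \<in> formulas L ({..<1::nat} <+> (A \<union> b ` {..<k}))"
    and "\<And>x. sat M [] (case_sum x id) \<theta> \<longleftrightarrow> (\<exists>b'. (\<forall>i<k. b' i = b i) \<and> b' k = x 0 \<and> b' ` {Suc k..<m} \<subseteq> univ M \<and>
      (\<forall>\<phi>\<in>\<Gamma>0. sat M [] (case_sum b' id) \<phi>))"
proof -
  obtain \<gamma> where \<gamma>: "\<gamma> \<in> formulas L ({..<m} <+> A)" "\<And>e. sat M [] e \<gamma> \<longleftrightarrow> (\<forall>\<phi>\<in>\<Gamma>0. sat M [] e \<phi>)"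
    by (rule conj_formula[OF fin(1) order_trans[OF fin(2) \<Gamma>] ne]) blast
  define S :: "(nat + 'c) set" where "S = Inl ` {Suc k..<m}"
  have "finite S" by (simp add: S_def)
  obtain \<chi> where \<chi>: "\<chi> \<in> formulas L (({..<m} <+> A) - S)"
    "\<And>e. sat M [] e \<chi> \<longleftrightarrow> (\<exists>e'. (\<forall>v. v \<notin> S \<longrightarrow> e' v = e v) \<and> e' ` S \<subseteq> univ M \<and> sat M [] e' \<gamma>)"
    using ex_formula[OF \<open>finite S\<close> \<gamma>(1), of M] by blast
  define g :: "nat + 'c \<Rightarrow> nat + 'c" where
    "g = case_sum (\<lambda>i. if i < k then Inr (b i) else if i = k then Inl 0 else Inl i) Inr"
  have gim: "g v \<in> {..<1::nat} <+> (A \<union> b ` {..<k})" if "v \<in> ({..<m} <+> A) - S" for v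
  proof (cases v)
    case (Inl i)
    then have "i \<le> k" using that by (auto simp: S_def)
    then show ?thesis using Inl by (auto simp: g_def)
  qed (use that in \<open>auto simp: g_def\<close>)
  have "sat M [] (case_sum x id) (map_fm id id g \<chi>) \<longleftrightarrow> (\<exists>b'. (\<forall>i<k. b' i = b i) \<and> b' k = x 0 \<and> b' ` {Suc k..<m} \<subseteq> univ M \<and>
      (\<forall>\<phi>\<in>\<Gamma>0. sat M [] (case_sum b' id) \<phi>))" (is "?l \<longleftrightarrow> ?r") for x
  proof
    assume ?l
    then obtain e' where e': "\<forall>v. v \<notin> S \<longrightarrow> e' v = (case_sum x id \<circ> g) v" "e' ` S \<subseteq> univ M" "sat M [] e' \<gamma>"
      unfolding sat_map \<chi>(2) by blast
    have "e' (Inl i) = b i" if "i < k" for i using spec[OF e'(1), of "Inl i"] that by (auto simp: S_def g_def)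
    moreover have "e' (Inl k) = x 0" using spec[OF e'(1), of "Inl k"] by (auto simp: S_def g_def)
    moreover have "(e' \<circ> Inl) ` {Suc k..<m} \<subseteq> univ M" using e'(2) by (auto simp: S_def)
    moreover have "e' v = case_sum (e' \<circ> Inl) id v" for v
      using spec[OF e'(1), of v] by (cases v) (auto simp: S_def g_def)
    then have "e' = case_sum (e' \<circ> Inl) id" by blast
    then have "\<forall>\<phi>\<in>\<Gamma>0. sat M [] (case_sum (e' \<circ> Inl) id) \<phi>" using e'(3) \<gamma>(2) by metis
    ultimately show ?r by (intro exI[of _ "e' \<circ> Inl"]) auto
  next
    assume ?r
    then obtain b' where b': "\<forall>i<k. b' i = b i" "b' k = x 0" "b' ` {Suc k..<m} \<subseteq> univ M"
      "\<forall>\<phi>\<in>\<Gamma>0. sat M [] (case_sum b' id) \<phi>" by blast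
    \<comment> \<open>Beyond \<open>m\<close> the values are those of \<open>x\<close>: they do not
      affect \<open>\<gamma>\<close>, but must agree with \<open>g\<close> outside
      \<open>S\<close>.\<close>
    define e' where "e' = case_sum (\<lambda>i. if i < m then b' i else x i) id"
    have "sat M [] (case_sum b' id) \<gamma>" using b'(4) \<gamma>(2) by blast
    moreover have "sat M [] (case_sum b' id) \<gamma> \<longleftrightarrow> sat M [] e' \<gamma>"
      by (rule sat_formulas_cong[OF \<gamma>(1)]) (auto simp: e'_def)
    moreover have "e' v = (case_sum x id \<circ> g) v" if "v \<notin> S" for v
    proof (cases v)
      case (Inl i)
      then have "i \<le> k \<or> m \<le> i" using that by (auto simp: S_def image_iff)
      then show ?thesis using Inl b'(1,2) k by (auto simp: e'_def g_def)
    qed (simp add: e'_def g_def)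
    moreover have "e' ` S \<subseteq> univ M" using b'(3) by (auto simp: e'_def S_def)
    ultimately show ?l unfolding sat_map \<chi>(2) by blast
  qed
  moreover have "map_fm id id g \<chi> \<in> formulas L ({..<1::nat} <+> (A \<union> b ` {..<k}))"
    by (rule map_in_formulas[OF \<chi>(1)]) (use gim in blast)
  ultimately show ?thesis using that by blast
qed

lemma finite_card_less:
  assumes "Card_order \<mu>" "infinite (Field \<mu>)" "finite A"
  shows "|A| <o \<mu>"
proof -
  have "Well_order |A|" "Well_order \<mu>"
    using assms(1) card_of_Well_order card_order_on_well_order_on by blast+
  then show ?thesis using finite_ordLess_infinite[of "|A|" \<mu>] assms by (simp add: Field_card_of)
qed

text \<open>Since \<open>saturated\<close> speaks of one variable, the coordinates are found in
  turn. The invariant is that each finite part of \<open>\<Gamma>\<close> has a realization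
  extending the coordinates chosen so far; \<open>\<theta> \<Gamma>0\<close> expresses this for the
  next coordinate.\<close>

lemma saturated_tuple:
  assumes sat: "saturated L \<mu> M" and \<mu>: "Card_order \<mu>" "infinite (Field \<mu>)" and ne: "univ M \<noteq> {}"
    and A: "A \<subseteq> univ M" "|A| <o \<mu>" and \<Gamma>: "\<Gamma> \<subseteq> formulas L ({..<m} <+> A)" and con: "consistent M m \<Gamma>"
  obtains b where "b ` {..<m} \<subseteq> univ M" "\<forall>\<phi>\<in>\<Gamma>. sat M [] (case_sum b id) \<phi>"
proof -
  have "k \<le> m \<Longrightarrow> \<exists>b. b ` {..<k} \<subseteq> univ M \<and> (\<forall>\<Gamma>0\<subseteq>\<Gamma>. finite \<Gamma>0 \<longrightarrow>
      (\<exists>b'. (\<forall>i<k. b' i = b i) \<and> b' ` {..<m} \<subseteq> univ M \<and> (\<forall>\<phi>\<in>\<Gamma>0. sat M [] (case_sum b' id) \<phi>)))" for k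
  proof (induction k)
    case 0
    then show ?case using con unfolding consistent_def by simp
  next
    case (Suc k)
    then obtain b where b: "b ` {..<k} \<subseteq> univ M" "\<And>\<Gamma>0. \<Gamma>0 \<subseteq> \<Gamma> \<Longrightarrow> finite \<Gamma>0 \<Longrightarrow>
      (\<exists>b'. (\<forall>i<k. b' i = b i) \<and> b' ` {..<m} \<subseteq> univ M \<and> (\<forall>\<phi>\<in>\<Gamma>0. sat M [] (case_sum b' id) \<phi>))" by auto
    have km: "k < m" using Suc.prems by simp
    define D where "D \<Gamma>0 x \<longleftrightarrow> (\<exists>b'. (\<forall>i<k. b' i = b i) \<and> b' k = x \<and> b' ` {Suc k..<m} \<subseteq> univ M \<and>
      (\<forall>\<phi>\<in>\<Gamma>0. sat M [] (case_sum b' id) \<phi>))" for \<Gamma>0 x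
    have "\<exists>\<theta>. \<theta> \<in> formulas L ({..<1::nat} <+> (A \<union> b ` {..<k})) \<and> (\<forall>x. sat M [] (case_sum x id) \<theta> \<longleftrightarrow> D \<Gamma>0 (x 0))"
      if "finite \<Gamma>0" "\<Gamma>0 \<subseteq> \<Gamma>" for \<Gamma>0
      unfolding D_def by (rule partial_realization[OF \<Gamma> km ne that, of b]) blast
    then have "\<forall>\<Gamma>0. \<exists>\<theta>. finite \<Gamma>0 \<and> \<Gamma>0 \<subseteq> \<Gamma> \<longrightarrow> \<theta> \<in> formulas L ({..<1::nat} <+> (A \<union> b ` {..<k})) \<and>
      (\<forall>x. sat M [] (case_sum x id) \<theta> \<longleftrightarrow> D \<Gamma>0 (x 0))" by blast
    from choice[OF this] obtain \<theta> where "\<forall>\<Gamma>0. finite \<Gamma>0 \<and> \<Gamma>0 \<subseteq> \<Gamma> \<longrightarrow>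
      \<theta> \<Gamma>0 \<in> formulas L ({..<1::nat} <+> (A \<union> b ` {..<k})) \<and> (\<forall>x. sat M [] (case_sum x id) (\<theta> \<Gamma>0) \<longleftrightarrow> D \<Gamma>0 (x 0))" ..
    then have \<theta>: "\<theta> \<Gamma>0 \<in> formulas L ({..<1::nat} <+> (A \<union> b ` {..<k})) \<and>
      (\<forall>x. sat M [] (case_sum x id) (\<theta> \<Gamma>0) \<longleftrightarrow> D \<Gamma>0 (x 0))" if "finite \<Gamma>0" "\<Gamma>0 \<subseteq> \<Gamma>" for \<Gamma>0
      using that by blast
    let ?\<Sigma> = "\<theta> ` {\<Gamma>0. finite \<Gamma>0 \<and> \<Gamma>0 \<subseteq> \<Gamma>}"
    have "consistent M 1 ?\<Sigma>" unfolding consistent_def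
    proof (intro allI impI)
      fix \<Sigma>0 assume s: "\<Sigma>0 \<subseteq> ?\<Sigma>" "finite \<Sigma>0"
      obtain G where G: "finite G" "G \<subseteq> {\<Gamma>0. finite \<Gamma>0 \<and> \<Gamma>0 \<subseteq> \<Gamma>}" "\<Sigma>0 = \<theta> ` G"
        using finite_subset_image[OF s(2,1)] by blast
      \<comment> \<open>Finitely many conditions \<open>\<theta> \<Gamma>0\<close> are met together
        by the next coordinate of a realization of the union of the parts.\<close>
      have "\<Union>G \<subseteq> \<Gamma>" "finite (\<Union>G)" using G by auto
      from b(2)[OF this] obtain b' where b': "\<forall>i<k. b' i = b i" "b' ` {..<m} \<subseteq> univ M"
        "\<forall>\<phi>\<in>\<Union>G. sat M [] (case_sum b' id) \<phi>" by blast
      have sub: "b' ` {Suc k..<m} \<subseteq> univ M" using b'(2) by auto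
      have "D \<Gamma>0 (b' k)" if "\<Gamma>0 \<in> G" for \<Gamma>0 unfolding D_def using b'(1,3) sub that by blast
      then have "\<forall>\<phi>\<in>\<Sigma>0. sat M [] (case_sum (\<lambda>_. b' k) id) \<phi>" using \<theta> G by auto
      then show "\<exists>b. b ` {..<1::nat} \<subseteq> univ M \<and> (\<forall>\<phi>\<in>\<Sigma>0. sat M [] (case_sum b id) \<phi>)"
        using b'(2) km by (intro exI[of _ "\<lambda>_. b' k"]) auto
    qed
    moreover have "?\<Sigma> \<subseteq> formulas L ({..<1::nat} <+> (A \<union> b ` {..<k}))" using \<theta> by blast
    moreover have "A \<union> b ` {..<k} \<subseteq> univ M" using A b(1) by simp
    moreover have "|A \<union> b ` {..<k}| <o \<mu>"
      using card_of_Un_ordLess_infinite_Field[OF \<mu>(2,1) A(2) finite_card_less[OF \<mu>]] by simp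
    ultimately obtain x where x: "x \<in> univ M" "\<forall>\<phi>\<in>?\<Sigma>. sat M [] (case_sum (\<lambda>_. x) id) \<phi>"
      using sat unfolding saturated_def by meson
    show ?case
    proof (rule exI[of _ "b(k := x)"], intro conjI allI impI)
      show "(b(k := x)) ` {..<Suc k} \<subseteq> univ M" using b(1) x(1) by auto
      fix \<Gamma>0 assume g: "\<Gamma>0 \<subseteq> \<Gamma>" "finite \<Gamma>0"
      then have "D \<Gamma>0 x" using x(2) \<theta>[OF g(2,1)] by auto
      then obtain b' where b': "\<forall>i<k. b' i = b i" "b' k = x" "b' ` {Suc k..<m} \<subseteq> univ M"
        "\<forall>\<phi>\<in>\<Gamma>0. sat M [] (case_sum b' id) \<phi>" unfolding D_def by blast
      have "b' i \<in> univ M" if "i < m" for i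
        using that b' b(1) x(1) by (cases i k rule: linorder_cases) auto
      then show "\<exists>b'. (\<forall>i<Suc k. b' i = (b(k := x)) i) \<and> b' ` {..<m} \<subseteq> univ M \<and> (\<forall>\<phi>\<in>\<Gamma>0. sat M [] (case_sum b' id) \<phi>)"
        using b' by (intro exI[of _ b']) (auto simp: less_Suc_eq)
    qed
  qed
  from this[OF order_refl] obtain b where "b ` {..<m} \<subseteq> univ M \<and> (\<forall>\<Gamma>0\<subseteq>\<Gamma>. finite \<Gamma>0 \<longrightarrow>
      (\<exists>b'. (\<forall>i<m. b' i = b i) \<and> b' ` {..<m} \<subseteq> univ M \<and> (\<forall>\<phi>\<in>\<Gamma>0. sat M [] (case_sum b' id) \<phi>)))" ..
  note b = conjunct1[OF this] conjunct2[OF this]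
  have "sat M [] (case_sum b id) \<phi>" if p: "\<phi> \<in> \<Gamma>" for \<phi>
  proof -
    obtain b' where b': "\<forall>i<m. b' i = b i" "sat M [] (case_sum b' id) \<phi>" using spec[OF b(2), of "{\<phi>}"] p by auto
    have "\<phi> \<in> formulas L ({..<m} <+> A)" using p \<Gamma> by blast
    then have "sat M [] (case_sum b' id) \<phi> \<longleftrightarrow> sat M [] (case_sum b id) \<phi>"
      by (rule sat_formulas_cong) (use b'(1) in auto)
    then show ?thesis using b'(2) by simp
  qed
  then show ?thesis using that b(1) by blast
qed

section \<open>Transfer along indiscernible trees\<close>

definition env :: "(nat \<Rightarrow> 'm) \<Rightarrow> ('s \<Rightarrow> nat \<Rightarrow> 'm) \<Rightarrow> ('j \<Rightarrow> 's) \<Rightarrow> (nat + 'j \<times> nat) + 'm \<Rightarrow> 'm" where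
  "env b a \<rho> = case_sum (case_sum b (\<lambda>(t, i). a (\<rho> t) i)) id"

abbreviation vars :: "nat \<Rightarrow> 'j set \<Rightarrow> nat \<Rightarrow> 'm set \<Rightarrow> ((nat + 'j \<times> nat) + 'm) set" where
  "vars m J d C \<equiv> ({..<m} <+> J \<times> {..<d}) <+> C"

definition relabel :: "('j \<Rightarrow> 'l) \<Rightarrow> ('f, 'p, (nat + 'j \<times> nat) + 'm) fm \<Rightarrow> ('f, 'p, (nat + 'l \<times> nat) + 'm) fm" where
  "relabel f = map_fm id id (map_sum (map_sum id (map_prod f id)) id)"

definition sub :: "('s \<Rightarrow> nat \<Rightarrow> 'm) \<Rightarrow> ('j \<Rightarrow> 's) \<Rightarrow> (nat + 'j \<times> nat) + 'm \<Rightarrow> nat + 'm" where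
  "sub a \<rho> = case_sum (case_sum Inl (\<lambda>(t, i). Inr (a (\<rho> t) i))) Inr"

lemma env_simps [simp]:
  "env b a \<rho> (Inl (Inl i)) = b i" "env b a \<rho> (Inl (Inr (t, i))) = a (\<rho> t) i" "env b a \<rho> (Inr c) = c"
  by (simp_all add: env_def)

lemma sat_relabel: "sat M [] (env b a \<rho>) (relabel f \<psi>) = sat M [] (env b a (\<lambda>t. \<rho> (f t))) \<psi>"
  unfolding relabel_def sat_map by (rule sat_cong) (auto simp: env_def split: sum.splits)

lemma sat_sub: "sat M [] (case_sum b id) (map_fm id id (sub a \<rho>) \<psi>) = sat M [] (env b a \<rho>) \<psi>"
  unfolding sat_map by (rule sat_cong) (auto simp: env_def sub_def split: sum.splits)

lemma relabel_formulas: "\<psi> \<in> formulas L (vars m J d C) \<Longrightarrow> f ` J \<subseteq> J' \<Longrightarrow> relabel f \<psi> \<in> formulas L (vars m J' d C)"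
  unfolding relabel_def by (rule map_in_formulas) auto

lemma joint_tp_iff:
  "\<psi> \<in> joint_tp L M C m b d a I X \<longleftrightarrow> \<psi> \<in> formulas L (vars m I d C) \<and> sat M [] (env b a X) \<psi>"
  by (simp add: joint_tp_def tp_def env_def)

lemma plug_eq: "plug a X p = map_fm id id (sub a X) ` p"
  by (simp add: plug_def sub_def)

lemma env_cong_formulas:
  "\<psi> \<in> formulas L (vars m J d C) \<Longrightarrow> (\<And>i. i < m \<Longrightarrow> b i = b' i) \<Longrightarrow> (\<And>t i. t \<in> J \<Longrightarrow> i < d \<Longrightarrow> a (\<rho> t) i = a' (\<rho>' t) i) \<Longrightarrow>
    sat M [] (env b a \<rho>) \<psi> = sat M [] (env b' a' \<rho>') \<psi>"
  by (rule sat_formulas_cong) auto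

context card_tree begin

text \<open>Quantifying out the variables for \<open>b\<close> leaves a formula over
  \<open>C\<close> about the tree alone, to which strong indiscernibility applies; the price is that
  the tuple changes. An enumeration of \<open>J\<close> brings the index set into the form
  \<open>{..<n}\<close> of the definition.\<close>

lemma strong_transfer1:
  fixes M :: "('f, 'p, 'm) struct" and J :: "'j set"
  assumes si: "strongly_indiscernible L M \<kappa> d C a" and fin: "finite J"
    and \<rho>: "\<rho> ` J \<subseteq> tr" "\<rho>' ` J \<subseteq> tr" "dsim J \<rho> \<rho>'"
    and \<psi>: "\<psi> \<in> formulas L (vars m J d C)"
    and ex: "\<exists>b. b ` {..<m} \<subseteq> univ M \<and> sat M [] (env b a \<rho>) \<psi>"
  shows "\<exists>b. b ` {..<m} \<subseteq> univ M \<and> sat M [] (env b a \<rho>') \<psi>"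
proof -
  define S :: "((nat + 'j \<times> nat) + 'm) set" where "S = Inl ` Inl ` {..<m}"
  have "finite S" by (simp add: S_def)
  obtain \<chi> where \<chi>: "\<chi> \<in> formulas L (vars m J d C - S)"
    "\<And>e. sat M [] e \<chi> \<longleftrightarrow> (\<exists>e'. (\<forall>v. v \<notin> S \<longrightarrow> e' v = e v) \<and> e' ` S \<subseteq> univ M \<and> sat M [] e' \<psi>)"
    by (rule ex_formula[OF \<open>finite S\<close> \<psi>, of M]) blast
  have iff: "(\<exists>b. b ` {..<m} \<subseteq> univ M \<and> sat M [] (env b a \<rho>) \<psi>) \<longleftrightarrow> sat M [] (env c a \<rho>) \<chi>" for \<rho> c
  proof
    assume "\<exists>b. b ` {..<m} \<subseteq> univ M \<and> sat M [] (env b a \<rho>) \<psi>"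
    then obtain b where b: "b ` {..<m} \<subseteq> univ M" "sat M [] (env b a \<rho>) \<psi>" by blast
    define b' where "b' i = (if i < m then b i else c i)" for i
    have "sat M [] (env b a \<rho>) \<psi> = sat M [] (env b' a \<rho>) \<psi>"
      by (rule env_cong_formulas[OF \<psi>]) (auto simp: b'_def)
    moreover have "env b' a \<rho> v = env c a \<rho> v" if "v \<notin> S" for v
      using that by (auto simp: env_def S_def b'_def split: sum.splits)
    moreover have "env b' a \<rho> ` S \<subseteq> univ M" using b(1) by (auto simp: S_def b'_def)
    ultimately show "sat M [] (env c a \<rho>) \<chi>" unfolding \<chi>(2) using b(2) by blast
  next
    assume "sat M [] (env c a \<rho>) \<chi>"
    then obtain e' where e': "\<forall>v. v \<notin> S \<longrightarrow> e' v = env c a \<rho> v" "e' ` S \<subseteq> univ M" "sat M [] e' \<psi>"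
      unfolding \<chi>(2) by blast
    define b where "b i = e' (Inl (Inl i))" for i
    have "b ` {..<m} \<subseteq> univ M" using e'(2) by (auto simp: b_def S_def)
    moreover have "e' v = env b a \<rho> v" if "v \<in> vars m J d C" for v
      using spec[OF e'(1), of v] that by (auto simp: b_def S_def)
    then have "sat M [] e' \<psi> = sat M [] (env b a \<rho>) \<psi>" by (rule sat_formulas_cong[OF \<psi>])
    ultimately show "\<exists>b. b ` {..<m} \<subseteq> univ M \<and> sat M [] (env b a \<rho>) \<psi>" using e'(3) by blast
  qed
  obtain n and u :: "nat \<Rightarrow> 'j" where u: "bij_betw u {..<n} J"
    using ex_bij_betw_nat_finite[OF fin] by (auto simp: atLeast0LessThan)
  define ui where "ui = inv_into {..<n} u"
  have ui: "ui j < n" "u (ui j) = j" if "j \<in> J" for j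
    using that u inv_into_into[of j u "{..<n}"] f_inv_into_f[of j u "{..<n}"] unfolding ui_def bij_betw_def by auto
  have uJ: "u s \<in> J" if "s < n" for s using u that unfolding bij_betw_def by blast
  define g :: "(nat + 'j \<times> nat) + 'm \<Rightarrow> nat \<times> nat + 'm" where
    "g = case_sum (case_sum (\<lambda>i. Inl (0, i)) (\<lambda>(j, i). Inl (ui j, i))) Inr"
  have g: "map_fm id id g \<chi> \<in> formulas L (({..<n} \<times> {..<d}) <+> C)"
    by (rule map_in_formulas[OF \<chi>(1)]) (use ui in \<open>auto simp: g_def S_def\<close>)
  have trans: "sat M [] (case_sum (\<lambda>(s, i). a (\<rho> (u s)) i) id) (map_fm id id g \<chi>) = sat M [] (env c a \<rho>) \<chi>" for \<rho> c
    unfolding sat_map by (rule sat_formulas_cong[OF \<chi>(1)]) (use ui in \<open>auto simp: g_def S_def\<close>)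
  have im: "(\<lambda>s. \<rho> (u s)) ` {..<n} \<subseteq> tr" "(\<lambda>s. \<rho>' (u s)) ` {..<n} \<subseteq> tr" using \<rho> uJ by auto
  have "dsim {..<n} (\<lambda>s. \<rho> (u s)) (\<lambda>s. \<rho>' (u s))" by (rule dsim_reindex[OF \<rho>(3)]) (use uJ in auto)
  then have "sim0 \<kappa> {..<n} (\<lambda>s. \<rho> (u s)) (\<lambda>s. \<rho>' (u s))" using sim0_iff[OF im] by simp
  then have "tp L M C ({..<n} \<times> {..<d}) (\<lambda>(s, i). a (\<rho> (u s)) i) = tp L M C ({..<n} \<times> {..<d}) (\<lambda>(s, i). a (\<rho>' (u s)) i)"
    using si im unfolding strongly_indiscernible_def by blast
  then have "sat M [] (case_sum (\<lambda>(s, i). a (\<rho> (u s)) i) id) (map_fm id id g \<chi>) =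
      sat M [] (case_sum (\<lambda>(s, i). a (\<rho>' (u s)) i) id) (map_fm id id g \<chi>)"
    using g unfolding tp_def by blast
  then show ?thesis using ex unfolding iff[of _ undefined] trans[of _ undefined] by simp
qed

lemma strong_transfer:
  fixes M :: "('f, 'p, 'm) struct"
  assumes si: "strongly_indiscernible L M \<kappa> d C a" and ne: "univ M \<noteq> {}" and fin: "finite J"
    and \<rho>: "\<rho> ` J \<subseteq> tr" "\<rho>' ` J \<subseteq> tr" "dsim J \<rho> \<rho>'"
    and \<Psi>: "finite \<Psi>" "\<Psi> \<subseteq> formulas L (vars m J d C)"
    and ex: "b ` {..<m} \<subseteq> univ M" "\<forall>\<psi>\<in>\<Psi>. sat M [] (env b a \<rho>) \<psi>"
  obtains b' where "b' ` {..<m} \<subseteq> univ M" "\<forall>\<psi>\<in>\<Psi>. sat M [] (env b' a \<rho>') \<psi>"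
proof -
  obtain \<psi> where \<psi>: "\<psi> \<in> formulas L (vars m J d C)" "\<And>e. sat M [] e \<psi> \<longleftrightarrow> (\<forall>\<phi>\<in>\<Psi>. sat M [] e \<phi>)"
    by (rule conj_formula[OF \<Psi> ne]) blast
  have "\<exists>b. b ` {..<m} \<subseteq> univ M \<and> sat M [] (env b a \<rho>) \<psi>" using ex \<psi>(2) by blast
  from strong_transfer1[OF si fin \<rho> \<psi>(1) this] show ?thesis using that \<psi>(2) by blast
qed

text \<open>In contrast to \<open>strong_transfer1\<close> the tuple \<open>b\<close> is kept,
  because its coordinates can serve as parameters over which the antichain is indiscernible.\<close>

lemma delta_transfer:
  fixes M :: "('f, 'p, 'm) struct" and J :: "'j set"
  assumes di: "delta_indiscernible L M \<kappa> d (b ` {..<m} \<union> C) X a" and X: "X \<subseteq> tr" and fin: "finite J"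
    and \<rho>: "\<rho> ` J \<subseteq> X" "\<rho>' ` J \<subseteq> X" "dsim J \<rho> \<rho>'"
    and \<psi>: "\<psi> \<in> formulas L (vars m J d C)"
  shows "sat M [] (env b a \<rho>) \<psi> = sat M [] (env b a \<rho>') \<psi>"
proof -
  obtain n and u :: "nat \<Rightarrow> 'j" where u: "bij_betw u {..<n} J"
    using ex_bij_betw_nat_finite[OF fin] by (auto simp: atLeast0LessThan)
  define ui where "ui = inv_into {..<n} u"
  have ui: "ui j < n" "u (ui j) = j" if "j \<in> J" for j
    using that u inv_into_into[of j u "{..<n}"] f_inv_into_f[of j u "{..<n}"] unfolding ui_def bij_betw_def by auto
  have uJ: "u s \<in> J" if "s < n" for s using u that unfolding bij_betw_def by blast
  define g :: "(nat + 'j \<times> nat) + 'm \<Rightarrow> nat \<times> nat + 'm" where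
    "g = case_sum (case_sum (\<lambda>i. Inr (b i)) (\<lambda>(j, i). Inl (ui j, i))) Inr"
  have g: "map_fm id id g \<psi> \<in> formulas L (({..<n} \<times> {..<d}) <+> (b ` {..<m} \<union> C))"
    by (rule map_in_formulas[OF \<psi>]) (use ui in \<open>auto simp: g_def\<close>)
  have trans: "sat M [] (case_sum (\<lambda>(s, i). a (\<rho> (u s)) i) id) (map_fm id id g \<psi>) = sat M [] (env b a \<rho>) \<psi>" for \<rho>
    unfolding sat_map by (rule sat_formulas_cong[OF \<psi>]) (use ui in \<open>auto simp: g_def\<close>)
  have im: "(\<lambda>s. \<rho> (u s)) ` {..<n} \<subseteq> X" "(\<lambda>s. \<rho>' (u s)) ` {..<n} \<subseteq> X" using \<rho> uJ by auto
  have "dsim {..<n} (\<lambda>s. \<rho> (u s)) (\<lambda>s. \<rho>' (u s))" by (rule dsim_reindex[OF \<rho>(3)]) (use uJ in auto)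
  then have "sim_delta \<kappa> X {..<n} (\<lambda>s. \<rho> (u s)) (\<lambda>s. \<rho>' (u s))"
    using sim_delta_iff[of "\<lambda>s. \<rho> (u s)" "{..<n}" "\<lambda>s. \<rho>' (u s)" X] im X by auto
  then have "tp L M (b ` {..<m} \<union> C) ({..<n} \<times> {..<d}) (\<lambda>(s, i). a (\<rho> (u s)) i) =
      tp L M (b ` {..<m} \<union> C) ({..<n} \<times> {..<d}) (\<lambda>(s, i). a (\<rho>' (u s)) i)"
    using di im unfolding delta_indiscernible_def by blast
  then have "sat M [] (case_sum (\<lambda>(s, i). a (\<rho> (u s)) i) id) (map_fm id id g \<psi>) =
      sat M [] (case_sum (\<lambda>(s, i). a (\<rho>' (u s)) i) id) (map_fm id id g \<psi>)"
    using g unfolding tp_def by blast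
  then show ?thesis unfolding trans .
qed

lemma universal_embed:
  assumes "universal_antichain \<kappa> X" "antichain \<kappa> Y" "finite Y"
  obtains h where "h ` Y \<subseteq> X" "dsim Y (\<lambda>y. y) h"
proof -
  obtain h where h: "h ` Y \<subseteq> X" "sim0 \<kappa> Y id h" using assms unfolding universal_antichain_def by blast
  have "X \<subseteq> tr" "Y \<subseteq> tr" using assms unfolding universal_antichain_def antichain_def by auto
  then have "dsim Y id h" using sim0_iff[of id Y h] h by auto
  then show ?thesis using that h(1) by (simp add: id_def)
qed

text \<open>Otherwise \<open>\<psi>\<close>, with the finite set \<open>C\<close> absorbed into its
  parameter tuple, witnesses ATP along \<open>place\<close>. Truth is transferred in two directions:
  from embedded copies inside \<open>X\<close> to an antichain of copies, and from a comparable pair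
  of copies to the one pair excluded by assumption.\<close>

lemma tree_property:
  fixes M :: "('f, 'p, 'm) struct" and \<sigma> :: "'i \<Rightarrow> 'k seq"
  assumes ne: "univ M \<noteq> {}" and C: "finite C" "C \<subseteq> univ M" and b: "b ` {..<m} \<subseteq> univ M"
    and a: "\<And>\<eta> i. \<eta> \<in> tr \<Longrightarrow> i < d \<Longrightarrow> a \<eta> i \<in> univ M"
    and si: "strongly_indiscernible L M \<kappa> d C a"
    and X: "universal_antichain \<kappa> X" and di: "delta_indiscernible L M \<kappa> d (b ` {..<m} \<union> C) X a"
    and \<sigma>: "\<sigma> ` U \<subseteq> tr" "antichain \<kappa> (\<sigma> ` U)" "t0 \<in> U" and fin: "finite U"
    and \<rho>: "\<rho> ` U \<subseteq> X" "dsim U \<rho> \<sigma>"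
    and \<psi>: "\<psi> \<in> formulas L (vars m U d C)" "sat M [] (env b a \<rho>) \<psi>"
    and bad: "\<not> (\<exists>k \<phi>. witnesses_ATP L M m k \<phi>)"
  obtains b' where "b' ` {..<m} \<subseteq> univ M" "sat M [] (env b' a \<sigma>) \<psi>"
    "sat M [] (env b' a (\<lambda>t. ext (branch (\<sigma> t0) False) (\<sigma> t))) \<psi>"
proof (rule ccontr)
  assume nt: "\<not> thesis"
  note concl = that
  have no: False if "b' ` {..<m} \<subseteq> univ M" "sat M [] (env b' a \<sigma>) \<psi>"
    "sat M [] (env b' a (\<lambda>t. ext (branch (\<sigma> t0) False) (\<sigma> t))) \<psi>" for b'
    using concl[OF that] nt by blast
  let ?pl = "place (\<sigma> t0) \<sigma>"
  have plt: "?pl \<eta> t \<in> tr" if "t \<in> U" for \<eta> t using place_tree[OF \<sigma> that] .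
  have Xt: "X \<subseteq> tr" using X unfolding universal_antichain_def antichain_def by blast
  \<comment> \<open>One place in the parameter tuple for each coordinate over \<open>U\<close> and
    for each element of \<open>C\<close>; \<open>g\<close> numbers these places.\<close>
  let ?P = "(U \<times> {..<d}) <+> C"
  have "finite ?P" using fin C(1) by simp
  from ex_bij_betw_finite_nat[OF this] obtain g where "bij_betw g ?P {0..<card ?P}" ..
  then obtain k where g: "bij_betw g ?P {..<k}" unfolding atLeast0LessThan by blast
  define h where "h = inv_into ?P g"
  have h: "h (g v) = v" "g v < k" if "v \<in> ?P" for v
    using that g unfolding h_def bij_betw_def by auto
  have h': "t \<in> U \<Longrightarrow> i < d \<Longrightarrow> h (g (Inl (t, i))) = Inl (t, i)" "t \<in> U \<Longrightarrow> i < d \<Longrightarrow> g (Inl (t, i)) < k"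
    "x \<in> C \<Longrightarrow> h (g (Inr x)) = Inr x" "x \<in> C \<Longrightarrow> g (Inr x) < k" for t i x
    using h[of "Inl (t, i)"] h[of "Inr x"] by auto
  have hk: "h s \<in> ?P" if "s < k" for s
    unfolding h_def by (rule inv_into_into) (use g that in \<open>auto simp: bij_betw_def\<close>)
  define r :: "(nat + 'i \<times> nat) + 'm \<Rightarrow> nat + nat" where "r = case_sum (case_sum Inl (\<lambda>z. Inr (g (Inl z)))) (\<lambda>c. Inr (g (Inr c)))"
  define \<phi> where "\<phi> = map_fm id id r \<psi>"
  define c where "c \<eta> s = case_sum (\<lambda>(t, i). a (?pl \<eta> t) i) id (h s)" for \<eta> s
  have \<phi>: "\<phi> \<in> formulas L ({..<m} <+> {..<k})"
    unfolding \<phi>_def by (rule map_in_formulas[OF \<psi>(1)]) (use h' in \<open>auto simp: r_def\<close>)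
  have inst: "sat M [] (case_sum b' id) (inst \<phi> (c \<eta>)) = sat M [] (env b' a (?pl \<eta>)) \<psi>" for b' \<eta>
    unfolding inst_def \<phi>_def sat_map
    by (rule sat_formulas_cong[OF \<psi>(1)]) (use h' in \<open>auto simp: r_def c_def\<close>)
  have "witnesses_ATP L M m k \<phi>" unfolding witnesses_ATP_def
  proof (intro conjI exI[of _ c] allI impI \<phi>)
    fix \<eta>
    show "c \<eta> ` {..<k} \<subseteq> univ M"
    proof (rule image_subsetI)
      fix s assume "s \<in> {..<k}"
      then have "h s \<in> ?P" using hk by simp
      then show "c \<eta> s \<in> univ M" using a plt C(2) by (auto simp: c_def)
    qed
  next
    fix A :: "bool list set"
    assume A: "\<forall>\<eta>\<in>A. \<forall>\<nu>\<in>A. \<eta> \<noteq> \<nu> \<longrightarrow> \<not> prefix \<eta> \<nu>"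
    show "consistent M m {inst \<phi> (c \<eta>) |\<eta>. \<eta> \<in> A}" unfolding consistent_def
    proof (intro allI impI)
      fix \<Sigma>0 assume S: "\<Sigma>0 \<subseteq> {inst \<phi> (c \<eta>) |\<eta>. \<eta> \<in> A}" "finite \<Sigma>0"
      then have "\<Sigma>0 \<subseteq> (\<lambda>\<eta>. inst \<phi> (c \<eta>)) ` A" by auto
      then obtain B where B: "B \<subseteq> A" "finite B" "\<Sigma>0 = (\<lambda>\<eta>. inst \<phi> (c \<eta>)) ` B"
        using finite_subset_image[OF S(2)] by blast
      let ?Y = "(\<lambda>(\<eta>, t). ?pl \<eta> t) ` (B \<times> U)"
      have "\<forall>\<eta>\<in>B. \<forall>\<nu>\<in>B. \<eta> \<noteq> \<nu> \<longrightarrow> \<not> prefix \<eta> \<nu>" using A B(1) by blast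
      then have "antichain \<kappa> ?Y" by (rule place_antichain[OF \<sigma>])
      moreover have "finite ?Y" using B(2) fin by simp
      \<comment> \<open>Inside \<open>X\<close> the single tuple \<open>b\<close> satisfies
        \<open>\<psi>\<close> on every embedded copy, by delta-indiscernibility. Strong
        indiscernibility then moves the whole finite set of formulas to the copies themselves, with
        a new tuple.\<close>
      ultimately obtain e where e: "e ` ?Y \<subseteq> X" "dsim ?Y (\<lambda>y. y) e" by (rule universal_embed[OF X])
      let ?\<rho>1 = "\<lambda>(\<eta>, t). e (?pl \<eta> t)" and ?\<rho>2 = "\<lambda>(\<eta>, t). ?pl \<eta> t"
      have d12: "dsim (B \<times> U) ?\<rho>2 ?\<rho>1"
        using dsim_reindex[OF e(2), of ?\<rho>2 "B \<times> U"] by (simp add: case_prod_unfold)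
      have eX: "e (?pl \<eta> t) \<in> X" if "\<eta> \<in> B" "t \<in> U" for \<eta> t using e(1) that by auto
      have \<psi>\<eta>: "sat M [] (env b a (\<lambda>t. e (?pl \<eta> t))) \<psi>" if "\<eta> \<in> B" for \<eta>
      proof -
        have "dsim U (\<lambda>t. ?pl \<eta> t) (\<lambda>t. e (?pl \<eta> t))"
          using dsim_reindex[OF d12, of "\<lambda>t. (\<eta>, t)" U] that by auto
        then have "dsim U \<rho> (\<lambda>t. e (?pl \<eta> t))"
          using dsim_trans[OF \<rho>(2) dsim_trans[OF dsim_sym[OF place_dsim[OF \<sigma>]]]] by blast
        from delta_transfer[OF di Xt fin \<rho>(1) _ this \<psi>(1)] show ?thesis using eX that \<psi>(2) by auto
      qed
      let ?\<Psi> = "(\<lambda>\<eta>. relabel (\<lambda>t. (\<eta>, t)) \<psi>) ` B"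
      have F: "finite ?\<Psi>" "?\<Psi> \<subseteq> formulas L (vars m (B \<times> U) d C)"
      proof -
        show "finite ?\<Psi>" using B(2) by simp
        have "relabel (\<lambda>t. (\<eta>, t)) \<psi> \<in> formulas L (vars m (B \<times> U) d C)" if "\<eta> \<in> B" for \<eta>
          by (rule relabel_formulas[OF \<psi>(1)]) (use that in auto)
        then show "?\<Psi> \<subseteq> formulas L (vars m (B \<times> U) d C)" by blast
      qed
      have t12: "?\<rho>1 ` (B \<times> U) \<subseteq> tr" "?\<rho>2 ` (B \<times> U) \<subseteq> tr" using eX Xt plt by auto
      have "\<forall>\<chi>\<in>?\<Psi>. sat M [] (env b a ?\<rho>1) \<chi>" using \<psi>\<eta> by (simp add: sat_relabel)
      then obtain b' where b': "b' ` {..<m} \<subseteq> univ M" "\<forall>\<chi>\<in>?\<Psi>. sat M [] (env b' a ?\<rho>2) \<chi>"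
        by (rule strong_transfer[OF si ne finite_cartesian_product[OF B(2) fin] t12 dsim_sym[OF d12] F b])
      have "\<forall>\<chi>\<in>\<Sigma>0. sat M [] (case_sum b' id) \<chi>" using b'(2) unfolding B(3) by (simp add: inst sat_relabel)
      then show "\<exists>b. b ` {..<m} \<subseteq> univ M \<and> (\<forall>\<phi>\<in>\<Sigma>0. sat M [] (case_sum b id) \<phi>)" using b'(1) by blast
    qed
  next
    fix \<eta> \<nu> :: "bool list"
    assume pr: "prefix \<eta> \<nu> \<and> \<eta> \<noteq> \<nu>"
    show "\<not> consistent M m {inst \<phi> (c \<eta>), inst \<phi> (c \<nu>)}"
    proof
      assume "consistent M m {inst \<phi> (c \<eta>), inst \<phi> (c \<nu>)}"
      then obtain b1 where b1: "b1 ` {..<m} \<subseteq> univ M" "sat M [] (env b1 a (?pl \<eta>)) \<psi>" "sat M [] (env b1 a (?pl \<nu>)) \<psi>"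
        unfolding consistent_def inst[symmetric] by (metis finite.emptyI finite_insert insertCI subset_refl)
      let ?\<Psi> = "{relabel Inl \<psi>, relabel Inr \<psi>}"
      let ?\<rho>1 = "case_sum (?pl \<eta>) (?pl \<nu>)" and ?\<rho>2 = "case_sum \<sigma> (\<lambda>t. ext (branch (\<sigma> t0) False) (\<sigma> t))"
      have F: "finite ?\<Psi>" "?\<Psi> \<subseteq> formulas L (vars m (U <+> U) d C)"
        using relabel_formulas[OF \<psi>(1), of Inl "U <+> U"] relabel_formulas[OF \<psi>(1), of Inr "U <+> U"] by auto
      have st: "\<sigma> t0 \<in> tr" using \<sigma> by blast
      have t: "?\<rho>1 ` (U <+> U) \<subseteq> tr" using plt by auto
      have t': "?\<rho>2 ` (U <+> U) \<subseteq> tr" using \<sigma>(1) ext_tree[OF branch(1)[OF st]] by auto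
      have "\<forall>\<chi>\<in>?\<Psi>. sat M [] (env b1 a ?\<rho>1) \<chi>" using b1 by (simp add: sat_relabel)
      then obtain b' where "b' ` {..<m} \<subseteq> univ M" "\<forall>\<chi>\<in>?\<Psi>. sat M [] (env b' a ?\<rho>2) \<chi>"
        by (rule strong_transfer[OF si ne finite_Plus[OF fin fin] t t' place_pair[OF \<sigma> conjunct1[OF pr] conjunct2[OF pr]] F b1(1)])
      then show False using no[of b'] by (simp add: sat_relabel)
    qed
  qed
  then show False using bad by blast
qed

end

section \<open>Extending a collapsible family\<close>

lemma antichain_subset: "antichain \<kappa> X \<Longrightarrow> Y \<subseteq> X \<Longrightarrow> antichain \<kappa> Y"
  unfolding antichain_def by (simp add: subset_iff)

text \<open>\<open>\<rho>\<close> is the antichain that is indiscernible over \<open>b\<close>, and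
  \<open>\<tau>\<close> the one that is to become the new member; \<open>\<Psi>\<close> is a finite
  part of the type of \<open>b\<close>, and \<open>F\<close> contains the indices it mentions.
  Keeping \<open>t0\<close> in \<open>F\<close> puts the point under the shifted tree among the
  parameters.\<close>

locale collapse_step = card_tree \<kappa> for \<kappa> :: "'k rel" +
  fixes L :: "('f, 'p) lang" and M :: "('f, 'p, 'm) struct" and C :: "'m set" and m d :: nat
    and b :: "nat \<Rightarrow> 'm" and a :: "'k seq \<Rightarrow> nat \<Rightarrow> 'm" and I :: "'i set" and \<rho> \<tau> :: "'i \<Rightarrow> 'k seq"
    and t0 :: 'i and F :: "'i set" and \<Psi> :: "('f, 'p, (nat + 'i \<times> nat) + 'm) fm set"
  assumes ne: "univ M \<noteq> {}" and C: "finite C" "C \<subseteq> univ M" and b: "b ` {..<m} \<subseteq> univ M"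
    and a: "\<eta> \<in> tr \<Longrightarrow> i < d \<Longrightarrow> a \<eta> i \<in> univ M"
    and si: "strongly_indiscernible L M \<kappa> d C a"
    and \<rho>: "universal_antichain \<kappa> (\<rho> ` I)"
    and di: "delta_indiscernible L M \<kappa> d (b ` {..<m} \<union> C) (\<rho> ` I) a"
    and \<tau>: "universal_antichain \<kappa> (\<tau> ` I)" "inj_on \<tau> I" and \<rho>\<tau>: "dsim I \<rho> \<tau>"
    and F: "finite F" "F \<subseteq> I" "t0 \<in> F"
    and \<Psi>: "finite \<Psi>" "\<Psi> \<subseteq> formulas L (vars m F d C)" "\<psi> \<in> \<Psi> \<Longrightarrow> sat M [] (env b a \<rho>) \<psi>"
    and bad: "\<not> (\<exists>k \<phi>. witnesses_ATP L M m k \<phi>)"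
begin

abbreviation E :: "'k seq \<Rightarrow> 'k seq" where "E \<equiv> ext (branch (\<tau> t0) False)"

definition C' :: "'m set" where "C' = C \<union> (\<lambda>(t, i). a (\<tau> t) i) ` (F \<times> {..<d})"

lemma \<rho>_tr: "\<rho> ` I \<subseteq> tr" and \<tau>_tr: "\<tau> ` I \<subseteq> tr"
  using \<rho> \<tau> unfolding universal_antichain_def antichain_def by blast+

lemma \<tau>_in [simp]: "t \<in> I \<Longrightarrow> \<tau> t \<in> tr"
  using \<tau>_tr by blast

lemma t0_tr: "\<tau> t0 \<in> tr"
  using F \<tau>_tr by blast

lemma E_tree: "x \<in> tr \<Longrightarrow> E x \<in> tr"
  by (rule ext_tree[OF branch(1)[OF t0_tr]])

lemma \<tau>_antichain: "W \<subseteq> I \<Longrightarrow> antichain \<kappa> (\<tau> ` W)"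
proof -
  assume "W \<subseteq> I"
  then have "\<tau> ` W \<subseteq> \<tau> ` I" by (rule image_mono)
  moreover have "antichain \<kappa> (\<tau> ` I)" using \<tau>(1) unfolding universal_antichain_def by (rule conjunct1)
  ultimately show ?thesis using antichain_subset by metis
qed

lemma C'_univ: "C' \<subseteq> univ M"
proof -
  have "a (\<tau> t) i \<in> univ M" if "t \<in> F" "i < d" for t i using a \<tau>_in that F(2) by blast
  then show ?thesis using C(2) unfolding C'_def by auto
qed

lemma dsim_above:
  assumes "\<alpha> ` V \<subseteq> tr" "\<beta> ` V \<subseteq> tr" "dsim V \<alpha> \<beta>"
  shows "dsim (F <+> V) (case_sum \<tau> (\<lambda>v. E (\<alpha> v))) (case_sum \<tau> (\<lambda>v. E (\<beta> v)))"
proof (rule dsim_comb[OF _ \<tau>_antichain[OF F(2)] F(3) branch[OF t0_tr] branch[OF t0_tr] assms])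
  show "\<tau> ` F \<subseteq> tr" using \<tau>_tr F(2) by blast
qed

text \<open>A parameter of \<open>C'\<close> outside \<open>C\<close> is named by a coordinate over
  \<open>\<tau>\<close>, chosen arbitrarily if there are several. Thus \<open>lift\<close> turns a
  formula over \<open>C'\<close> into one over \<open>C\<close> that also speaks of
  \<open>\<tau>\<close> on \<open>F\<close>, where strong indiscernibility over \<open>C\<close>
  applies.\<close>

definition par :: "'m \<Rightarrow> (nat + ('i + 'j) \<times> nat) + 'm" where
  "par c = (if c \<in> C then Inr c
    else let z = SOME z. z \<in> F \<times> {..<d} \<and> a (\<tau> (fst z)) (snd z) = c in Inl (Inr (Inl (fst z), snd z)))"

lemma par:
  assumes "c \<in> C'"
  shows "par c \<in> vars m (F <+> J) d C" "env b' a (case_sum \<tau> \<beta>) (par c) = c"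
proof -
  consider "c \<in> C" | z where "c \<notin> C" "z \<in> F \<times> {..<d}" "a (\<tau> (fst z)) (snd z) = c"
    using assms unfolding C'_def by force
  then have "par c \<in> vars m (F <+> J) d C \<and> env b' a (case_sum \<tau> \<beta>) (par c) = c"
  proof cases
    case (2 z)
    let ?z = "SOME z. z \<in> F \<times> {..<d} \<and> a (\<tau> (fst z)) (snd z) = c"
    have "?z \<in> F \<times> {..<d} \<and> a (\<tau> (fst ?z)) (snd ?z) = c" by (rule someI[of _ z]) (use 2 in simp)
    then show ?thesis using 2(1) by (auto simp: par_def Let_def mem_Times_iff)
  qed (auto simp: par_def)
  then show "par c \<in> vars m (F <+> J) d C" "env b' a (case_sum \<tau> \<beta>) (par c) = c" by simp_all
qed

definition lift :: "('n \<Rightarrow> 'j) \<Rightarrow> ('f, 'p, (nat + 'n \<times> nat) + 'm) fm \<Rightarrow> ('f, 'p, (nat + ('i + 'j) \<times> nat) + 'm) fm" where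
  "lift v = map_fm id id (case_sum (case_sum (\<lambda>i. Inl (Inl i)) (\<lambda>(s, i). Inl (Inr (Inr (v s), i)))) par)"

lemma lift_formulas:
  assumes "\<theta> \<in> formulas L (vars n K d C')" "v ` K \<subseteq> J"
  shows "lift v \<theta> \<in> formulas L (vars n (F <+> J) d C)"
  unfolding lift_def
proof (rule map_in_formulas[OF assms(1)], rule image_subsetI)
  fix x assume "x \<in> vars n K d C' \<inter> fm_vars \<theta>"
  then have "x \<in> vars n K d C'" by simp
  moreover have "par c \<in> vars n (F <+> J) d C" if "c \<in> C'" for c
    using par(1)[OF that, of J] by (auto simp: par_def Let_def split: if_splits)
  ultimately show "case_sum (case_sum (\<lambda>i. Inl (Inl i)) (\<lambda>(s, i). Inl (Inr (Inr (v s), i)))) par x \<in> vars n (F <+> J) d C"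
    using assms(2) by auto
qed

lemma sat_lift:
  assumes "\<theta> \<in> formulas L (vars n K d C')"
  shows "sat M [] (env b' a (case_sum \<tau> \<beta>)) (lift v \<theta>) = sat M [] (env b' a (\<lambda>s. \<beta> (v s))) \<theta>"
  unfolding lift_def sat_map by (rule sat_formulas_cong[OF assms]) (auto simp: par(2))

text \<open>Lifting trades the parameters from \<open>\<tau>\<close> for indices, and by
  \<open>dsim_above\<close> the type of these indices together with a shifted tuple is determined by
  the type of the tuple. With no variables \<open>y\<close> present, \<open>strong_transfer1\<close>
  transfers plain truth.\<close>

lemma shifted_strongly_indiscernible: "strongly_indiscernible L M \<kappa> d C' (\<lambda>\<eta>. a (E \<eta>))"
  unfolding strongly_indiscernible_def
proof (intro allI impI, elim conjE)
  fix n and \<eta> \<nu> :: "nat \<Rightarrow> 'k seq"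
  assume t: "\<eta> ` {..<n} \<subseteq> tr" "\<nu> ` {..<n} \<subseteq> tr" and s: "sim0 \<kappa> {..<n} \<eta> \<nu>"
  have d: "dsim {..<n} \<eta> \<nu>" using s sim0_iff[OF t] by simp
  have imp: "sat M [] (case_sum (\<lambda>(s, i). a (E (\<nu> s)) i) id) \<phi>"
    if \<phi>: "\<phi> \<in> formulas L (({..<n} \<times> {..<d}) <+> C')" and sat: "sat M [] (case_sum (\<lambda>(s, i). a (E (\<eta> s)) i) id) \<phi>"
      and t: "\<eta> ` {..<n} \<subseteq> tr" "\<nu> ` {..<n} \<subseteq> tr" and d: "dsim {..<n} \<eta> \<nu>" for \<eta> \<nu> \<phi>
  proof -
    let ?\<theta> = "map_fm id id (map_sum Inr id) \<phi> :: ('f, 'p, (nat + nat \<times> nat) + 'm) fm"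
    have \<theta>: "?\<theta> \<in> formulas L (vars 0 {..<n} d C')" by (rule map_in_formulas[OF \<phi>]) auto
    have eq: "sat M [] (env c a (\<lambda>s. E (\<eta> s))) ?\<theta> = sat M [] (case_sum (\<lambda>(s, i). a (E (\<eta> s)) i) id) \<phi>" for c \<eta>
      unfolding sat_map by (rule sat_cong) (auto simp: env_def split: sum.splits)
    have tt: "case_sum \<tau> (\<lambda>s. E (\<eta> s)) ` (F <+> {..<n}) \<subseteq> tr" if "\<eta> ` {..<n} \<subseteq> tr" for \<eta> :: "nat \<Rightarrow> 'k seq"
      using that F(2) E_tree by auto
    have "sat M [] (env c a (case_sum \<tau> (\<lambda>s. E (\<eta> s)))) (lift (\<lambda>s. s) ?\<theta>)" for c
      using sat_lift[OF \<theta>, of c "\<lambda>s. E (\<eta> s)" "\<lambda>s. s"] sat eq by simp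
    then have "\<exists>c. c ` {..<0::nat} \<subseteq> univ M \<and> sat M [] (env c a (case_sum \<tau> (\<lambda>s. E (\<eta> s)))) (lift (\<lambda>s. s) ?\<theta>)" by simp
    from strong_transfer1[OF si _ tt[OF t(1)] tt[OF t(2)] dsim_above[OF t d] lift_formulas[OF \<theta>] this]
    obtain c where "sat M [] (env c a (case_sum \<tau> (\<lambda>s. E (\<nu> s)))) (lift (\<lambda>s. s) ?\<theta>)" using F(1) by auto
    then show ?thesis using sat_lift[OF \<theta>, of c "\<lambda>s. E (\<nu> s)" "\<lambda>s. s"] eq by simp
  qed
  show "tp L M C' ({..<n} \<times> {..<d}) (\<lambda>(s, i). a (E (\<eta> s)) i) = tp L M C' ({..<n} \<times> {..<d}) (\<lambda>(s, i). a (E (\<nu> s)) i)"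
    unfolding tp_def using imp[OF _ _ t d] imp[OF _ _ t(2,1) dsim_sym[OF d]] by blast
qed

definition idx :: "'k seq \<Rightarrow> 'i" where "idx = inv_into I \<tau>"

lemma idx: "y \<in> \<tau> ` I \<Longrightarrow> idx y \<in> I" "y \<in> \<tau> ` I \<Longrightarrow> \<tau> (idx y) = y"
  by (simp_all add: idx_def inv_into_into f_inv_into_f)

text \<open>The tree of copies of a finite part of the type gives a realization on a large finite
  antichain above \<open>\<tau> t0\<close>; Ramsey's theorem for antichains then makes a copy of the required
  finite part of that antichain indiscernible.\<close>

lemma finite_realization:
  assumes \<Psi>2: "finite \<Psi>2" "\<Psi>2 \<subseteq> formulas L (vars m I d C)" "\<forall>\<psi>\<in>\<Psi>2. sat M [] (env b a \<rho>) \<psi>"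
    and T: "finite T" "\<And>us us' \<theta>. (us, us', \<theta>) \<in> T \<Longrightarrow> set us \<subseteq> I \<and> set us' \<subseteq> I \<and> length us = length us' \<and>
      dsim {..<length us} (\<lambda>s. \<tau> (us ! s)) (\<lambda>s. \<tau> (us' ! s)) \<and> \<theta> \<in> formulas L (vars m {..<length us} d C')"
  obtains b' where "b' ` {..<m} \<subseteq> univ M" "\<forall>\<psi>\<in>\<Psi>. sat M [] (env b' a \<tau>) \<psi>"
    "\<forall>\<psi>\<in>\<Psi>2. sat M [] (env b' a (\<lambda>t. E (\<tau> t))) \<psi>"
    "\<forall>(us, us', \<theta>)\<in>T. sat M [] (env b' a (\<lambda>s. E (\<tau> (us ! s)))) \<theta> = sat M [] (env b' a (\<lambda>s. E (\<tau> (us' ! s)))) \<theta>"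
proof -
  define tv where "tv \<psi> = {t. \<exists>i. Inl (Inr (t, i)) \<in> fm_vars \<psi>}" for \<psi> :: "('f, 'p, (nat + 'i \<times> nat) + 'm) fm"
  have tv: "finite (tv \<psi>)" for \<psi>
  proof -
    have "tv \<psi> \<subseteq> (\<lambda>v. case v of Inl (Inr (t, i)) \<Rightarrow> t | _ \<Rightarrow> undefined) ` fm_vars \<psi>" by (force simp: tv_def)
    then show ?thesis using finite_fm_vars finite_subset by blast
  qed
  define W where "W = (\<Union>\<psi>\<in>\<Psi>2. tv \<psi>) \<union> (\<Union>(us, us', \<theta>)\<in>T. set us \<union> set us')"
  have W: "finite W" "W \<subseteq> I"
  proof -
    show "finite W" using \<Psi>2(1) T(1) tv by (auto simp: W_def)
    have "tv \<psi> \<subseteq> I" if "\<psi> \<in> \<Psi>2" for \<psi> using that \<Psi>2(2) by (fastforce simp: tv_def formulas_def)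
    then show "W \<subseteq> I" using T(2) by (fastforce simp: W_def)
  qed
  have \<Psi>2W: "\<psi> \<in> formulas L (vars m W d C)" if "\<psi> \<in> \<Psi>2" for \<psi>
  proof -
    have "fm_vars \<psi> \<subseteq> vars m I d C" "wf_fm L 0 \<psi>" using that \<Psi>2(2) by (auto simp: formulas_def)
    moreover have "t \<in> W" if "Inl (Inr (t, i)) \<in> fm_vars \<psi>" for t i using that \<open>\<psi> \<in> \<Psi>2\<close> by (auto simp: W_def tv_def)
    ultimately show ?thesis unfolding formulas_def by fastforce
  qed
  have TW: "set us \<subseteq> W" "set us' \<subseteq> W" if "(us, us', \<theta>) \<in> T" for us us' \<theta> using that by (auto simp: W_def)
  define n where "n = (\<Sum>z\<in>T. length (fst z))"
  have n: "length us \<le> n" if "(us, us', \<theta>) \<in> T" for us us' \<theta>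
    unfolding n_def using member_le_sum[OF that, of "\<lambda>z. length (fst z)"] T(1) by simp
  have fJ: "finite ((\<lambda>(us, us', \<theta>). \<theta>) ` T)" using T(1) by simp
  obtain Z where Z: "finite Z" "antichain \<kappa> Z" and
    R: "\<forall>Q :: ('f, 'p, (nat + nat \<times> nat) + 'm) fm \<Rightarrow> 'k seq list \<Rightarrow> bool. \<exists>f. f ` W \<subseteq> Z \<and> dsim W \<tau> f \<and>
    (\<forall>q\<in>(\<lambda>(us, us', \<theta>). \<theta>) ` T. \<forall>us us'. set us \<subseteq> W \<and> set us' \<subseteq> W \<and> length us = length us' \<and> length us \<le> n \<and>
      dsim {..<length us} (\<lambda>s. \<tau> (us ! s)) (\<lambda>s. \<tau> (us' ! s)) \<longrightarrow> Q q (map f us) = Q q (map f us'))"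
    using antichain_ramsey[OF fJ W(1) inj_on_subset[OF \<tau>(2) W(2)] \<tau>_antichain[OF W(2)], of n] by (elim exE conjE)
  obtain h where h: "h ` Z \<subseteq> \<tau> ` I" "dsim Z (\<lambda>y. y) h" by (rule universal_embed[OF \<tau>(1) Z(2,1)])
  have hI: "h z \<in> \<tau> ` I" if "z \<in> Z" for z using h(1) that by blast
  \<comment> \<open>Besides the indices \<open>F\<close> of the parameters, \<open>U\<close> holds a
    copy of the Ramsey antichain \<open>Z\<close>.\<close>
  define U where "U = F \<union> (\<lambda>z. idx (h z)) ` Z"
  have U: "finite U" "U \<subseteq> I" "t0 \<in> U" using F Z(1) idx(1)[OF hI] by (auto simp: U_def)
  define V where "V = {v \<in> W \<rightarrow>\<^sub>E U. dsim W \<tau> (\<lambda>t. \<tau> (v t))}"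
  have V: "finite V" unfolding V_def using finite_PiE[of W "\<lambda>_. U"] W(1) U(1) by simp
  have vU: "v ` W \<subseteq> U" if "v \<in> V" for v using that by (auto simp: V_def)
  \<comment> \<open>Which copy of \<open>W\<close> inside \<open>U\<close> will be homogeneous is
    known only after \<open>b2\<close> has been found, so \<open>\<Psi>2\<close> is demanded on all
    of the finitely many copies in advance. On \<open>\<rho>\<close> the tuple \<open>b\<close>
    satisfies all these demands, by delta-indiscernibility.\<close>
  define \<Phi> where "\<Phi> = \<Psi> \<union> (\<lambda>(v, \<psi>). relabel v \<psi>) ` (V \<times> \<Psi>2)"
  have \<Phi>: "finite \<Phi>" "\<Phi> \<subseteq> formulas L (vars m U d C)"
  proof -
    show "finite \<Phi>" using \<Psi>(1) V \<Psi>2(1) by (simp add: \<Phi>_def)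
    have "\<psi> \<in> formulas L (vars m U d C)" if "\<psi> \<in> \<Psi>" for \<psi>
      by (rule formulas_mono[of _ _ "vars m F d C"]) (use that \<Psi>(2) in \<open>auto simp: U_def\<close>)
    moreover have "relabel v \<psi> \<in> formulas L (vars m U d C)" if "v \<in> V" "\<psi> \<in> \<Psi>2" for v \<psi>
      by (rule relabel_formulas[OF \<Psi>2W[OF that(2)] vU[OF that(1)]])
    ultimately show "\<Phi> \<subseteq> formulas L (vars m U d C)" by (auto simp: \<Phi>_def)
  qed
  have sat\<Phi>: "sat M [] (env b a \<rho>) \<phi>" if "\<phi> \<in> \<Phi>" for \<phi>
  proof -
    have "sat M [] (env b a (\<lambda>t. \<rho> (v t))) \<psi>" if v: "v \<in> V" and \<psi>: "\<psi> \<in> \<Psi>2" for v \<psi>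
    proof -
      have vI: "v ` W \<subseteq> I" using vU[OF v] U(2) by blast
      have "dsim W \<tau> (\<lambda>t. \<tau> (v t))" using v by (simp add: V_def)
      moreover have "dsim W (\<lambda>t. \<tau> (v t)) (\<lambda>t. \<rho> (v t))" by (rule dsim_reindex[OF dsim_sym[OF \<rho>\<tau>] vI])
      ultimately have "dsim W \<rho> (\<lambda>t. \<rho> (v t))"
        using dsim_trans[OF dsim_mono[OF \<rho>\<tau> W(2)]] dsim_trans by blast
      from delta_transfer[OF di \<rho>_tr W(1) _ _ this \<Psi>2W[OF \<psi>]] show ?thesis
        using \<Psi>2(3) \<psi> W(2) vI by (auto simp: image_subset_iff)
    qed
    then show ?thesis using \<Psi>(3) that by (auto simp: \<Phi>_def sat_relabel)
  qed
  obtain \<psi>0 where \<psi>0: "\<psi>0 \<in> formulas L (vars m U d C)" "\<And>e. sat M [] e \<psi>0 \<longleftrightarrow> (\<forall>\<phi>\<in>\<Phi>. sat M [] e \<phi>)"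
    by (rule conj_formula[OF \<Phi> ne]) blast
  have s0: "sat M [] (env b a \<rho>) \<psi>0" using \<psi>0(2) sat\<Phi> by blast
  have \<tau>U: "\<tau> ` U \<subseteq> tr" "\<rho> ` U \<subseteq> \<rho> ` I" using \<tau>_tr U(2) by blast+
  obtain b2 where b2: "b2 ` {..<m} \<subseteq> univ M" "sat M [] (env b2 a \<tau>) \<psi>0" "sat M [] (env b2 a (\<lambda>t. E (\<tau> t))) \<psi>0"
    by (rule tree_property[OF ne C b a si \<rho> di \<tau>U(1) \<tau>_antichain[OF U(2)] U(3,1) \<tau>U(2) dsim_mono[OF \<rho>\<tau> U(2)] \<psi>0(1) s0 bad])
  \<comment> \<open>A list of points of \<open>Z\<close> is coloured by the truth of
    \<open>\<theta>\<close> for \<open>b2\<close> at its image in the shifted tree.\<close>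
  from spec[OF R, of "\<lambda>\<theta> zs. sat M [] (env b2 a (\<lambda>s. E (h (zs ! s)))) \<theta>"]
  obtain f where f: "f ` W \<subseteq> Z" "dsim W \<tau> f" and
    hom: "\<forall>q\<in>(\<lambda>(us, us', \<theta>). \<theta>) ` T. \<forall>us us'. set us \<subseteq> W \<and> set us' \<subseteq> W \<and> length us = length us' \<and> length us \<le> n \<and>
      dsim {..<length us} (\<lambda>s. \<tau> (us ! s)) (\<lambda>s. \<tau> (us' ! s)) \<longrightarrow>
      sat M [] (env b2 a (\<lambda>s. E (h (map f us ! s)))) q = sat M [] (env b2 a (\<lambda>s. E (h (map f us' ! s)))) q"
    by (elim exE conjE)
  define v where "v = (\<lambda>t\<in>W. idx (h (f t)))"
  have fZ: "f t \<in> Z" if "t \<in> W" for t using f(1) that by blast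
  have v\<tau>: "\<tau> (v t) = h (f t)" if "t \<in> W" for t using idx(2)[OF hI[OF fZ[OF that]]] that by (simp add: v_def)
  have dv: "dsim W \<tau> (\<lambda>t. \<tau> (v t))"
  proof -
    have "dsim W f (\<lambda>t. h (f t))" by (rule dsim_reindex[OF h(2) f(1)])
    then have "dsim W \<tau> (\<lambda>t. h (f t))" by (rule dsim_trans[OF f(2)])
    moreover have "dsim W \<tau> (\<lambda>t. h (f t)) = dsim W \<tau> (\<lambda>t. \<tau> (v t))" by (rule dsim_cong) (simp_all add: v\<tau>)
    ultimately show ?thesis by simp
  qed
  have vV: "v \<in> V" unfolding V_def using dv fZ by (auto simp: v_def U_def)
  have A1: "\<forall>\<psi>\<in>\<Psi>. sat M [] (env b2 a \<tau>) \<psi>" using b2(2) \<psi>0(2) by (auto simp: \<Phi>_def)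
  have A2: "sat M [] (env b2 a (\<lambda>t. E (\<tau> (v t)))) \<psi>" if "\<psi> \<in> \<Psi>2" for \<psi>
  proof -
    have "relabel v \<psi> \<in> \<Phi>" using vV that by (auto simp: \<Phi>_def)
    then have "sat M [] (env b2 a (\<lambda>t. E (\<tau> t))) (relabel v \<psi>)" using b2(3) \<psi>0(2) by blast
    then show ?thesis by (simp add: sat_relabel)
  qed
  have A3: "sat M [] (env b2 a (\<lambda>s. E (\<tau> (v (us ! s))))) \<theta> = sat M [] (env b2 a (\<lambda>s. E (\<tau> (v (us' ! s))))) \<theta>"
    if z: "(us, us', \<theta>) \<in> T" for us us' \<theta>
  proof -
    note t = T(2)[OF z]
    have "\<theta> \<in> (\<lambda>(us, us', \<theta>). \<theta>) ` T" using z by force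
    then have "sat M [] (env b2 a (\<lambda>s. E (h (map f us ! s)))) \<theta> = sat M [] (env b2 a (\<lambda>s. E (h (map f us' ! s)))) \<theta>"
      using hom t TW[OF z] n[OF z] by blast
    moreover have "sat M [] (env b2 a (\<lambda>s. E (h (map f us ! s)))) \<theta> = sat M [] (env b2 a (\<lambda>s. E (\<tau> (v (us ! s))))) \<theta>"
      if us: "length us = k" "set us \<subseteq> W" "\<theta> \<in> formulas L (vars m {..<k} d C')" for us k
    proof (rule env_cong_formulas[OF us(3)])
      fix s i assume s: "s \<in> {..<k}"
      then have "us ! s \<in> W" using us(1,2) nth_mem[of s us] by auto
      then show "a (E (h (map f us ! s))) i = a (E (\<tau> (v (us ! s)))) i" using v\<tau> s us(1) by simp
    qed simp
    ultimately show ?thesis using t TW[OF z] by metis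
  qed
  \<comment> \<open>What holds on the homogeneous copy \<open>v\<close> is moved to the original
    indices \<open>W\<close>. The antichain \<open>\<tau>\<close> on \<open>F\<close> is carried
    along unchanged, so that \<open>\<Psi>\<close> and the parameters from \<open>C'\<close>
    survive.\<close>
  let ?\<rho>1 = "case_sum \<tau> (\<lambda>t. E (\<tau> (v t)))" and ?\<rho>2 = "case_sum \<tau> (\<lambda>t. E (\<tau> t))"
  let ?\<Omega> = "relabel Inl ` \<Psi> \<union> relabel Inr ` \<Psi>2 \<union> (\<lambda>(us, us', \<theta>). iff_fm (lift ((!) us) \<theta>) (lift ((!) us') \<theta>)) ` T"
  have \<Omega>: "finite ?\<Omega>" "?\<Omega> \<subseteq> formulas L (vars m (F <+> W) d C)"
  proof -
    show "finite ?\<Omega>" using \<Psi>(1) \<Psi>2(1) T(1) by simp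
    have "relabel Inl \<psi> \<in> formulas L (vars m (F <+> W) d C)" if "\<psi> \<in> \<Psi>" for \<psi>
      by (rule relabel_formulas[of _ _ _ F]) (use that \<Psi>(2) in auto)
    moreover have "relabel Inr \<psi> \<in> formulas L (vars m (F <+> W) d C)" if "\<psi> \<in> \<Psi>2" for \<psi>
      by (rule relabel_formulas[OF \<Psi>2W[OF that]]) auto
    moreover have "iff_fm (lift ((!) us) \<theta>) (lift ((!) us') \<theta>) \<in> formulas L (vars m (F <+> W) d C)"
      if z: "(us, us', \<theta>) \<in> T" for us us' \<theta>
    proof -
      have \<theta>: "\<theta> \<in> formulas L (vars m {..<length us} d C')" and l: "length us = length us'" using T(2)[OF z] by blast+
      have "(!) us ` {..<length us} \<subseteq> W" "(!) us' ` {..<length us} \<subseteq> W" using TW[OF z] l nth_mem by auto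
      from lift_formulas[OF \<theta> this(1)] lift_formulas[OF \<theta> this(2)] show ?thesis by (simp only: iff_fm_formulas)
    qed
    ultimately show "?\<Omega> \<subseteq> formulas L (vars m (F <+> W) d C)" by auto
  qed
  have sat_iff: "sat M [] (env b' a (case_sum \<tau> \<beta>)) (iff_fm (lift ((!) us) \<theta>) (lift ((!) us') \<theta>)) \<longleftrightarrow>
    (sat M [] (env b' a (\<lambda>s. \<beta> (us ! s))) \<theta> \<longleftrightarrow> sat M [] (env b' a (\<lambda>s. \<beta> (us' ! s))) \<theta>)"
    if z: "(us, us', \<theta>) \<in> T" for us us' \<theta> b' \<beta>
  proof -
    have \<theta>: "\<theta> \<in> formulas L (vars m {..<length us} d C')" using T(2)[OF z] by blast
    show ?thesis unfolding sat_iff_fm sat_lift[OF \<theta>] ..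
  qed
  have tr1: "(\<lambda>t. \<tau> (v t)) ` W \<subseteq> tr" "\<tau> ` W \<subseteq> tr"
  proof -
    show "\<tau> ` W \<subseteq> tr" using W(2) \<tau>_tr by blast
    show "(\<lambda>t. \<tau> (v t)) ` W \<subseteq> tr" using vU[OF vV] U(2) \<tau>_tr by blast
  qed
  have tr2: "?\<rho>1 ` (F <+> W) \<subseteq> tr" "?\<rho>2 ` (F <+> W) \<subseteq> tr" using tr1 F(2) E_tree by auto
  have "\<forall>\<psi>\<in>?\<Omega>. sat M [] (env b2 a ?\<rho>1) \<psi>" using A1 A2 A3 sat_iff by (auto simp: sat_relabel)
  then obtain b' where b': "b' ` {..<m} \<subseteq> univ M" "\<forall>\<psi>\<in>?\<Omega>. sat M [] (env b' a ?\<rho>2) \<psi>"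
    by (rule strong_transfer[OF si ne finite_Plus[OF F(1) W(1)] tr2 dsim_above[OF tr1 dsim_sym[OF dv]] \<Omega> b2(1)])
  show ?thesis
  proof (rule that[OF b'(1)])
    show "\<forall>\<psi>\<in>\<Psi>. sat M [] (env b' a \<tau>) \<psi>"
    proof
      fix \<psi> assume "\<psi> \<in> \<Psi>"
      then have "sat M [] (env b' a ?\<rho>2) (relabel Inl \<psi>)" using b'(2) by blast
      then show "sat M [] (env b' a \<tau>) \<psi>" by (simp add: sat_relabel)
    qed
    show "\<forall>\<psi>\<in>\<Psi>2. sat M [] (env b' a (\<lambda>t. E (\<tau> t))) \<psi>"
    proof
      fix \<psi> assume "\<psi> \<in> \<Psi>2"
      then have "sat M [] (env b' a ?\<rho>2) (relabel Inr \<psi>)" using b'(2) by blast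
      then show "sat M [] (env b' a (\<lambda>t. E (\<tau> t))) \<psi>" by (simp add: sat_relabel)
    qed
    have "sat M [] (env b' a (\<lambda>s. E (\<tau> (us ! s)))) \<theta> = sat M [] (env b' a (\<lambda>s. E (\<tau> (us' ! s)))) \<theta>"
      if z: "(us, us', \<theta>) \<in> T" for us us' \<theta>
    proof -
      have "iff_fm (lift ((!) us) \<theta>) (lift ((!) us') \<theta>) \<in> ?\<Omega>" using z by force
      then show ?thesis using b'(2) sat_iff[OF z, of b' "\<lambda>t. E (\<tau> t)"] by blast
    qed
    then show "\<forall>(us, us', \<theta>)\<in>T. sat M [] (env b' a (\<lambda>s. E (\<tau> (us ! s)))) \<theta> = sat M [] (env b' a (\<lambda>s. E (\<tau> (us' ! s)))) \<theta>"
      by blast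
  qed
qed

text \<open>Indiscernibility over the unknown tuple is a set \<open>G3\<close> of equivalences in
  the variables \<open>y\<close>, so it can be part of the type to be realized. Each finite part of
  this type is covered by \<open>finite_realization\<close>, and saturation does the rest.\<close>

lemma full_realization:
  assumes sat: "saturated L \<mu> M" and \<mu>: "Card_order \<mu>" "infinite (Field \<mu>)" and small: "|tr| <o \<mu>"
  obtains b' where "b' ` {..<m} \<subseteq> univ M" "\<forall>\<psi>\<in>\<Psi>. sat M [] (env b' a \<tau>) \<psi>"
    "\<forall>\<psi>\<in>joint_tp L M C m b d a I \<rho>. sat M [] (env b' a (\<lambda>t. E (\<tau> t))) \<psi>"
    "delta_indiscernible L M \<kappa> d (b' ` {..<m} \<union> C') (\<tau> ` I) (\<lambda>\<eta>. a (E \<eta>))"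
proof -
  define A where "A = C' \<union> (\<lambda>(t, i). a (E (\<tau> t)) i) ` (I \<times> {..<d})"
  have AC: "C' \<subseteq> A" "C \<subseteq> A" by (auto simp: A_def C'_def)
  have Aa: "a (E (\<tau> t)) i \<in> A" if "t \<in> I" "i < d" for t i using that by (force simp: A_def)
  have Aa': "a (\<tau> t) i \<in> A" if "t \<in> F" "i < d" for t i using that by (force simp: A_def C'_def)
  have Auniv: "A \<subseteq> univ M"
  proof -
    have "a (E (\<tau> t)) i \<in> univ M" if "t \<in> I" "i < d" for t i using a[OF E_tree[OF \<tau>_in[OF that(1)]] that(2)] .
    then show ?thesis using C'_univ unfolding A_def by auto
  qed
  \<comment> \<open>Apart from the finite set \<open>C\<close> all parameters are coordinates of the
    tree, whose size is below \<open>\<mu>\<close>.\<close>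
  have Asmall: "|A| <o \<mu>"
  proof -
    have "A \<subseteq> C \<union> (\<lambda>(\<eta>, i). a \<eta> i) ` (tr \<times> {..<d})" (is "_ \<subseteq> _ \<union> ?B")
    proof -
      have "a (E (\<tau> t)) i \<in> ?B" if "t \<in> I" "i < d" for t i
        by (rule image_eqI[of _ _ "(E (\<tau> t), i)"]) (use that E_tree \<tau>_in in auto)
      moreover have "a (\<tau> t) i \<in> ?B" if "t \<in> F" "i < d" for t i
        by (rule image_eqI[of _ _ "(\<tau> t, i)"]) (use that F(2) \<tau>_in in auto)
      ultimately show ?thesis unfolding A_def C'_def by auto
    qed
    then have 1: "|A| \<le>o |C \<union> ?B|" by (rule card_of_mono1)
    have "|tr \<times> {..<d}| <o \<mu>"
    proof (cases "finite tr")
      case True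
      then show ?thesis by (intro finite_card_less[OF \<mu>] finite_cartesian_product) simp_all
    next
      case False
      then have i: "infinite (Field |tr| )" by (simp add: Field_card_of)
      have "|{..<d}| <o |tr|" by (rule finite_card_less[OF card_of_Card_order i]) simp
      then have "|tr \<times> {..<d}| \<le>o |tr|"
        using card_of_Times_ordLeq_infinite_Field[OF i card_of_refl[THEN ordIso_imp_ordLeq] _ card_of_Card_order]
          ordLess_imp_ordLeq by blast
      then show ?thesis using small ordLeq_ordLess_trans by blast
    qed
    then have "|?B| <o \<mu>" using card_of_image ordLeq_ordLess_trans by blast
    then have "|C \<union> ?B| <o \<mu>" using card_of_Un_ordLess_infinite_Field[OF \<mu>(2,1) finite_card_less[OF \<mu> C(1)]] by blast
    then show ?thesis using 1 ordLeq_ordLess_trans by blast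
  qed
  let ?a = "\<lambda>\<eta>. a (E \<eta>)"
  define TT where "TT = {(us, us', \<theta>). set us \<subseteq> I \<and> set us' \<subseteq> I \<and> length us = length us' \<and>
    dsim {..<length us} (\<lambda>s. \<tau> (us ! s)) (\<lambda>s. \<tau> (us' ! s)) \<and> \<theta> \<in> formulas L (vars m {..<length us} d C')}"
  define ins where "ins us \<theta> = map_fm id id (sub ?a (\<lambda>s. \<tau> (us ! s))) \<theta>"
    for us and \<theta> :: "('f, 'p, (nat + nat \<times> nat) + 'm) fm"
  define G1 where "G1 = map_fm id id (sub a \<tau>) ` \<Psi>"
  define G2 where "G2 = map_fm id id (sub ?a \<tau>) ` joint_tp L M C m b d a I \<rho>"
  define G3 where "G3 = (\<lambda>(us, us', \<theta>). iff_fm (ins us \<theta>) (ins us' \<theta>)) ` TT"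
  have sat_ins: "sat M [] (case_sum c id) (ins us \<theta>) = sat M [] (env c ?a (\<lambda>s. \<tau> (us ! s))) \<theta>" for c us \<theta>
    unfolding ins_def by (rule sat_sub)
  have "G1 \<union> G2 \<union> G3 \<subseteq> formulas L ({..<m} <+> A)"
  proof -
    have "map_fm id id (sub a \<tau>) \<psi> \<in> formulas L ({..<m} <+> A)" if "\<psi> \<in> \<Psi>" for \<psi>
    proof (rule map_in_formulas)
      show "\<psi> \<in> formulas L (vars m F d C)" using that \<Psi>(2) by blast
      show "sub a \<tau> ` (vars m F d C \<inter> fm_vars \<psi>) \<subseteq> {..<m} <+> A" using AC Aa' by (auto simp: sub_def)
    qed
    moreover have "map_fm id id (sub ?a \<tau>) \<psi> \<in> formulas L ({..<m} <+> A)" if "\<psi> \<in> joint_tp L M C m b d a I \<rho>" for \<psi>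
    proof (rule map_in_formulas)
      show "\<psi> \<in> formulas L (vars m I d C)" using that by (simp add: joint_tp_iff)
      show "sub ?a \<tau> ` (vars m I d C \<inter> fm_vars \<psi>) \<subseteq> {..<m} <+> A" using AC Aa by (auto simp: sub_def)
    qed
    moreover have "ins us \<theta> \<in> formulas L ({..<m} <+> A)"
      if "\<theta> \<in> formulas L (vars m {..<length us} d C')" "set us \<subseteq> I" for us \<theta>
      unfolding ins_def
    proof (rule map_in_formulas[OF that(1)])
      have "us ! s \<in> I" if "s < length us" for s using nth_mem[OF that] \<open>set us \<subseteq> I\<close> by blast
      then show "sub ?a (\<lambda>s. \<tau> (us ! s)) ` (vars m {..<length us} d C' \<inter> fm_vars \<theta>) \<subseteq> {..<m} <+> A"
        using AC Aa by (auto simp: sub_def)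
    qed
    ultimately show ?thesis unfolding G1_def G2_def G3_def TT_def by (auto simp: iff_fm_formulas)
  qed
  moreover have "consistent M m (G1 \<union> G2 \<union> G3)" unfolding consistent_def
  proof (intro allI impI)
    fix S assume S: "S \<subseteq> G1 \<union> G2 \<union> G3" "finite S"
    obtain \<Psi>2 where \<Psi>2: "\<Psi>2 \<subseteq> joint_tp L M C m b d a I \<rho>" "finite \<Psi>2" "S \<inter> G2 = map_fm id id (sub ?a \<tau>) ` \<Psi>2"
      using finite_subset_image[of "S \<inter> G2" "map_fm id id (sub ?a \<tau>)" "joint_tp L M C m b d a I \<rho>"] S(2)
      unfolding G2_def by blast
    obtain T where T: "T \<subseteq> TT" "finite T" "S \<inter> G3 = (\<lambda>(us, us', \<theta>). iff_fm (ins us \<theta>) (ins us' \<theta>)) ` T"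
      using finite_subset_image[of "S \<inter> G3" "\<lambda>(us, us', \<theta>). iff_fm (ins us \<theta>) (ins us' \<theta>)" TT] S(2)
      unfolding G3_def by blast
    have 2: "\<Psi>2 \<subseteq> formulas L (vars m I d C)" "\<forall>\<psi>\<in>\<Psi>2. sat M [] (env b a \<rho>) \<psi>"
      using \<Psi>2(1) by (auto simp: joint_tp_iff)
    have 3: "set us \<subseteq> I \<and> set us' \<subseteq> I \<and> length us = length us' \<and>
      dsim {..<length us} (\<lambda>s. \<tau> (us ! s)) (\<lambda>s. \<tau> (us' ! s)) \<and> \<theta> \<in> formulas L (vars m {..<length us} d C')"
      if "(us, us', \<theta>) \<in> T" for us us' \<theta> using that T(1) by (auto simp: TT_def)
    obtain c where c: "c ` {..<m} \<subseteq> univ M" "\<forall>\<psi>\<in>\<Psi>. sat M [] (env c a \<tau>) \<psi>"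
      "\<forall>\<psi>\<in>\<Psi>2. sat M [] (env c a (\<lambda>t. E (\<tau> t))) \<psi>"
      "\<forall>(us, us', \<theta>)\<in>T. sat M [] (env c a (\<lambda>s. E (\<tau> (us ! s)))) \<theta> = sat M [] (env c a (\<lambda>s. E (\<tau> (us' ! s)))) \<theta>"
      by (rule finite_realization[OF \<Psi>2(2) 2 T(2) 3])
    have ae: "env c ?a \<beta> = env c a (\<lambda>t. E (\<beta> t))" for \<beta> :: "'q \<Rightarrow> 'k seq" by (simp add: env_def)
    have "sat M [] (case_sum c id) \<phi>" if \<phi>: "\<phi> \<in> S" for \<phi>
    proof -
      consider "\<phi> \<in> G1" | "\<phi> \<in> S \<inter> G2" | "\<phi> \<in> S \<inter> G3" using \<phi> S(1) by blast
      then show ?thesis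
      proof cases
        case 1
        then show ?thesis using c(2) by (auto simp: G1_def sat_sub)
      next
        case 2
        then obtain \<psi> where "\<psi> \<in> \<Psi>2" "\<phi> = map_fm id id (sub ?a \<tau>) \<psi>" unfolding \<Psi>2(3) by blast
        then show ?thesis using c(3) by (simp add: sat_sub ae)
      next
        case 3
        then obtain us us' \<theta> where z: "(us, us', \<theta>) \<in> T" "\<phi> = iff_fm (ins us \<theta>) (ins us' \<theta>)" unfolding T(3) by force
        then show ?thesis using c(4) by (auto simp: sat_ins ae)
      qed
    qed
    then show "\<exists>b. b ` {..<m} \<subseteq> univ M \<and> (\<forall>\<phi>\<in>S. sat M [] (case_sum b id) \<phi>)" using c(1) by blast
  qed
  ultimately obtain b' where b': "b' ` {..<m} \<subseteq> univ M" "\<forall>\<phi>\<in>G1 \<union> G2 \<union> G3. sat M [] (case_sum b' id) \<phi>"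
    by (rule saturated_tuple[OF sat \<mu> ne Auniv Asmall])
  show ?thesis
  proof (rule that[OF b'(1)])
    have "\<forall>\<phi>\<in>G1. sat M [] (case_sum b' id) \<phi>" "\<forall>\<phi>\<in>G2. sat M [] (case_sum b' id) \<phi>" using b'(2) by blast+
    note G = this[unfolded G1_def G2_def ball_simps sat_sub]
    show "\<forall>\<psi>\<in>\<Psi>. sat M [] (env b' a \<tau>) \<psi>" by (rule G(1))
    have ae: "env b' ?a \<tau> = env b' a (\<lambda>t. E (\<tau> t))" by (simp add: env_def)
    show "\<forall>\<psi>\<in>joint_tp L M C m b d a I \<rho>. sat M [] (env b' a (\<lambda>t. E (\<tau> t))) \<psi>"
      using G(2) unfolding ae .
    show "delta_indiscernible L M \<kappa> d (b' ` {..<m} \<union> C') (\<tau> ` I) ?a" unfolding delta_indiscernible_def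
    proof (intro allI impI, elim conjE)
      fix n and \<eta> \<nu> :: "nat \<Rightarrow> 'k seq"
      assume im: "\<eta> ` {..<n} \<subseteq> \<tau> ` I" "\<nu> ` {..<n} \<subseteq> \<tau> ` I" and s: "sim_delta \<kappa> (\<tau> ` I) {..<n} \<eta> \<nu>"
      have "\<eta> ` {..<n} \<subseteq> tr" "\<nu> ` {..<n} \<subseteq> tr" using order_trans[OF im(1) \<tau>_tr] order_trans[OF im(2) \<tau>_tr] .
      from sim_delta_iff[OF this] have d: "dsim {..<n} \<eta> \<nu>" using s by simp
      define us where "us = map (\<lambda>s. idx (\<eta> s)) [0..<n]"
      define us' where "us' = map (\<lambda>s. idx (\<nu> s)) [0..<n]"
      have l: "length us = n" "length us' = n" by (simp_all add: us_def us'_def)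
      have nth: "\<tau> (us ! s) = \<eta> s" "\<tau> (us' ! s) = \<nu> s" if "s < n" for s
      proof -
        have "\<eta> s \<in> \<tau> ` I" "\<nu> s \<in> \<tau> ` I" using im that by blast+
        then show "\<tau> (us ! s) = \<eta> s" "\<tau> (us' ! s) = \<nu> s" using that idx(2) by (simp_all add: us_def us'_def)
      qed
      have "\<eta> s \<in> \<tau> ` I" "\<nu> s \<in> \<tau> ` I" if "s < n" for s using im that by blast+
      then have sub: "set us \<subseteq> I" "set us' \<subseteq> I" using idx(1) by (auto simp: us_def us'_def)
      have "dsim {..<n} (\<lambda>s. \<tau> (us ! s)) (\<lambda>s. \<tau> (us' ! s)) = dsim {..<n} \<eta> \<nu>"
        by (rule dsim_cong) (simp_all add: nth)
      then have d': "dsim {..<n} (\<lambda>s. \<tau> (us ! s)) (\<lambda>s. \<tau> (us' ! s))" using d by simp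
      \<comment> \<open>Coordinates of \<open>b'\<close> used as parameters turn back into variables
        \<open>y\<close>, since the formulas in \<open>TT\<close> have parameters from
        \<open>C'\<close> only; a coordinate that lies in \<open>C'\<close> stays a
        parameter.\<close>
      define gg :: "nat \<times> nat + 'm \<Rightarrow> (nat + nat \<times> nat) + 'm" where
        "gg = case_sum (\<lambda>z. Inl (Inr z)) (\<lambda>c. if c \<in> C' then Inr c else Inl (Inl (SOME i. i < m \<and> b' i = c)))"
      have some: "(SOME i. i < m \<and> b' i = c) < m \<and> b' (SOME i. i < m \<and> b' i = c) = c" if "c \<in> b' ` {..<m}" for c
      proof -
        have "\<exists>i. i < m \<and> b' i = c" using that by blast
        then show ?thesis by (rule someI_ex)
      qed
      have "sat M [] (case_sum (\<lambda>(s, i). ?a (\<eta> s) i) id) \<phi> = sat M [] (case_sum (\<lambda>(s, i). ?a (\<nu> s) i) id) \<phi>"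
        if \<phi>: "\<phi> \<in> formulas L (({..<n} \<times> {..<d}) <+> (b' ` {..<m} \<union> C'))" for \<phi>
      proof -
        let ?\<theta> = "map_fm id id gg \<phi>"
        have \<theta>: "?\<theta> \<in> formulas L (vars m {..<n} d C')"
        proof (rule map_in_formulas[OF \<phi>], rule image_subsetI)
          fix v assume "v \<in> (({..<n} \<times> {..<d}) <+> (b' ` {..<m} \<union> C')) \<inter> fm_vars \<phi>"
          then show "gg v \<in> vars m {..<n} d C'" using some by (cases v) (auto simp: gg_def)
        qed
        have eq: "sat M [] (case_sum (\<lambda>(s, i). ?a (\<alpha> s) i) id) \<phi> = sat M [] (env b' ?a (\<lambda>s. \<tau> (ws ! s))) ?\<theta>"
          if w: "\<And>s. s < n \<Longrightarrow> \<tau> (ws ! s) = \<alpha> s" for \<alpha> ws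
          unfolding sat_map
        proof (rule sat_formulas_cong[OF \<phi>])
          fix v assume "v \<in> ({..<n} \<times> {..<d}) <+> (b' ` {..<m} \<union> C')"
          then show "case_sum (\<lambda>(s, i). ?a (\<alpha> s) i) id v = (env b' ?a (\<lambda>s. \<tau> (ws ! s)) \<circ> gg) v"
            using some w by (cases v) (auto simp: gg_def)
        qed
        have "(us, us', ?\<theta>) \<in> TT" using sub l d' \<theta> by (simp add: TT_def)
        then have "iff_fm (ins us ?\<theta>) (ins us' ?\<theta>) \<in> G3" unfolding G3_def by force
        then have "sat M [] (case_sum b' id) (iff_fm (ins us ?\<theta>) (ins us' ?\<theta>))" using b'(2) by blast
        then show ?thesis using eq[of us \<eta>, OF nth(1)] eq[of us' \<nu>, OF nth(2)] by (simp add: sat_ins)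
      qed
      then show "tp L M (b' ` {..<m} \<union> C') ({..<n} \<times> {..<d}) (\<lambda>(s, i). ?a (\<eta> s) i) =
          tp L M (b' ` {..<m} \<union> C') ({..<n} \<times> {..<d}) (\<lambda>(s, i). ?a (\<nu> s) i)"
        unfolding tp_def by blast
    qed
  qed
qed

text \<open>The given family is applied to the shifted tree, with base set \<open>C'\<close> and
  tuple \<open>b1\<close>. As the coordinates of \<open>\<tau>\<close> on \<open>F\<close> are
  parameters there, the type of \<open>b1\<close> remembers \<open>\<Psi>\<close> on
  \<open>\<tau>\<close> (through \<open>inst0\<close>); hence a tuple that works for all shifted
  antichains still satisfies \<open>\<Psi>\<close> on \<open>\<tau>\<close>.\<close>

lemma simultaneous_realization:
  assumes sat: "saturated L \<mu> M" and \<mu>: "Card_order \<mu>" "infinite (Field \<mu>)" and small: "|tr| <o \<mu>"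
    and coll: "collapsible L M \<kappa> n I X'" and X'0: "X' 0 = \<tau>"
  obtains b' where "b' ` {..<m} \<subseteq> univ M" "\<forall>\<psi>\<in>\<Psi>. sat M [] (env b' a \<tau>) \<psi>"
    "\<forall>j\<le>n. \<forall>\<psi>\<in>\<Psi>. sat M [] (env b' a (\<lambda>t. E (X' j t))) \<psi>"
proof -
  let ?a = "\<lambda>\<eta>. a (E \<eta>)"
  obtain b1 where b1: "b1 ` {..<m} \<subseteq> univ M" "\<forall>\<psi>\<in>\<Psi>. sat M [] (env b1 a \<tau>) \<psi>"
    "\<forall>\<psi>\<in>joint_tp L M C m b d a I \<rho>. sat M [] (env b1 a (\<lambda>t. E (\<tau> t))) \<psi>"
    "delta_indiscernible L M \<kappa> d (b1 ` {..<m} \<union> C') (\<tau> ` I) ?a"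
    by (rule full_realization[OF sat \<mu> small])
  let ?q = "joint_tp L M C' m b1 d ?a I (X' 0)"
  have "\<forall>\<eta>\<in>tr. ?a \<eta> ` {..<d} \<subseteq> univ M" using a E_tree by blast
  then have hyp: "C' \<subseteq> univ M \<and> b1 ` {..<m} \<subseteq> univ M \<and> (\<forall>\<eta>\<in>tr. ?a \<eta> ` {..<d} \<subseteq> univ M) \<and>
      strongly_indiscernible L M \<kappa> d C' ?a \<and> delta_indiscernible L M \<kappa> d (b1 ` {..<m} \<union> C') (X' 0 ` I) ?a"
    using C'_univ b1(1,4) shifted_strongly_indiscernible unfolding X'0 by blast
  have con: "consistent M m (\<Union>j\<le>n. plug ?a (X' j) ?q)"
    using conjunct2[OF coll[unfolded collapsible_def], THEN spec, of C', THEN spec, of m, THEN spec, of b1,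
        THEN spec, of d, THEN spec, of ?a, THEN spec, of 0, THEN mp, OF le0, THEN mp, OF hyp] bad by simp
  define inst0 :: "('f, 'p, (nat + 'i \<times> nat) + 'm) fm \<Rightarrow> ('f, 'p, (nat + 'i \<times> nat) + 'm) fm" where "inst0 = map_fm id id (case_sum (case_sum (\<lambda>i. Inl (Inl i)) (\<lambda>(t, i). Inr (a (\<tau> t) i))) Inr)"
  have inst0_sat: "sat M [] (env c ?a \<beta>) (inst0 \<psi>) = sat M [] (env c a \<tau>) \<psi>" for c \<psi> and \<beta> :: "'i \<Rightarrow> 'k seq"
    unfolding inst0_def sat_map by (rule sat_cong) (auto simp: env_def split: sum.splits)
  have inst0_q: "inst0 \<psi> \<in> ?q" if "\<psi> \<in> \<Psi>" for \<psi>
  proof -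
    have \<psi>: "\<psi> \<in> formulas L (vars m F d C)" using that \<Psi>(2) by blast
    have "inst0 \<psi> \<in> formulas L (vars m I d C')" unfolding inst0_def
    proof (rule map_in_formulas[OF \<psi>], rule image_subsetI)
      fix v assume "v \<in> vars m F d C \<inter> fm_vars \<psi>"
      then have "v \<in> vars m F d C" by simp
      moreover have "a (\<tau> t) i \<in> C'" if "t \<in> F" "i < d" for t i using that by (force simp: C'_def)
      moreover have "C \<subseteq> C'" by (auto simp: C'_def)
      ultimately show "case_sum (case_sum (\<lambda>i. Inl (Inl i)) (\<lambda>(t, i). Inr (a (\<tau> t) i))) Inr v \<in> vars m I d C'" by auto
    qed
    then show ?thesis using b1(2) that by (simp add: joint_tp_iff inst0_sat)
  qed
  have \<Psi>_q: "\<psi> \<in> ?q" if "\<psi> \<in> \<Psi>" for \<psi>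
  proof -
    have "\<psi> \<in> formulas L (vars m I d C)"
      by (rule formulas_mono[of _ _ "vars m F d C"]) (use that \<Psi>(2) F(2) in auto)
    then have "\<psi> \<in> joint_tp L M C m b d a I \<rho>" using \<Psi>(3)[OF that] by (simp add: joint_tp_iff)
    then have "sat M [] (env b1 a (\<lambda>t. E (\<tau> t))) \<psi>" using b1(3) by blast
    then have "sat M [] (env b1 ?a (X' 0)) \<psi>" by (simp add: env_def X'0)
    moreover have "\<psi> \<in> formulas L (vars m I d C')"
      by (rule formulas_mono[OF \<open>\<psi> \<in> formulas L (vars m I d C)\<close>]) (auto simp: C'_def)
    ultimately show ?thesis by (simp add: joint_tp_iff)
  qed
  let ?S = "(\<lambda>(j, \<psi>). map_fm id id (sub ?a (X' j)) \<psi>) ` ({..n} \<times> \<Psi>) \<union> (\<lambda>\<psi>. map_fm id id (sub ?a (X' 0)) (inst0 \<psi>)) ` \<Psi>"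
  have Sfin: "finite ?S" using \<Psi>(1) by simp
  have Ssub: "?S \<subseteq> (\<Union>j\<le>n. plug ?a (X' j) ?q)"
    using \<Psi>_q inst0_q unfolding plug_eq by fastforce
  have "\<exists>b'. b' ` {..<m} \<subseteq> univ M \<and> (\<forall>\<phi>\<in>?S. sat M [] (case_sum b' id) \<phi>)"
    by (rule mp[OF mp[OF spec[OF con[unfolded consistent_def]] Ssub] Sfin])
  then obtain b' where "b' ` {..<m} \<subseteq> univ M \<and> (\<forall>\<phi>\<in>?S. sat M [] (case_sum b' id) \<phi>)" ..
  note b' = conjunct1[OF this] conjunct2[OF this]
  show ?thesis
  proof (rule that[OF b'(1)])
    show "\<forall>\<psi>\<in>\<Psi>. sat M [] (env b' a \<tau>) \<psi>"
    proof
      fix \<psi> assume "\<psi> \<in> \<Psi>"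
      then have "sat M [] (case_sum b' id) (map_fm id id (sub ?a (X' 0)) (inst0 \<psi>))" using b'(2) by blast
      then show "sat M [] (env b' a \<tau>) \<psi>" unfolding sat_sub inst0_sat .
    qed
    show "\<forall>j\<le>n. \<forall>\<psi>\<in>\<Psi>. sat M [] (env b' a (\<lambda>t. E (X' j t))) \<psi>"
    proof (intro allI impI ballI)
      fix j \<psi> assume "j \<le> n" "\<psi> \<in> \<Psi>"
      then have "map_fm id id (sub ?a (X' j)) \<psi> \<in> ?S" by force
      then have "sat M [] (case_sum b' id) (map_fm id id (sub ?a (X' j)) \<psi>)" using b'(2) by blast
      then have "sat M [] (env b' ?a (X' j)) \<psi>" unfolding sat_sub .
      then show "sat M [] (env b' a (\<lambda>t. E (X' j t))) \<psi>" by (simp add: env_def)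
    qed
  qed
qed

end

lemma tp_mono: "tp L M C I a = tp L M C I a' \<Longrightarrow> C0 \<subseteq> C \<Longrightarrow> tp L M C0 I a = tp L M C0 I a'"
proof -
  assume t: "tp L M C I a = tp L M C I a'" and C: "C0 \<subseteq> C"
  have "tp L M C0 I a = tp L M C I a \<inter> formulas L (I <+> C0)" for a
    using formulas_mono[of _ L "I <+> C0" "I <+> C"] C unfolding tp_def by blast
  then show ?thesis using t by simp
qed

lemma strongly_indiscernible_mono:
  "strongly_indiscernible L M \<kappa> d C a \<Longrightarrow> C0 \<subseteq> C \<Longrightarrow> strongly_indiscernible L M \<kappa> d C0 a"
  unfolding strongly_indiscernible_def using tp_mono by metis

lemma delta_indiscernible_mono:
  "delta_indiscernible L M \<kappa> d C X a \<Longrightarrow> C0 \<subseteq> C \<Longrightarrow> delta_indiscernible L M \<kappa> d C0 X a"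
  unfolding delta_indiscernible_def using tp_mono by metis

context card_tree begin

lemma universal_antichain_ext:
  assumes p: "p \<in> tr" and Y: "universal_antichain \<kappa> Y"
  shows "universal_antichain \<kappa> (ext p ` Y)"
  unfolding universal_antichain_def
proof (intro conjI allI impI)
  have Ya: "antichain \<kappa> Y" using Y unfolding universal_antichain_def by (rule conjunct1)
  then have Yt: "Y \<subseteq> tr" by (simp add: antichain_def)
  show "antichain \<kappa> (ext p ` Y)" unfolding antichain_def
  proof (intro conjI ballI impI)
    show "ext p ` Y \<subseteq> tr" using Yt ext_tree[OF p] by blast
    fix x y assume "x \<in> ext p ` Y" "y \<in> ext p ` Y" and ne: "x \<noteq> y"
    then obtain x' y' where xy: "x' \<in> Y" "y' \<in> Y" "x = ext p x'" "y = ext p y'" by blast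
    have "x' \<in> tr" "y' \<in> tr" using xy Yt by auto
    moreover have "x' \<noteq> y'" using xy ne by auto
    then have "incomparable x' y'" using Ya xy(1,2) unfolding antichain_def by simp
    ultimately show "incomparable x y" using xy ext_incomparable[OF p] by simp
  qed
  fix Z assume Z: "antichain \<kappa> Z \<and> finite Z"
  obtain h where h: "h ` Z \<subseteq> Y" "dsim Z (\<lambda>y. y) h" by (rule universal_embed[OF Y conjunct1[OF Z] conjunct2[OF Z]])
  have Zt: "Z \<subseteq> tr" using Z by (simp add: antichain_def)
  have ht: "h ` Z \<subseteq> tr" using h(1) Yt by blast
  have "dsim Z id (\<lambda>z. ext p (h z))" using dsim_trans[OF h(2) dsim_sym[OF dsim_ext[OF p ht]]] by (simp add: id_def)
  moreover have "(\<lambda>z. ext p (h z)) ` Z \<subseteq> tr" using ht ext_tree[OF p] by blast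
  ultimately have "sim0 \<kappa> Z id (\<lambda>z. ext p (h z))" using sim0_iff[of id Z] Zt by simp
  then show "\<exists>h. h ` Z \<subseteq> ext p ` Y \<and> sim0 \<kappa> Z id h" using h(1) by (intro exI[of _ "\<lambda>z. ext p (h z)"]) auto
qed

text \<open>A finite part of the union involves finitely many indices \<open>F\<close> and
  parameters \<open>C0\<close>. Cutting \<open>C\<close> down to \<open>C0\<close> makes saturation
  usable, and both kinds of indiscernibility pass to smaller base sets. The index \<open>i\<close>
  may be any, since all members have the same quantifier-free type and only that type links
  \<open>X i\<close> to \<open>X' 0\<close>.\<close>

lemma collapsible_extend:
  fixes M :: "('f, 'p, 'm) struct" and I :: "'i set" and X' :: "nat \<Rightarrow> 'i \<Rightarrow> 'k seq"
  assumes ne: "univ M \<noteq> {}" and sat: "saturated L \<mu> M" and \<mu>: "Card_order \<mu>" "infinite (Field \<mu>)"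
    and small: "|tr| <o \<mu>" and coll: "collapsible L M \<kappa> n I X'"
  shows "\<exists>X. collapsible L M \<kappa> (Suc n) I X \<and>
    (\<exists>\<chi>\<in>X (Suc n) ` I. \<exists>\<chi>'\<in>tr. \<chi> \<subseteq>\<^sub>m \<chi>' \<and> (\<forall>j\<le>n. \<forall>t\<in>I. X j t = cat \<kappa> \<chi>' (X' j t)))"
proof -
  have X': "universal_antichain \<kappa> (X' j ` I)" "inj_on (X' j) I" "sim0 \<kappa> I (X' 0) (X' j)" if "j \<le> n" for j
    using conjunct1[OF coll[unfolded collapsible_def]] that by blast+
  have X't: "X' j ` I \<subseteq> tr" if "j \<le> n" for j using X'(1)[OF that] unfolding universal_antichain_def antichain_def by blast
  \<comment> \<open>A universal antichain contains a copy of the one-point antichain and so is not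
    empty.\<close>
  have "antichain \<kappa> {Map.empty}" using empty_tree by (simp add: antichain_def)
  then obtain h :: "'k seq \<Rightarrow> 'k seq" where "h ` {Map.empty} \<subseteq> X' 0 ` I" by (rule universal_embed[OF X'(1)[OF le0]]) simp_all
  then obtain t0 where t0: "t0 \<in> I" by blast
  have \<chi>: "X' 0 t0 \<in> tr" using X't[OF le0] t0 by blast
  define \<chi>' where "\<chi>' = branch (X' 0 t0) False"
  have \<chi>': "\<chi>' \<in> tr" unfolding \<chi>'_def by (rule branch(1)[OF \<chi>])
  define X where "X j = (if j \<le> n then (\<lambda>t. ext \<chi>' (X' j t)) else X' 0)" for j
  have d0: "dsim I (X' 0) (X j)" if "j \<le> Suc n" for j
  proof (cases "j \<le> n")
    case True
    have "dsim I (X' 0) (X' j)" using X'(3)[OF True] sim0_iff[OF X't[OF le0] X't[OF True]] by simp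
    then show ?thesis using dsim_trans[OF _ dsim_sym[OF dsim_ext[OF \<chi>' X't[OF True]]]] True by (simp add: X_def)
  qed (simp add: X_def)
  have Xu: "universal_antichain \<kappa> (X j ` I)" for j
  proof (cases "j \<le> n")
    case True
    then have "X j ` I = ext \<chi>' ` X' j ` I" by (auto simp: X_def)
    then show ?thesis using universal_antichain_ext[OF \<chi>' X'(1)[OF True]] by simp
  qed (use X'(1)[OF le0] in \<open>simp add: X_def\<close>)
  have Xt: "X j ` I \<subseteq> tr" for j using Xu unfolding universal_antichain_def antichain_def by blast
  have Xi: "inj_on (X j) I" if "j \<le> Suc n" for j
  proof (rule inj_onI)
    fix s t assume st: "s \<in> I" "t \<in> I" "X j s = X j t"
    then have "X' 0 s = X' 0 t" using dsim_eq[OF d0[OF that] X't[OF le0] Xt st(1,2)] by simp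
    then show "s = t" using X'(2)[OF le0] st unfolding inj_on_def by blast
  qed
  have Xs: "sim0 \<kappa> I (X 0) (X j)" if "j \<le> Suc n" for j
    using sim0_iff[OF Xt Xt] dsim_trans[OF dsim_sym[OF d0[OF le0]] d0[OF that]] by blast
  have main: "consistent M m (\<Union>j\<le>Suc n. plug a (X j) (joint_tp L M C m b d a I (X i)))"
    if i: "i \<le> Suc n" and h: "C \<subseteq> univ M" "b ` {..<m} \<subseteq> univ M" "\<forall>\<eta>\<in>tr. a \<eta> ` {..<d} \<subseteq> univ M"
      "strongly_indiscernible L M \<kappa> d C a" "delta_indiscernible L M \<kappa> d (b ` {..<m} \<union> C) (X i ` I) a"
      and bad: "\<not> (\<exists>k \<phi>. witnesses_ATP L M m k \<phi>)" for C m b d a i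
    unfolding consistent_def
  proof (intro allI impI)
    let ?p = "joint_tp L M C m b d a I (X i)"
    fix S assume S: "S \<subseteq> (\<Union>j\<le>Suc n. plug a (X j) ?p)" "finite S"
    have "S \<subseteq> (\<lambda>(j, \<psi>). map_fm id id (sub a (X j)) \<psi>) ` ({..Suc n} \<times> ?p)"
      using S(1) unfolding plug_eq by fastforce
    from finite_subset_image[OF S(2) this] obtain P where P: "P \<subseteq> {..Suc n} \<times> ?p" "finite P"
      "S = (\<lambda>(j, \<psi>). map_fm id id (sub a (X j)) \<psi>) ` P" by blast
    define \<Psi> where "\<Psi> = snd ` P"
    have \<Psi>p: "\<Psi> \<subseteq> ?p" "finite \<Psi>" using P by (auto simp: \<Psi>_def)
    define VV where "VV = (\<Union>\<psi>\<in>\<Psi>. fm_vars \<psi>)"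
    have VV: "finite VV" using \<Psi>p(2) finite_fm_vars by (auto simp: VV_def)
    have VVs: "VV \<subseteq> vars m I d C" using \<Psi>p(1) by (fastforce simp: VV_def joint_tp_iff formulas_def)
    define F where "F = insert t0 {t. \<exists>i. Inl (Inr (t, i)) \<in> VV}"
    define C0 where "C0 = {c. Inr c \<in> VV}"
    have "{t. \<exists>i. Inl (Inr (t, i)) \<in> VV} \<subseteq> (\<lambda>v. case v of Inl (Inr (t, i)) \<Rightarrow> t | _ \<Rightarrow> undefined) ` VV" by force
    from finite_subset[OF this finite_imageI[OF VV]] have F: "finite F" "F \<subseteq> I" "t0 \<in> F"
      using VVs t0 by (auto simp: F_def)
    have C0: "finite C0" "C0 \<subseteq> C"
    proof -
      have "C0 = Inr -` VV" by (auto simp: C0_def)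
      then show "finite C0" using finite_vimageI[OF VV, of Inr] by (simp add: inj_on_def)
      show "C0 \<subseteq> C" using VVs by (auto simp: C0_def)
    qed
    have \<Psi>f: "\<Psi> \<subseteq> formulas L (vars m F d C0)"
    proof
      fix \<psi> assume \<psi>: "\<psi> \<in> \<Psi>"
      then have w: "wf_fm L 0 \<psi>" using \<Psi>p(1) by (auto simp: joint_tp_iff formulas_def)
      have "v \<in> vars m F d C0" if "v \<in> fm_vars \<psi>" for v
      proof -
        have v: "v \<in> VV" using \<psi> that by (auto simp: VV_def)
        then have "v \<in> vars m I d C" using VVs by blast
        then show ?thesis using v by (auto simp: F_def C0_def)
      qed
      then show "\<psi> \<in> formulas L (vars m F d C0)" using w by (auto simp: formulas_def)
    qed
    interpret collapse_step \<kappa> L M C0 m d b a I "X i" "X' 0" t0 F \<Psi>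
    proof
      show "univ M \<noteq> {}" by (rule ne)
      show "finite C0" "C0 \<subseteq> univ M" using C0 h(1) by auto
      show "b ` {..<m} \<subseteq> univ M" by (rule h(2))
      show "a \<eta> i \<in> univ M" if "\<eta> \<in> tr" "i < d" for \<eta> i using h(3) that by blast
      show "strongly_indiscernible L M \<kappa> d C0 a" by (rule strongly_indiscernible_mono[OF h(4) C0(2)])
      show "universal_antichain \<kappa> (X i ` I)" by (rule Xu)
      show "delta_indiscernible L M \<kappa> d (b ` {..<m} \<union> C0) (X i ` I) a"
        by (rule delta_indiscernible_mono[OF h(5)]) (use C0(2) in blast)
      show "universal_antichain \<kappa> (X' 0 ` I)" "inj_on (X' 0) I" by (rule X'[OF le0])+
      show "dsim I (X i) (X' 0)" by (rule dsim_sym[OF d0[OF i]])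
      show "finite F" "F \<subseteq> I" "t0 \<in> F" by (fact F)+
      show "finite \<Psi>" by (rule \<Psi>p(2))
      show "\<Psi> \<subseteq> formulas L (vars m F d C0)" by (rule \<Psi>f)
      show "sat M [] (env b a (X i)) \<psi>" if "\<psi> \<in> \<Psi>" for \<psi> using that \<Psi>p(1) by (auto simp: joint_tp_iff)
      show "\<not> (\<exists>k \<phi>. witnesses_ATP L M m k \<phi>)" by (rule bad)
    qed
    obtain b' where b': "b' ` {..<m} \<subseteq> univ M" "\<forall>\<psi>\<in>\<Psi>. sat M [] (env b' a (X' 0)) \<psi>"
      "\<forall>j\<le>n. \<forall>\<psi>\<in>\<Psi>. sat M [] (env b' a (\<lambda>t. ext \<chi>' (X' j t))) \<psi>"
      unfolding \<chi>'_def by (rule simultaneous_realization[OF sat \<mu> small coll refl])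
    have "sat M [] (case_sum b' id) \<phi>" if \<phi>: "\<phi> \<in> S" for \<phi>
    proof -
      obtain j \<psi> where j: "(j, \<psi>) \<in> P" "\<phi> = map_fm id id (sub a (X j)) \<psi>" using \<phi> unfolding P(3) by (elim imageE) force
      have \<psi>: "\<psi> \<in> \<Psi>" using j(1) by (force simp: \<Psi>_def)
      have "sat M [] (env b' a (X j)) \<psi>" using b'(2,3) \<psi> by (cases "j \<le> n") (simp_all add: X_def)
      then show ?thesis unfolding j(2) sat_sub .
    qed
    then show "\<exists>b. b ` {..<m} \<subseteq> univ M \<and> (\<forall>\<phi>\<in>S. sat M [] (case_sum b id) \<phi>)" using b'(1) by blast
  qed
  have X_coll: "collapsible L M \<kappa> (Suc n) I X" unfolding collapsible_def
  proof (intro conjI allI impI)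
    fix j assume "j \<le> Suc n"
    then show "universal_antichain \<kappa> (X j ` I)" "inj_on (X j) I" "sim0 \<kappa> I (X 0) (X j)" using Xu Xi Xs by simp_all
  next
    fix C :: "'m set" and m :: nat and b :: "nat \<Rightarrow> 'm" and d :: nat and a :: "'k seq \<Rightarrow> nat \<Rightarrow> 'm" and i
    assume "i \<le> Suc n" and "C \<subseteq> univ M \<and> b ` {..<m} \<subseteq> univ M \<and> (\<forall>\<eta>\<in>tr. a \<eta> ` {..<d} \<subseteq> univ M) \<and>
      strongly_indiscernible L M \<kappa> d C a \<and> delta_indiscernible L M \<kappa> d (b ` {..<m} \<union> C) (X i ` I) a"
    then show "consistent M m (\<Union>j\<le>Suc n. plug a (X j) (joint_tp L M C m b d a I (X i))) \<or> (\<exists>k \<phi>. witnesses_ATP L M m k \<phi>)"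
      using main[of i C b m a d] by blast
  qed
  have in_X: "X' 0 t0 \<in> X (Suc n) ` I" using t0 by (simp add: X_def)
  have below: "X' 0 t0 \<subseteq>\<^sub>m \<chi>'" unfolding \<chi>'_def by (rule branch(2)[OF \<chi>])
  have "X j t = cat \<kappa> \<chi>' (X' j t)" if "j \<le> n" "t \<in> I" for j t
  proof -
    have "X' j t \<in> tr" using X't[OF that(1)] that(2) by blast
    then show ?thesis using cat_ext[OF \<chi>'] that(1) by (simp add: X_def)
  qed
  then have "X' 0 t0 \<subseteq>\<^sub>m \<chi>' \<and> (\<forall>j\<le>n. \<forall>t\<in>I. X j t = cat \<kappa> \<chi>' (X' j t))" using below by simp
  then show ?thesis
    by (intro exI[of _ X] conjI X_coll, intro bexI[OF _ in_X], intro bexI[OF _ \<chi>'])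
qed

end

lemma infinite_formulas: "infinite (formulas L (UNIV :: nat set) :: ('f, 'p, nat) fm set)"
proof -
  have "inj (\<lambda>n. Eq (Free n) (Free n) :: ('f, 'p, nat) fm)" by (simp add: inj_def)
  then have "infinite (range (\<lambda>n. Eq (Free n) (Free n) :: ('f, 'p, nat) fm))" by (rule range_inj_infinite)
  moreover have "range (\<lambda>n. Eq (Free n) (Free n)) \<subseteq> formulas L UNIV" by (auto simp: formulas_def)
  ultimately show ?thesis by (rule infinite_super[rotated])
qed

lemma infinite_Field:
  assumes "Card_order r" "infinite A" "|A| \<le>o r"
  shows "infinite (Field r)"
proof -
  have "|A| \<le>o |Field r|" using ordLeq_ordIso_trans[OF assms(3) ordIso_symmetric[OF card_of_Field_ordIso[OF assms(1)]]] .
  then show ?thesis using card_of_ordLeq_infinite assms(2) by blast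
qed

theorem lemma3p16:
  fixes L :: "('f, 'p) lang" and T :: "('f, 'p, nat) fm set"
  assumes "complete_theory L T"
  shows "\<exists>\<kappa>0 :: ('f, 'p, nat) fm set set rel. Card_order \<kappa>0 \<and>
    (\<forall>(\<kappa> :: 'k rel) (\<mu> :: 'l rel) (M :: ('f, 'p, 'm) struct) n (I :: 'i set) X'.
       Card_order \<kappa> \<and> \<kappa>0 \<le>o \<kappa> \<and> monster_model L T \<mu> M \<and> |tree \<kappa>| <o \<mu> \<and>
       collapsible L M \<kappa> n I X' \<longrightarrow>
         (\<exists>X. collapsible L M \<kappa> (Suc n) I X \<and>
            (\<exists>\<chi>\<in>X (Suc n) ` I. \<exists>\<chi>'\<in>tree \<kappa>. \<chi> \<subseteq>\<^sub>m \<chi>' \<and>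
               (\<forall>j\<le>n. \<forall>t\<in>I. X j t = cat \<kappa> \<chi>' (X' j t)))))"
proof -
  have inf: "infinite (UNIV :: ('f, 'p, nat) fm set set set)"
  proof -
    have "infinite (UNIV :: ('f, 'p, nat) fm set)" using infinite_formulas finite_subset[OF subset_UNIV] by blast
    then have "infinite (Pow (Pow (UNIV :: ('f, 'p, nat) fm set)))" unfolding finite_Pow_iff .
    then show ?thesis unfolding Pow_UNIV .
  qed
  show ?thesis
  \<comment> \<open>The cardinal of the whole carrier type is taken for \<open>\<kappa>0\<close>;
    what is drawn from it is that \<open>\<kappa>\<close> is infinite.\<close>
  proof (intro exI[of _ "|UNIV|"] conjI allI impI card_of_Card_order, elim conjE)
    fix \<kappa> :: "'k rel" and \<mu> :: "'l rel" and M :: "('f, 'p, 'm) struct" and n and I :: "'i set" and X'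
    assume \<kappa>: "Card_order \<kappa>" "|UNIV :: ('f, 'p, nat) fm set set set| \<le>o \<kappa>" and M: "monster_model L T \<mu> M"
      and small: "|tree \<kappa>| <o \<mu>" and coll: "collapsible L M \<kappa> n I X'"
    interpret card_tree \<kappa> by unfold_locales (rule \<kappa>(1), rule infinite_Field[OF \<kappa>(1) inf \<kappa>(2)])
    have m: "univ M \<noteq> {}" "Card_order \<mu>" "saturated L \<mu> M"
      "|formulas L (UNIV :: nat set) :: ('f, 'p, nat) fm set| <o \<mu>"
      using M by (auto simp: monster_model_def models_def is_struct_def)
    have "infinite (Field \<mu>)" by (rule infinite_Field[OF m(2) infinite_formulas ordLess_imp_ordLeq[OF m(4)]])
    from collapsible_extend[OF m(1,3,2) this small coll]
    show "\<exists>X. collapsible L M \<kappa> (Suc n) I X \<and>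
      (\<exists>\<chi>\<in>X (Suc n) ` I. \<exists>\<chi>'\<in>tree \<kappa>. \<chi> \<subseteq>\<^sub>m \<chi>' \<and> (\<forall>j\<le>n. \<forall>t\<in>I. X j t = cat \<kappa> \<chi>' (X' j t)))" .
  qed
qed

end
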